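(* For every fixed $c$ with $0<c<1$ there is a sufficiently large constant $K$ such that the following holds for all integers $k\ge 2$ and $n\ge k^{Kk}$. Let $\epsilon=n^{-c}$. Let $X$ and $Y$ be $(n,k)$-PMDs with $X=\sum_{i=1}^k X^i$ and $Y=\sum_{i=1}^k Y^i$, where each $X^i$ and each $Y^i$ is an $i$-maximal PMD. Let $\Sigma$ and $\Sigma'$ denote the covariance matrices of $X$ and $Y$ respectively. Suppose that all eigenvalues of $\Sigma$ but one, and all eigenvalues of $\Sigma'$ but one, are at least $\epsilon n/k$, and that for every $i\in[k]$, every integer $\ell\le\frac{2+2c}{1-c}$, and every $m\in\mathbb{Z}_{\ge 0}^k$ of degree $\|m\|_1=\ell$, $$|M_m(X^i)-M_m(Y^i)|\le n^{-c}.$$ Then $d_{\mathrm{TV}}(X,Y)\le\epsilon$.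
   Context: A $k$-categorical random variable ($k$-CRV) is a random vector supported on the standard basis vectors $\{e_1,\dots,e_k\}$ of $\mathbb{R}^k$. A $k$-CRV is $i$-maximal if $e_i$ is its most likely outcome, ties being broken in favour of the smallest index. An $(n,k)$-Poisson multinomial distribution, or $(n,k)$-PMD, is (the law of) a sum $X=\sum_{r=1}^n X_r$ of $n$ independent $k$-CRVs. In the decomposition $X=\sum_{i=1}^k X^i$, the component $X^i=\sum_{r\in A_i}X_r$ is the sum of the $i$-maximal CRVs among the $X_r$, with $A_i\subseteq[n]$ the set of indices $r$ for which $X_r$ is $i$-maximal (an $i$-maximal PMD is a sum of independent $i$-maximal $k$-CRVs); similarly for $Y$. For a PMD $Z=\sum_{r\in A}Z_r$ with $p_{r,j}=\Pr[Z_r=e_j]$ and for $m=(m_1,\dots,m_k)\in\mathbb{Z}_{\ge 0}^k$, the $m$-th parameter moment is $M_m(Z)=\sum_{r\in A}\prod_{j=1}^k p_{r,j}^{m_j}$ (with $0^0=1$), and its degree is $\|m\|_1=\sum_{j}m_j$. $d_{\mathrm{TV}}(P,Q)=\max_{S}|P(S)-Q(S)|=\frac12\|P-Q\|_1$ is total variation distance. The covariance matrix of an $(n,k)$-PMD always has eigenvalue $0$ with eigenvector $(1,\dots,1)$, because the coordinates sum to $n$; "all eigenvalues but one" are counted with multiplicity. *)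

theory Defs
  imports
    "HOL-Probability.Product_PMF"
    "HOL-Computational_Algebra.Fundamental_Theorem_Algebra"
    "Jordan_Normal_Form.Char_Poly"
begin

unbundle no vec_syntax

text \<open>
  Since \<open>k\<close> and \<open>n\<close> are quantified inside the theorem, vectors in \<open>\<real>\<^sup>k\<close> and \<open>k \<times> k\<close> matrices
  are those of Jordan_Normal_Form, whose dimension is a natural number. Coordinates and
  summands are numbered from \<open>0\<close>, so \<open>e\<^sub>1, \<dots>, e\<^sub>k\<close> are \<open>unit_vec k 0, \<dots>, unit_vec k (k - 1)\<close>.
  A random vector enters only through its law, so a categorical random variable is given by a
  \<open>pmf\<close>, and a family of independent ones by a family of \<open>pmf\<close>s.
\<close>

definition categorical :: "nat \<Rightarrow> real vec pmf \<Rightarrow> bool" where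
  "categorical k p \<longleftrightarrow> set_pmf p \<subseteq> unit_vec k ` {..<k}"

definition maximal :: "nat \<Rightarrow> nat \<Rightarrow> real vec pmf \<Rightarrow> bool" where
  "maximal k i p \<longleftrightarrow> i < k \<and>
     (\<forall>j<k. pmf p (unit_vec k j) \<le> pmf p (unit_vec k i)) \<and>
     (\<forall>j<i. pmf p (unit_vec k j) < pmf p (unit_vec k i))"

text \<open>
  The law of \<open>\<Sum>r\<in>A. X\<^sub>r\<close> for independent \<open>X\<^sub>r\<close> with laws \<open>P r\<close>. The second argument of
  \<open>Pi_pmf\<close> is only the value taken outside \<open>A\<close>.
\<close>

definition pmd :: "nat \<Rightarrow> nat set \<Rightarrow> (nat \<Rightarrow> real vec pmf) \<Rightarrow> real vec pmf" where
  "pmd k A P = map_pmf (\<lambda>x. finsum_vec TYPE(real) k x A) (Pi_pmf A (0\<^sub>v k) P)"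

definition maximal_indices :: "nat \<Rightarrow> nat \<Rightarrow> (nat \<Rightarrow> real vec pmf) \<Rightarrow> nat \<Rightarrow> nat set" where
  "maximal_indices n k P i = {r. r < n \<and> maximal k i (P r)}"

definition parameter_moment ::
    "nat \<Rightarrow> nat set \<Rightarrow> (nat \<Rightarrow> real vec pmf) \<Rightarrow> nat vec \<Rightarrow> real" where
  "parameter_moment k A P m = (\<Sum>r\<in>A. \<Prod>j<k. pmf (P r) (unit_vec k j) ^ (m $ j))"

definition moment_degree :: "nat vec \<Rightarrow> nat" where
  "moment_degree m = (\<Sum>j<dim_vec m. m $ j)"

definition covariance_mat :: "nat \<Rightarrow> real vec pmf \<Rightarrow> real mat" where
  "covariance_mat k p = mat k k (\<lambda>(i, j). measure_pmf.expectation p (\<lambda>x.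
     (x $ i - measure_pmf.expectation p (\<lambda>y. y $ i)) *
     (x $ j - measure_pmf.expectation p (\<lambda>y. y $ j))))"

text \<open>
  The real eigenvalues with algebraic multiplicity. For a symmetric matrix, such as a
  covariance matrix, all eigenvalues are real, and this is the full spectrum.
\<close>

definition eigenvalues_mset :: "real mat \<Rightarrow> real multiset" where
  "eigenvalues_mset S = proots (char_poly S)"

definition all_eigenvalues_but_one_ge :: "real mat \<Rightarrow> real \<Rightarrow> bool" where
  "all_eigenvalues_but_one_ge S t \<longleftrightarrow>
     (\<exists>\<mu> \<in># eigenvalues_mset S. \<forall>\<nu> \<in># eigenvalues_mset S - {#\<mu>#}. t \<le> \<nu>)"

definition tv_dist :: "'a pmf \<Rightarrow> 'a pmf \<Rightarrow> real" where
  "tv_dist p q = (SUP S. \<bar>measure_pmf.prob p S - measure_pmf.prob q S\<bar>)"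

end

theory Submission
  imports Defs
begin

text \<open>
  Write \<open>Q(\<xi>)\<close> for the variance of \<open>\<xi> \<bullet> X\<close>, dropping the last coordinate of \<open>X\<close>, which the others determine.
  The eigenvalue hypothesis says that \<open>Q(\<xi>)\<close> dominates all \<open>(\<xi>\<^sub>j - \<xi>\<^sub>l)\<^sup>2\<close>. Gram--Schmidt orthogonalisation of
  the unit vectors with respect to the covariance form gives variances \<open>D\<^sub>j\<close> such that \<open>X\<close> lies with high
  probability in a set of \<open>\<Prod>\<^sub>j O(\<tau> \<surd>D\<^sub>j)\<close> lattice points (Chernoff), while at most \<open>\<Prod>\<^sub>j O(N \<surd>(R / D\<^sub>j))\<close>
  frequencies in \<open>(\<int>/N)\<^sup>d\<close> satisfy \<open>Q \<le> R\<close>; at the other frequencies the Fourier transform is negligible.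
  The determinants cancel in the product of the two counts, so no comparison of the two covariance
  matrices is needed: it suffices to use the support of the variable with the smaller determinant.
  At a frequency with \<open>Q \<le> R\<close> all differences \<open>\<xi>\<^sub>j - \<xi>\<^sub>l\<close> are small, and the logarithm of the Fourier transform is
  a power series whose coefficients are the parameter moments. Degrees up to \<open>L\<close> are controlled by hypothesis,
  and the condition on the degree makes the tail of order \<open>n\<^bsup>-c-\<gamma>\<^esup>\<close>, where \<open>\<gamma> > 0\<close> absorbs the
  factors \<open>(k log n)\<^bsup>O(k)\<^esup>\<close>.
\<close>

section \<open>The spectral hypothesis\<close>

text \<open>The thresholds come from one count. With eigenvalues at least
  \<open>t = n^(1-c) / k\<close>, the frequencies that matter have differences of order
  \<open>n^(-(1-c)/2)\<close>, up to powers of k and log n. Each of the n logarithms, cut off after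
  degree L, leaves a remainder of that size to the power L + 1, and
  \<open>L + 1 > (2+2c)/(1-c)\<close> puts the n remainders below \<open>n^(-c)\<close> by a fixed
  power of n. The moment errors start at \<open>n^(-c)\<close>; they gain because the expansion
  begins in degree 1, moments of degree 0 being cardinalities, which must coincide.

  Two obstacles shape the rest. The Fourier transform has period 1 in each coordinate but Q has not,
  so representatives must be chosen before Q can bound the modulus; reducing each coordinate to
  (-1/2, 1/2] fails, since it is the differences that must stay away from 1. And a pointwise Fourier
  bound gives an \<open>l^1\<close> bound only after multiplication by a number of points. As total
  variation is the sum of the positive parts of \<open>p - q\<close>, only p needs little mass off
  the chosen support, which leaves the order of p and q free.\<close>

definition qform :: "nat \<Rightarrow> (nat \<Rightarrow> nat \<Rightarrow> real) \<Rightarrow> (nat \<Rightarrow> real) \<Rightarrow> (nat \<Rightarrow> real) \<Rightarrow> real" where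
  "qform k S x y = (\<Sum>i<k. \<Sum>j<k. S i j * x i * y j)"

lemma qform_lin:
  "qform k S (\<lambda>i. a * x i + b * y i) z = a * qform k S x z + b * qform k S y z"
  "qform k S z (\<lambda>i. a * x i + b * y i) = a * qform k S z x + b * qform k S z y"
  by (simp_all add: qform_def algebra_simps sum.distrib sum_distrib_left)

lemma qform_sym: "(\<And>i j. i < k \<Longrightarrow> j < k \<Longrightarrow> S i j = S j i) \<Longrightarrow> qform k S x y = qform k S y x"
  unfolding qform_def by (subst sum.swap, intro sum.cong refl) (auto simp: mult_ac)

text \<open>The unit sphere of the hyperplane of coordinate sum 0 is compact; homogeneity carries
  the bound from the sphere to the whole hyperplane.\<close>

lemma rayleigh_minimizer:
  fixes S :: "nat \<Rightarrow> nat \<Rightarrow> real"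
  assumes k: "2 \<le> k"
  obtains w where "(\<Sum>i<k. w i) = 0" "(\<Sum>i<k. (w i)\<^sup>2) = 1"
    "\<And>x. (\<Sum>i<k. x i) = 0 \<Longrightarrow> qform k S w w * (\<Sum>i<k. (x i)\<^sup>2) \<le> qform k S x x"
proof -
  \<comment> \<open>The functions live on all of \<open>nat\<close>; pinning the coordinates from
    \<open>k\<close> on to 0 makes the box compact in the product topology.\<close>
  define B where "B = (\<lambda>i. if i < k then {-1..1::real} else {0})"
  have cB: "compact (PiE UNIV B)"
    unfolding compactin_euclidean_iff[symmetric] euclidean_product_topology[symmetric]
    by (subst compactin_PiE) (auto simp: B_def)
  have cont: "continuous_on A (\<lambda>x::nat\<Rightarrow>real. x i)" for A i
    by (rule continuous_on_subset[OF continuous_on_product_coordinates]) auto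
  define C where "C = PiE UNIV B \<inter> ({x. (\<Sum>i<k. x i) = 0} \<inter> {x. (\<Sum>i<k. (x i)\<^sup>2) = 1})"
  have "closed {x::nat\<Rightarrow>real. (\<Sum>i<k. x i) = 0}" "closed {x::nat\<Rightarrow>real. (\<Sum>i<k. (x i)\<^sup>2) = 1}"
    by (intro closed_Collect_eq continuous_intros cont)+
  hence cC: "compact C" unfolding C_def by (intro compact_Int_closed cB closed_Int)
  \<comment> \<open>A witness that the sphere is not empty; this is where \<open>2 \<le> k\<close>
    enters.\<close>
  define e where "e = (\<lambda>i::nat. if i = 0 then 1 / sqrt 2 else if i = 1 then - 1 / sqrt 2 else (0::real))"
  have s: "(\<Sum>i<k. g (e i)) = g (1 / sqrt 2) + g (- 1 / sqrt 2)" if "g 0 = 0" for g :: "real \<Rightarrow> real"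
  proof -
    have "(\<Sum>i<k. g (e i)) = (\<Sum>i\<in>{0,1}. g (e i))"
      using k that by (intro sum.mono_neutral_right) (auto simp: e_def)
    thus ?thesis by (simp add: e_def)
  qed
  have "- 1 \<le> 1 / sqrt 2" by (rule order_trans[of _ 0]) auto
  hence "e \<in> C" using s[of "\<lambda>x. x"] s[of "\<lambda>x. x\<^sup>2"] k
    by (auto simp: C_def B_def e_def power_divide)
  hence ne: "C \<noteq> {}" by auto
  have "continuous_on C (\<lambda>x. qform k S x x)" unfolding qform_def
    by (intro continuous_intros cont)
  from continuous_attains_inf[OF cC ne this] obtain w
    where w: "w \<in> C" "\<And>x. x \<in> C \<Longrightarrow> qform k S w w \<le> qform k S x x" by auto
  show thesis
  proof
    show "(\<Sum>i<k. w i) = 0" "(\<Sum>i<k. (w i)\<^sup>2) = 1" using w(1) by (auto simp: C_def)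
    fix x :: "nat \<Rightarrow> real" assume x0: "(\<Sum>i<k. x i) = 0"
    define r where "r = (\<Sum>i<k. (x i)\<^sup>2)"
    have r0: "r \<ge> 0" unfolding r_def by (intro sum_nonneg) auto
    show "qform k S w w * (\<Sum>i<k. (x i)\<^sup>2) \<le> qform k S x x"
    proof (cases "r = 0")
      case True
      hence "\<And>i. i < k \<Longrightarrow> x i = 0" by (simp add: r_def sum_nonneg_eq_0_iff)
      hence "qform k S x x = 0" by (simp add: qform_def)
      thus ?thesis using True by (simp add: r_def)
    next
      case False
      define y where "y = (\<lambda>i. if i < k then x i / sqrt r else 0)"
      have y2: "(\<Sum>i<k. (y i)\<^sup>2) = 1"
        using False r0 by (simp add: y_def power_divide sum_divide_distrib[symmetric] r_def[symmetric])
      have yi: "(y i)\<^sup>2 \<le> 1" if "i < k" for i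
        unfolding y2[symmetric] using that by (intro member_le_sum) auto
      have "y i \<in> {-1..1}" if "i < k" for i
        using yi[OF that] abs_le_square_iff[of "y i" 1] by auto
      hence "y \<in> PiE UNIV B" by (auto simp: B_def y_def)
      moreover have "(\<Sum>i<k. y i) = 0"
        using x0 by (simp add: y_def sum_divide_distrib[symmetric])
      ultimately have "y \<in> C" unfolding C_def using y2 by simp
      from w(2)[OF this] have "qform k S w w \<le> qform k S y y" .
      also have "qform k S y y = qform k S x x / r"
        using r0 by (simp add: qform_def y_def sum_divide_distrib mult_ac)
      finally show ?thesis using False r0 by (simp add: r_def[symmetric] field_simps)
    qed
  qed
qed

text \<open>First-order optimality. The residual \<open>S w - \<nu> w\<close> has coordinate sum 0,
  because \<open>S\<close> is symmetric with vanishing row sums, so it is an admissible direction of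
  variation. The derivative in that direction is twice its squared norm, which must therefore
  vanish.\<close>

lemma rayleigh_minimizer_eigenvector:
  fixes S :: "nat \<Rightarrow> nat \<Rightarrow> real"
  assumes k: "2 \<le> k" and sym: "\<And>i j. i < k \<Longrightarrow> j < k \<Longrightarrow> S i j = S j i"
    and rows: "\<And>i. i < k \<Longrightarrow> (\<Sum>j<k. S i j) = 0"
  obtains w \<nu> where "(\<Sum>i<k. w i) = 0" "(\<Sum>i<k. (w i)\<^sup>2) = 1"
    "\<And>i. i < k \<Longrightarrow> (\<Sum>j<k. S i j * w j) = \<nu> * w i"
    "\<And>x. (\<Sum>i<k. x i) = 0 \<Longrightarrow> \<nu> * (\<Sum>i<k. (x i)\<^sup>2) \<le> qform k S x x"
proof -
  obtain w where w: "(\<Sum>i<k. w i) = 0" "(\<Sum>i<k. (w i)\<^sup>2) = 1"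
    "\<And>x. (\<Sum>i<k. x i) = 0 \<Longrightarrow> qform k S w w * (\<Sum>i<k. (x i)\<^sup>2) \<le> qform k S x x"
    using rayleigh_minimizer[OF k] by blast
  define \<nu> where "\<nu> = qform k S w w"
  define g where "g = (\<lambda>i. (\<Sum>j<k. S i j * w j) - \<nu> * w i)"
  have "(\<Sum>i<k. \<Sum>j<k. S i j * w j) = (\<Sum>j<k. (\<Sum>i<k. S j i) * w j)"
    by (subst sum.swap) (auto simp: sum_distrib_right sym intro!: sum.cong)
  also have "\<dots> = 0" using rows by simp
  finally have g0: "(\<Sum>i<k. g i) = 0"
    using w(1) by (simp add: g_def sum_subtractf sum_distrib_left[symmetric])
  define G where "G = (\<Sum>i<k. (g i)\<^sup>2)"
  have Gq: "G = qform k S g w - \<nu> * (\<Sum>i<k. g i * w i)"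
    unfolding G_def qform_def power2_eq_square
    by (subst (2) g_def) (simp add: algebra_simps sum_subtractf sum_distrib_left)
  have quad: "2 * s * G + s\<^sup>2 * (qform k S g g - \<nu> * G) \<ge> 0" for s
  proof -
    have "(\<Sum>i<k. w i + s * g i) = 0" using w g0 by (simp add: sum.distrib sum_distrib_left[symmetric])
    from w(3)[OF this]
    have "\<nu> * (\<Sum>i<k. (w i + s * g i)\<^sup>2) \<le> qform k S (\<lambda>i. 1 * w i + s * g i) (\<lambda>i. 1 * w i + s * g i)"
      by (simp add: \<nu>_def)
    also have "(\<Sum>i<k. (w i + s * g i)\<^sup>2) = 1 + 2 * s * (\<Sum>i<k. g i * w i) + s\<^sup>2 * G"
      by (simp add: power2_sum sum.distrib w G_def sum_distrib_left algebra_simps power_mult_distrib)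
    also have "qform k S (\<lambda>i. 1 * w i + s * g i) (\<lambda>i. 1 * w i + s * g i)
       = \<nu> + 2 * s * qform k S g w + s\<^sup>2 * qform k S g g"
      unfolding qform_lin \<nu>_def using qform_sym[of k S w g, OF sym]
      by (simp add: algebra_simps power2_eq_square)
    finally have "\<nu> * (1 + 2 * s * (\<Sum>i<k. g i * w i) + s\<^sup>2 * G)
       \<le> \<nu> + 2 * s * qform k S g w + s\<^sup>2 * qform k S g g" .
    moreover have "qform k S g w = G + \<nu> * (\<Sum>i<k. g i * w i)" using Gq by simp
    ultimately show ?thesis by (simp add: algebra_simps)
  qed
  have "G \<le> 0"
  proof (rule ccontr)
    assume "\<not> G \<le> 0"
    hence G: "G > 0" by simp
    \<comment> \<open>\<open>c\<close> exceeds the quadratic coefficient, so at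
      \<open>s = - (G / c)\<close> the quadratic is at most \<open>- (G\<^sup>2 / c)\<close>, which
      is negative.\<close>
    define c where "c = \<bar>qform k S g g - \<nu> * G\<bar> + 1"
    have c: "c > 0" "qform k S g g - \<nu> * G < c" by (auto simp: c_def)
    define s where "s = - (G / c)"
    have "s\<^sup>2 * (qform k S g g - \<nu> * G) \<le> s\<^sup>2 * c" using c by (intro mult_left_mono) auto
    hence "2 * s * G + s\<^sup>2 * c \<ge> 0" using quad[of s] by linarith
    moreover have "2 * s * G + s\<^sup>2 * c = - (G\<^sup>2 / c)" using c
      by (simp add: s_def power2_eq_square field_simps)
    moreover have "G\<^sup>2 / c > 0" using G c by simp
    ultimately show False by linarith
  qed
  hence "G = 0" unfolding G_def by (smt (verit) sum_nonneg zero_le_power2)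
  hence "\<And>i. i < k \<Longrightarrow> g i = 0" by (simp add: G_def sum_nonneg_eq_0_iff)
  with that[of w \<nu>] w show thesis by (auto simp: g_def \<nu>_def)
qed

section \<open>Splitting two linear factors off a characteristic polynomial\<close>

lemma replace_col_closed: "A \<in> carrier_mat n n \<Longrightarrow> replace_col A b k \<in> carrier_mat n n"
  by (auto simp: replace_col_def)

lemma replace_col_replace: "dim_vec b = dim_row A \<Longrightarrow> replace_col (replace_col A b k) b' k = replace_col A b' k"
  by (auto simp: replace_col_def)

text \<open>Cramer's rule for the matrix that already has column \<open>b\<close> in place, applied
  to \<open>c\<close> times a unit vector.\<close>

lemma det_replace_col_smult:
  fixes A :: "'a :: idom mat"
  assumes A: "A \<in> carrier_mat n n" and b: "b \<in> carrier_vec n" and k: "k < n"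
  shows "det (replace_col A (c \<cdot>\<^sub>v b) k) = c * det (replace_col A b k)"
proof -
  let ?R = "replace_col A b k"
  have R: "?R \<in> carrier_mat n n" using A by (rule replace_col_closed)
  have e: "?R *\<^sub>v (c \<cdot>\<^sub>v unit_vec n k) = c \<cdot>\<^sub>v b"
  proof (rule eq_vecI)
    fix i assume i: "i < dim_vec (c \<cdot>\<^sub>v b)"
    have "(?R *\<^sub>v (c \<cdot>\<^sub>v unit_vec n k)) $ i = c * (row ?R i \<bullet> unit_vec n k)"
      using i b R k by (simp add: scalar_prod_smult_right)
    also have "row ?R i \<bullet> unit_vec n k = ?R $$ (i, k)"
      using i b R k by (simp add: scalar_prod_right_unit)
    finally show "(?R *\<^sub>v (c \<cdot>\<^sub>v unit_vec n k)) $ i = (c \<cdot>\<^sub>v b) $ i"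
      using i b A k by (simp add: replace_col_def)
  qed (use A b in \<open>auto simp: replace_col_def\<close>)
  have "det (replace_col ?R (?R *\<^sub>v (c \<cdot>\<^sub>v unit_vec n k)) k) = (c \<cdot>\<^sub>v unit_vec n k) $ k * det ?R"
    by (rule cramer_lemma_mat[OF R _ k]) auto
  thus ?thesis unfolding e using k A b by (simp add: replace_col_replace)
qed

text \<open>
  Cramer's rule replaces two columns of the characteristic matrix by multiples of the two
  given eigenvectors, so that both linear factors split off, even if they coincide.
\<close>

lemma char_poly_two_eigenvectors:
  fixes A :: "real mat"
  assumes A: "A \<in> carrier_mat n n"
    and u: "\<And>i. i < n \<Longrightarrow> (\<Sum>j<n. A $$ (i, j)) = 0"
    and w: "\<And>i. i < n \<Longrightarrow> (\<Sum>j<n. A $$ (i, j) * w j) = \<nu> * w i"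
    and ab: "a < n" "b < n" "w a \<noteq> w b"
  shows "[:0, 1:] * [:-\<nu>, 1:] dvd char_poly A"
proof -
  define M where "M = char_poly_matrix A"
  have M: "M \<in> carrier_mat n n" using A by (simp add: M_def)
  have Mij: "M $$ (i, j) = (if i = j then [:0, 1:] else 0) - [:A $$ (i, j):]" if "i < n" "j < n" for i j
    using A that by (auto simp: M_def char_poly_matrix_def)
  have poly_sum': "(\<Sum>j<n. [:f j:]) = [:\<Sum>j<n. f j:]" for f :: "nat \<Rightarrow> real"
    by (simp add: sum_to_poly)
  define one where "one = vec n (\<lambda>_. 1 :: real poly)"
  define W where "W = vec n (\<lambda>i. [:w i:])"
  have vc: "one \<in> carrier_vec n" "W \<in> carrier_vec n" by (auto simp: one_def W_def)
  have M1: "M *\<^sub>v one = [:0, 1:] \<cdot>\<^sub>v one"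
  proof (rule eq_vecI)
    fix i assume "i < dim_vec ([:0, 1:] \<cdot>\<^sub>v one)"
    hence i: "i < n" by (simp add: one_def)
    have "(M *\<^sub>v one) $ i = (\<Sum>j<n. M $$ (i, j))"
      using i M by (simp add: one_def scalar_prod_def lessThan_atLeast0)
    also have "\<dots> = (\<Sum>j<n. if i = j then [:0, 1:] else 0) - [:\<Sum>j<n. A $$ (i, j):]"
      using i by (simp add: Mij sum_subtractf poly_sum')
    finally show "(M *\<^sub>v one) $ i = ([:0, 1:] \<cdot>\<^sub>v one) $ i"
      using i u by (simp add: one_def)
  qed (use M in \<open>auto simp: one_def\<close>)
  have MW: "M *\<^sub>v W = [:-\<nu>, 1:] \<cdot>\<^sub>v W"
  proof (rule eq_vecI)
    fix i assume "i < dim_vec ([:-\<nu>, 1:] \<cdot>\<^sub>v W)"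
    hence i: "i < n" by (simp add: W_def)
    have "(M *\<^sub>v W) $ i = (\<Sum>j<n. M $$ (i, j) * [:w j:])"
      using i M by (simp add: W_def scalar_prod_def lessThan_atLeast0)
    also have "\<dots> = (\<Sum>j<n. (if i = j then [:0, 1:] * [:w i:] else 0) - [:A $$ (i, j) * w j:])"
      using i by (intro sum.cong) (auto simp: Mij algebra_simps)
    also have "\<dots> = [:0, 1:] * [:w i:] - [:\<Sum>j<n. A $$ (i, j) * w j:]"
      using i by (simp add: sum_subtractf poly_sum')
    finally show "(M *\<^sub>v W) $ i = ([:-\<nu>, 1:] \<cdot>\<^sub>v W) $ i"
      using i w by (simp add: W_def)
  qed (use M in \<open>auto simp: W_def\<close>)
  have anb: "a \<noteq> b" using ab by auto
  define N where "N = replace_col M ([:0, 1:] \<cdot>\<^sub>v one) a"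
  have N: "N \<in> carrier_mat n n" unfolding N_def by (rule replace_col_closed[OF M])
  have detN: "det N = det M"
    using cramer_lemma_mat[OF M vc(1) ab(1)] ab(1) unfolding N_def M1[symmetric]
    by (simp add: one_def)
  \<comment> \<open>Column \<open>a\<close> of \<open>N\<close> is the sum of all columns of
    \<open>M\<close>, so these coordinates give \<open>N v = M W\<close>. The entry at
    \<open>b\<close> is the nonzero constant \<open>w b - w a\<close>, a unit among the
    polynomials.\<close>
  define v where "v = vec n (\<lambda>j. if j = a then [:w a:] else [:w j - w a:])"
  have v: "v \<in> carrier_vec n" by (simp add: v_def)
  have Nv: "N *\<^sub>v v = [:-\<nu>, 1:] \<cdot>\<^sub>v W"
  proof (rule eq_vecI)
    fix i assume "i < dim_vec ([:-\<nu>, 1:] \<cdot>\<^sub>v W)"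
    hence i: "i < n" by (simp add: W_def)
    have m1: "(\<Sum>j<n. M $$ (i, j)) = [:0, 1:]"
    proof -
      have "(\<Sum>j<n. M $$ (i, j)) = (M *\<^sub>v one) $ i"
        using i M by (simp add: one_def scalar_prod_def lessThan_atLeast0)
      also have "\<dots> = [:0, 1:]" unfolding M1 using i by (simp add: one_def)
      finally show ?thesis .
    qed
    have mw: "(\<Sum>j<n. M $$ (i, j) * [:w j:]) = ([:-\<nu>, 1:] \<cdot>\<^sub>v W) $ i"
      using i M unfolding MW[symmetric] by (simp add: W_def scalar_prod_def lessThan_atLeast0)
    have "(N *\<^sub>v v) $ i = (\<Sum>j<n. N $$ (i, j) * v $ j)"
      using i N v by (simp add: scalar_prod_def lessThan_atLeast0)
    also have "\<dots> = (\<Sum>j<n. M $$ (i, j) * [:w j:] - M $$ (i, j) * [:w a:]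
        + (if j = a then [:0, 1:] * [:w a:] else 0))"
      using i M by (intro sum.cong) (auto simp: N_def v_def replace_col_def one_def algebra_simps
          simp flip: diff_pCons)
    also have "\<dots> = ([:-\<nu>, 1:] \<cdot>\<^sub>v W) $ i"
      using ab(1) unfolding sum.distrib sum_subtractf mw sum_distrib_right[symmetric] m1 by simp
    finally show "(N *\<^sub>v v) $ i = ([:-\<nu>, 1:] \<cdot>\<^sub>v W) $ i" .
  qed (use N v in \<open>auto simp: W_def\<close>)
  define R where "R = replace_col N W b"
  have R: "R \<in> carrier_mat n n" unfolding R_def by (rule replace_col_closed[OF N])
  have "[:w b - w a:] * det M = det (replace_col N ([:-\<nu>, 1:] \<cdot>\<^sub>v W) b)"
    using cramer_lemma_mat[OF N v ab(2)] ab(2) anb unfolding Nv[symmetric] detN[symmetric]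
    by (simp add: v_def)
  also have "\<dots> = [:-\<nu>, 1:] * det R"
    unfolding R_def by (rule det_replace_col_smult[OF N vc(2) ab(2)])
  \<comment> \<open>As \<open>a \<noteq> b\<close>, column \<open>a\<close> of \<open>R\<close> is
    still \<open>[:0, 1:]\<close> times the all-ones vector, so the other factor splits off as
    well.\<close>
  also have "R = replace_col R ([:0, 1:] \<cdot>\<^sub>v one) a"
    using M anb by (auto simp: R_def N_def replace_col_def)
  also have "det \<dots> = [:0, 1:] * det (replace_col R one a)"
    by (rule det_replace_col_smult[OF R vc(1) ab(1)])
  finally have "[:0, 1:] * [:-\<nu>, 1:] dvd [:w b - w a:] * det M"
    unfolding dvd_def by (intro exI[of _ "det (replace_col R one a)"]) (simp only: mult_ac)
  thus ?thesis using ab(3) unfolding char_poly_def M_def[symmetric]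
    by (simp add: dvd_smult_iff)
qed

text \<open>The all-ones vector and the Rayleigh minimiser put 0 and \<open>\<nu>\<close> into the
  spectrum, counted with multiplicity. Since \<open>0 < t\<close>, the exempted eigenvalue must be
  0, whence \<open>t \<le> \<nu>\<close>.\<close>

lemma all_eigenvalues_but_one_geD:
  fixes A :: "real mat"
  assumes A: "A \<in> carrier_mat k k" and k: "2 \<le> k" and t: "0 < t"
    and sym: "\<And>i j. i < k \<Longrightarrow> j < k \<Longrightarrow> A $$ (i, j) = A $$ (j, i)"
    and rows: "\<And>i. i < k \<Longrightarrow> (\<Sum>j<k. A $$ (i, j)) = 0"
    and ev: "all_eigenvalues_but_one_ge A t" and jl: "j < k" "l < k"
  shows "t * (x j - x l)\<^sup>2 \<le> 2 * qform k (\<lambda>i j. A $$ (i, j)) x x"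
proof -
  let ?S = "\<lambda>i j. A $$ (i, j)"
  obtain w \<nu> where w: "(\<Sum>i<k. w i) = 0" "(\<Sum>i<k. (w i)\<^sup>2) = 1"
    "\<And>i. i < k \<Longrightarrow> (\<Sum>j<k. ?S i j * w j) = \<nu> * w i"
    "\<And>x. (\<Sum>i<k. x i) = 0 \<Longrightarrow> \<nu> * (\<Sum>i<k. (x i)\<^sup>2) \<le> qform k ?S x x"
    using rayleigh_minimizer_eigenvector[of k ?S, OF k sym rows] by blast
  have "\<exists>a<k. \<exists>b<k. w a \<noteq> w b"
  proof (rule ccontr)
    assume "\<not> ?thesis"
    moreover have "0 < k" using k by simp
    ultimately have c: "\<And>i. i < k \<Longrightarrow> w i = w 0" by blast
    have "(\<Sum>i<k. w i) = (\<Sum>i<k. w 0)" by (intro sum.cong refl c) simp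
    hence "w 0 = 0" using k w(1) by simp
    hence "\<And>i. i < k \<Longrightarrow> w i = 0" using c by metis
    thus False using w(2) by simp
  qed
  then obtain a b where ab: "a < k" "b < k" "w a \<noteq> w b" by auto
  from char_poly_two_eigenvectors[OF A rows w(3) ab]
  obtain q where q: "char_poly A = [:0, 1:] * [:-\<nu>, 1:] * q" unfolding dvd_def by blast
  have "char_poly A \<noteq> 0" using degree_monic_char_poly[OF A] by auto
  hence "q \<noteq> 0" using q by auto
  hence ev': "eigenvalues_mset A = {#0#} + {#\<nu>#} + proots q"
    unfolding eigenvalues_mset_def q
    using proots_mult[of "[:0, 1::real:] * [:-\<nu>, 1:]" q] proots_mult[of "[:0, 1::real:]" "[:-\<nu>, 1:]"]
      proots_linear_factor[of "0::real"] proots_linear_factor[of "-\<nu>"] by simp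
  have "t \<le> \<nu>"
  proof -
    obtain \<mu> where m: "\<And>y. y \<in># eigenvalues_mset A - {#\<mu>#} \<Longrightarrow> t \<le> y"
      using ev unfolding all_eigenvalues_but_one_ge_def by blast
    show ?thesis
    proof (cases "\<mu> = 0")
      case True
      thus ?thesis using m[of \<nu>] by (simp add: ev')
    next
      case False
      hence "0 \<in># eigenvalues_mset A - {#\<mu>#}" by (auto simp: ev' in_diff_count)
      thus ?thesis using m[of 0] t by simp
    qed
  qed
  \<comment> \<open>Centring moves \<open>x\<close> into the hyperplane of the Rayleigh bound. It
    changes neither the form, whose kernel contains the constants, nor differences of
    coordinates.\<close>
  define s where "s = (\<Sum>i<k. x i) / real k"
  define y where "y = (\<lambda>i. x i - s)"
  have y0: "(\<Sum>i<k. y i) = 0" using k by (simp add: y_def sum_subtractf s_def)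
  have c0: "qform k ?S (\<lambda>_. 1) z = 0" for z
  proof -
    have "qform k ?S (\<lambda>_. 1) z = (\<Sum>j<k. (\<Sum>i<k. A $$ (j, i)) * z j)"
      unfolding qform_def
      by (subst sum.swap) (auto simp: sum_distrib_right intro!: sum.cong sym)
    thus ?thesis using rows by simp
  qed
  have c0': "qform k ?S z (\<lambda>_. 1) = 0" for z
    using c0 qform_sym[of k ?S z "\<lambda>_. 1"] sym by simp
  have y: "y = (\<lambda>i. 1 * x i + (-s) * 1)" by (simp add: y_def)
  have qy: "qform k ?S y y = qform k ?S x x"
    unfolding y qform_lin by (simp add: c0 c0')
  have "(y j - y l)\<^sup>2 \<le> 2 * (\<Sum>i<k. (y i)\<^sup>2)"
  proof (cases "j = l")
    case True
    thus ?thesis by (simp add: sum_nonneg)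
  next
    case False
    have "(y j - y l)\<^sup>2 \<le> 2 * ((y j)\<^sup>2 + (y l)\<^sup>2)"
      using zero_le_power2[of "y j + y l"] by (simp add: power2_eq_square algebra_simps)
    also have "(y j)\<^sup>2 + (y l)\<^sup>2 = (\<Sum>i\<in>{j,l}. (y i)\<^sup>2)" using False by simp
    also have "\<dots> \<le> (\<Sum>i<k. (y i)\<^sup>2)" using jl by (intro sum_mono2) auto
    finally show ?thesis by simp
  qed
  hence yjl: "t * (y j - y l)\<^sup>2 \<le> t * (2 * (\<Sum>i<k. (y i)\<^sup>2))"
    using t by (intro mult_left_mono) auto
  have "t * (\<Sum>i<k. (y i)\<^sup>2) \<le> \<nu> * (\<Sum>i<k. (y i)\<^sup>2)"
    using \<open>t \<le> \<nu>\<close> by (intro mult_right_mono sum_nonneg) auto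
  also have "\<dots> \<le> qform k ?S x x" using w(4)[OF y0] by (simp add: qy)
  finally show ?thesis using yjl by (simp add: y_def)
qed

section \<open>Sums of independent categorical variables\<close>

definition stochastic :: "nat \<Rightarrow> nat \<Rightarrow> (nat \<Rightarrow> nat \<Rightarrow> real) \<Rightarrow> bool" where
  "stochastic n k p \<longleftrightarrow> (\<forall>r<n. (\<forall>j<k. 0 \<le> p r j) \<and> (\<Sum>j<k. p r j) = 1)"

definition outcomes :: "nat \<Rightarrow> nat \<Rightarrow> (nat \<Rightarrow> nat) set" where
  "outcomes n k = PiE {..<n} (\<lambda>_. {..<k})"

definition weight :: "nat \<Rightarrow> (nat \<Rightarrow> nat \<Rightarrow> real) \<Rightarrow> (nat \<Rightarrow> nat) \<Rightarrow> real" where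
  "weight n p f = (\<Prod>r<n. p r (f r))"

definition cnt :: "nat \<Rightarrow> (nat \<Rightarrow> nat) \<Rightarrow> nat \<Rightarrow> nat" where
  "cnt n f j = card {r. r < n \<and> f r = j}"

definition mean :: "nat \<Rightarrow> (nat \<Rightarrow> real) \<Rightarrow> (nat \<Rightarrow> real) \<Rightarrow> real" where
  "mean k u v = (\<Sum>j<k. u j * v j)"

text \<open>The covariance of the sums of \<open>x\<close> and of \<open>y\<close> over the
  \<open>n\<close> outcomes, written variable by variable as independence permits.
  \<open>covf n k p x x\<close> is the variance Q.\<close>

definition covf :: "nat \<Rightarrow> nat \<Rightarrow> (nat \<Rightarrow> nat \<Rightarrow> real) \<Rightarrow> (nat \<Rightarrow> real) \<Rightarrow> (nat \<Rightarrow> real) \<Rightarrow> real" where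
  "covf n k p x y = (\<Sum>r<n. mean k (p r) (\<lambda>j. x j * y j) - mean k (p r) x * mean k (p r) y)"

lemma stochasticD:
  assumes "stochastic n k p" "r < n"
  shows "j < k \<Longrightarrow> 0 \<le> p r j" "(\<Sum>j<k. p r j) = 1"
  using assms by (auto simp: stochastic_def)

lemma finite_outcomes [simp]: "finite (outcomes n k)"
  unfolding outcomes_def by (intro finite_PiE) auto

lemma outcomesD: "f \<in> outcomes n k \<Longrightarrow> r < n \<Longrightarrow> f r < k"
  by (auto simp: outcomes_def PiE_def Pi_def)

lemma sum_outcomes:
  fixes h :: "nat \<Rightarrow> nat \<Rightarrow> 'a :: comm_semiring_1"
  shows "(\<Sum>f\<in>outcomes n k. \<Prod>r<n. h r (f r)) = (\<Prod>r<n. \<Sum>j<k. h r j)"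
  unfolding outcomes_def by (rule prod_sum_PiE[symmetric]) auto

lemma weight_nonneg: "stochastic n k p \<Longrightarrow> f \<in> outcomes n k \<Longrightarrow> 0 \<le> weight n p f"
  unfolding weight_def by (intro prod_nonneg) (auto dest: outcomesD simp: stochastic_def)

lemma sum_weight_one:
  assumes p: "stochastic n k p" and r: "r < n"
  shows "(\<Sum>f\<in>outcomes n k. weight n p f * g (f r)) = mean k (p r) g"
proof -
  \<comment> \<open>Padding with factors 1 at the other positions keeps the summand a product, so
    that the sum over outcomes factorises.\<close>
  have "(\<Sum>f\<in>outcomes n k. weight n p f * g (f r)) =
        (\<Sum>f\<in>outcomes n k. \<Prod>s<n. p s (f s) * (if s = r then g (f s) else 1))"
    using r by (intro sum.cong refl) (simp add: weight_def prod.distrib)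
  also have "\<dots> = (\<Prod>s<n. \<Sum>j<k. p s j * (if s = r then g j else 1))"
    by (rule sum_outcomes)
  also have "\<dots> = (\<Prod>s<n. if s = r then mean k (p r) g else 1)"
    by (intro prod.cong refl) (auto simp: mean_def stochasticD[OF p])
  finally show ?thesis using r by simp
qed

lemma sum_weight_two:
  assumes p: "stochastic n k p" and r: "r < n" "s < n" "r \<noteq> s"
  shows "(\<Sum>f\<in>outcomes n k. weight n p f * (g (f r) * h (f s))) = mean k (p r) g * mean k (p s) h"
proof -
  have "(\<Sum>f\<in>outcomes n k. weight n p f * (g (f r) * h (f s))) =
        (\<Sum>f\<in>outcomes n k. \<Prod>t<n. p t (f t) * ((if t = r then g (f t) else 1) * (if t = s then h (f t) else 1)))"
    using r by (intro sum.cong refl) (simp add: weight_def prod.distrib)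
  also have "\<dots> = (\<Prod>t<n. \<Sum>j<k. p t j * ((if t = r then g j else 1) * (if t = s then h j else 1)))"
    by (rule sum_outcomes)
  also have "\<dots> = (\<Prod>t<n. (if t = r then mean k (p r) g else 1) * (if t = s then mean k (p s) h else 1))"
    using r by (intro prod.cong refl) (auto simp: mean_def stochasticD[OF p])
  finally show ?thesis using r by (simp add: prod.distrib)
qed

text \<open>Cross terms with \<open>r \<noteq> s\<close> factor into two means, and centring one of
  the two families is enough to kill them.\<close>

lemma covariance_sum:
  assumes p: "stochastic n k p"
    and u: "\<And>r. r < n \<Longrightarrow> mean k (p r) (u r) = 0"
  shows "(\<Sum>f\<in>outcomes n k. weight n p f * ((\<Sum>r<n. u r (f r)) * (\<Sum>s<n. w s (f s)))) =
         (\<Sum>r<n. mean k (p r) (\<lambda>j. u r j * w r j))"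
proof -
  have "(\<Sum>f\<in>outcomes n k. weight n p f * ((\<Sum>r<n. u r (f r)) * (\<Sum>s<n. w s (f s)))) =
        (\<Sum>f\<in>outcomes n k. \<Sum>r<n. \<Sum>s<n. weight n p f * (u r (f r) * w s (f s)))"
    by (simp only: sum_product) (simp only: sum_distrib_left)
  also have "\<dots> = (\<Sum>r<n. \<Sum>s<n. \<Sum>f\<in>outcomes n k. weight n p f * (u r (f r) * w s (f s)))"
    by (subst sum.swap, intro sum.cong refl, rule sum.swap)
  also have "\<dots> = (\<Sum>r<n. \<Sum>s<n. if s = r then mean k (p r) (\<lambda>j. u r j * w r j) else 0)"
  proof (intro sum.cong refl)
    fix r s assume "r \<in> {..<n}" "s \<in> {..<n}"
    thus "(\<Sum>f\<in>outcomes n k. weight n p f * (u r (f r) * w s (f s))) =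
       (if s = r then mean k (p r) (\<lambda>j. u r j * w r j) else 0)"
      using sum_weight_one[OF p, of r "\<lambda>j. u r j * w r j"] sum_weight_two[OF p, of r s "u r" "w s"] u
      by auto
  qed
  finally show ?thesis by simp
qed

lemma sum_cnt:
  assumes "f \<in> outcomes n k"
  shows "(\<Sum>r<n. v (f r)) = (\<Sum>j<k. of_nat (cnt n f j) * (v j :: 'a :: comm_semiring_1))"
proof -
  have "(\<Sum>r<n. v (f r)) = (\<Sum>r<n. \<Sum>j<k. if f r = j then v j else 0)"
    using outcomesD[OF assms] by (intro sum.cong) auto
  also have "\<dots> = (\<Sum>j<k. \<Sum>r<n. if f r = j then v j else 0)" by (rule sum.swap)
  also have "\<dots> = (\<Sum>j<k. of_nat (cnt n f j) * v j)"
    by (intro sum.cong refl) (simp add: sum.If_cases cnt_def Int_def)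
  finally show ?thesis .
qed

lemma sum_cnt_total: "f \<in> outcomes n k \<Longrightarrow> (\<Sum>j<k. cnt n f j) = n"
  using sum_cnt[of f n k "\<lambda>_. 1::nat"] by simp

lemma cnt_le: "cnt n f j \<le> n"
  unfolding cnt_def using card_mono[of "{..<n}" "{r. r < n \<and> f r = j}"] by auto

lemma covf_alt:
  assumes p: "stochastic n k p"
  shows "covf n k p x y = (\<Sum>r<n. mean k (p r) (\<lambda>j. (x j - mean k (p r) x) * (y j - mean k (p r) y)))"
  unfolding covf_def
proof (intro sum.cong refl)
  fix r assume "r \<in> {..<n}"
  hence s: "(\<Sum>j<k. p r j) = 1" using stochasticD[OF p] by auto
  define a b where "a = mean k (p r) x" and "b = mean k (p r) y"
  have "mean k (p r) (\<lambda>j. (x j - a) * (y j - b)) =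
     mean k (p r) (\<lambda>j. x j * y j) - b * (\<Sum>j<k. p r j * x j) - a * (\<Sum>j<k. p r j * y j) + a * b * (\<Sum>j<k. p r j)"
    by (simp add: mean_def sum_subtractf sum.distrib sum_distrib_left algebra_simps)
  thus "mean k (p r) (\<lambda>j. x j * y j) - mean k (p r) x * mean k (p r) y =
    mean k (p r) (\<lambda>j. (x j - mean k (p r) x) * (y j - mean k (p r) y))"
    by (simp add: s a_def b_def mean_def)
qed

lemma covf_nonneg: "stochastic n k p \<Longrightarrow> 0 \<le> covf n k p x x"
  by (subst covf_alt) (auto simp: mean_def power2_eq_square[symmetric] dest: stochasticD
      intro!: sum_nonneg mult_nonneg_nonneg)

lemma mean_lin: "mean k u (\<lambda>j. a * x j + b * y j) = a * mean k u x + b * mean k u y"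
  by (simp add: mean_def sum.distrib sum_distrib_left algebra_simps)

lemma covf_lin:
  "covf n k p (\<lambda>j. a * x j + b * y j) z = a * covf n k p x z + b * covf n k p y z"
proof -
  have "mean k u (\<lambda>j. (a * x j + b * y j) * z j) = a * mean k u (\<lambda>j. x j * z j) + b * mean k u (\<lambda>j. y j * z j)" for u
    using mean_lin[of k u a "\<lambda>j. x j * z j" b "\<lambda>j. y j * z j"] by (simp add: algebra_simps)
  thus ?thesis unfolding covf_def mean_lin
    by (simp add: sum.distrib sum_subtractf sum_distrib_left algebra_simps)
qed

lemma covf_commute: "covf n k p x y = covf n k p y x"
  by (simp add: covf_def mult.commute)

section \<open>Concentration of linear statistics\<close>

lemma exp_le_quadratic:
  fixes x :: real assumes "\<bar>x\<bar> \<le> 1" shows "exp x \<le> 1 + x + x\<^sup>2"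
proof (cases "x \<ge> 0")
  case True thus ?thesis using exp_bound[of x] assms by simp
next
  case False
  define y where "y = -x"
  have y: "0 \<le> y" "y \<le> 1" using False assms by (auto simp: y_def)
  \<comment> \<open>The product equals \<open>1 + y^3\<close>.\<close>
  have "1 \<le> (1 - y + y\<^sup>2) * (1 + y)"
    using y by (simp add: algebra_simps power2_eq_square)
  also have "\<dots> \<le> (1 - y + y\<^sup>2) * exp y"
    using y exp_ge_add_one_self[of y] by (intro mult_left_mono) (auto simp: power2_eq_square)
  finally show ?thesis by (simp add: y_def exp_minus field_simps)
qed

lemma chernoff:
  assumes p: "stochastic n k p" and M: "\<And>j l. j < k \<Longrightarrow> l < k \<Longrightarrow> \<bar>v j - v l\<bar> \<le> M"
    and D: "D = covf n k p v v" "D > 0" and t: "t > 0" "t * M \<le> 2 * sqrt D"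
  shows "(\<Sum>f\<in>{f\<in>outcomes n k. (\<Sum>r<n. v (f r) - mean k (p r) v) > t * sqrt D}. weight n p f) \<le> exp (- t\<^sup>2 / 4)"
proof -
  \<comment> \<open>The minimiser of \<open>s\<^sup>2 * D - s * (t * sqrt D)\<close>. The assumption
    \<open>t * M \<le> 2 * sqrt D\<close> says \<open>s * M \<le> 1\<close>, the range in which the
    quadratic bound for \<open>exp\<close> is available.\<close>
  define s where "s = t / (2 * sqrt D)"
  have s: "s > 0" "s * M \<le> 1" using t D by (auto simp: s_def field_simps)
  define u where "u = (\<lambda>r j. v j - mean k (p r) v)"
  have u: "\<bar>s * u r j\<bar> \<le> 1" if "r < n" "j < k" for r j
  proof -
    have "u r j = (\<Sum>l<k. p r l * (v j - v l))"
      using stochasticD[OF p that(1)]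
      by (simp add: u_def mean_def right_diff_distrib sum_subtractf sum_distrib_right[symmetric])
    also have "\<bar>\<dots>\<bar> \<le> (\<Sum>l<k. p r l * M)"
      using stochasticD[OF p that(1)] M that
      by (intro order_trans[OF sum_abs] sum_mono) (auto simp: abs_mult intro!: mult_mono)
    also have "\<dots> = M" using stochasticD[OF p that(1)] by (simp add: sum_distrib_right[symmetric])
    finally have "s * \<bar>u r j\<bar> \<le> s * M" using s by (intro mult_left_mono) auto
    hence "s * \<bar>u r j\<bar> \<le> 1" using s(2) by linarith
    thus ?thesis using s(1) by (simp add: abs_mult)
  qed
  have u0: "mean k (p r) (u r) = 0" if "r < n" for r
    using stochasticD[OF p that]
    by (simp add: mean_def u_def right_diff_distrib sum_subtractf sum_distrib_right[symmetric])
  have "(\<Sum>f\<in>{f\<in>outcomes n k. (\<Sum>r<n. u r (f r)) > t * sqrt D}. weight n p f) \<le>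
     (\<Sum>f\<in>{f\<in>outcomes n k. (\<Sum>r<n. u r (f r)) > t * sqrt D}. weight n p f * exp (s * (\<Sum>r<n. u r (f r)) - s * (t * sqrt D)))"
  proof (intro sum_mono)
    fix f assume f: "f \<in> {f\<in>outcomes n k. (\<Sum>r<n. u r (f r)) > t * sqrt D}"
    hence "s * (\<Sum>r<n. u r (f r)) - s * (t * sqrt D) \<ge> 0" using s by simp
    hence "1 \<le> exp (s * (\<Sum>r<n. u r (f r)) - s * (t * sqrt D))" by simp
    thus "weight n p f \<le> weight n p f * exp (s * (\<Sum>r<n. u r (f r)) - s * (t * sqrt D))"
      using mult_left_mono[of 1 _ "weight n p f"] weight_nonneg[OF p, of f] f by simp
  qed
  also have "\<dots> \<le> (\<Sum>f\<in>outcomes n k. weight n p f * exp (s * (\<Sum>r<n. u r (f r)) - s * (t * sqrt D)))"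
    using weight_nonneg[OF p] by (intro sum_mono2) auto
  also have "\<dots> = (\<Sum>f\<in>outcomes n k. \<Prod>r<n. p r (f r) * exp (s * u r (f r))) / exp (s * (t * sqrt D))"
    by (simp add: weight_def exp_diff sum_distrib_left exp_sum prod.distrib sum_divide_distrib)
  also have "\<dots> = (\<Prod>r<n. \<Sum>j<k. p r j * exp (s * u r j)) / exp (s * (t * sqrt D))"
    by (subst sum_outcomes) simp
  also have "\<dots> \<le> (\<Prod>r<n. exp (s\<^sup>2 * mean k (p r) (\<lambda>j. u r j * u r j))) / exp (s * (t * sqrt D))"
  proof (intro divide_right_mono prod_mono conjI)
    fix r assume "r \<in> {..<n}"
    hence r: "r < n" by simp
    show "0 \<le> (\<Sum>j<k. p r j * exp (s * u r j))"
      using stochasticD[OF p r] by (intro sum_nonneg) auto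
    have "(\<Sum>j<k. p r j * exp (s * u r j)) \<le> (\<Sum>j<k. p r j * (1 + s * u r j + (s * u r j)\<^sup>2))"
      using stochasticD[OF p r] u[OF r] by (intro sum_mono mult_left_mono exp_le_quadratic) auto
    also have "\<dots> = (\<Sum>j<k. p r j) + s * mean k (p r) (u r) + s\<^sup>2 * mean k (p r) (\<lambda>j. u r j * u r j)"
      by (simp add: mean_def sum.distrib sum_distrib_left algebra_simps power2_eq_square)
    also have "\<dots> = 1 + s\<^sup>2 * mean k (p r) (\<lambda>j. u r j * u r j)"
      using stochasticD[OF p r] u0[OF r] by simp
    also have "\<dots> \<le> exp (s\<^sup>2 * mean k (p r) (\<lambda>j. u r j * u r j))" by (rule exp_ge_add_one_self)
    finally show "(\<Sum>j<k. p r j * exp (s * u r j)) \<le> exp (s\<^sup>2 * mean k (p r) (\<lambda>j. u r j * u r j))" .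
  qed auto
  also have "\<dots> = exp (s\<^sup>2 * D - s * (t * sqrt D))"
    by (simp add: exp_sum[symmetric] exp_diff D covf_alt[OF p] u_def sum_distrib_left)
  also have "s\<^sup>2 * D - s * (t * sqrt D) = - t\<^sup>2 / 4"
    using D(2) by (simp add: s_def power2_eq_square field_simps)
  finally show ?thesis by (simp add: u_def)
qed

lemma chernoff_two_sided:
  assumes p: "stochastic n k p" and M: "\<And>j l. j < k \<Longrightarrow> l < k \<Longrightarrow> \<bar>v j - v l\<bar> \<le> M"
    and D: "D = covf n k p v v" "D > 0" and t: "t > 0" "t * M \<le> 2 * sqrt D"
  shows "(\<Sum>f\<in>{f\<in>outcomes n k. \<bar>\<Sum>r<n. v (f r) - mean k (p r) v\<bar> > t * sqrt D}. weight n p f) \<le> 2 * exp (- t\<^sup>2 / 4)"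
proof -
  have m: "mean k u (\<lambda>j. - v j) = - mean k u v" for u by (simp add: mean_def sum_negf)
  have D': "D = covf n k p (\<lambda>j. - v j) (\<lambda>j. - v j)" using D(1) by (simp add: covf_def m)
  let ?A = "{f\<in>outcomes n k. (\<Sum>r<n. v (f r) - mean k (p r) v) > t * sqrt D}"
  let ?B = "{f\<in>outcomes n k. (\<Sum>r<n. - v (f r) - mean k (p r) (\<lambda>j. - v j)) > t * sqrt D}"
  have neg: "(\<Sum>r<n. - v (f r) - mean k (p r) (\<lambda>j. - v j)) = - (\<Sum>r<n. v (f r) - mean k (p r) v)" for f
    by (simp add: m sum_subtractf sum_negf sum.distrib)
  have sub: "{f\<in>outcomes n k. \<bar>\<Sum>r<n. v (f r) - mean k (p r) v\<bar> > t * sqrt D} \<subseteq> ?A \<union> ?B"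
    unfolding neg by auto
  have "(\<Sum>f\<in>{f\<in>outcomes n k. \<bar>\<Sum>r<n. v (f r) - mean k (p r) v\<bar> > t * sqrt D}. weight n p f) \<le> sum (weight n p) (?A \<union> ?B)"
    using weight_nonneg[OF p] by (intro sum_mono2 sub) auto
  also have "\<dots> \<le> sum (weight n p) ?A + sum (weight n p) ?B"
    using weight_nonneg[OF p] by (subst sum_Un) (auto intro!: sum_nonneg)
  also have "\<dots> \<le> exp (- t\<^sup>2 / 4) + exp (- t\<^sup>2 / 4)"
    using M by (intro add_mono chernoff[OF p _ D t] chernoff[OF p _ D' D(2) t])
      (auto simp: abs_minus_commute)
  finally show ?thesis by simp
qed

section \<open>Counting lattice points\<close>

text \<open>A Gram--Schmidt basis left unnormalised: \<open>v m\<close> is the \<open>m\<close>-th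
  unit vector minus its \<open>B\<close>-projection on the earlier ones, so the product of the
  \<open>B (v m) (v m)\<close> is the determinant of \<open>B\<close> on the first \<open>d\<close>
  coordinates. The entry 1 on the diagonal is what allows integer coordinates to be counted one
  after the other.\<close>

definition orthogonal_family ::
    "((nat \<Rightarrow> real) \<Rightarrow> (nat \<Rightarrow> real) \<Rightarrow> real) \<Rightarrow> nat \<Rightarrow> (nat \<Rightarrow> nat \<Rightarrow> real) \<Rightarrow> bool" where
  "orthogonal_family B d v \<longleftrightarrow> (\<forall>m<d. v m m = 1 \<and> (\<forall>l>m. v m l = 0) \<and> 0 < B (v m) (v m) \<and>
     B (v m) (v m) \<le> B (\<lambda>i. if i = m then 1 else 0) (\<lambda>i. if i = m then 1 else 0) \<and>
     (\<forall>y. (\<forall>j\<ge>m. y j = 0) \<longrightarrow> B y (v m) = 0))"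

lemma bilinear_sum_left:
  fixes B :: "(nat \<Rightarrow> real) \<Rightarrow> (nat \<Rightarrow> real) \<Rightarrow> real" and m :: nat
  assumes lin: "\<And>a b x y z. B (\<lambda>j. a * x j + b * y j) z = a * B x z + b * B y z"
  shows "B (\<lambda>i. \<Sum>l<m. c l * v l i) z = (\<Sum>l<m. c l * B (v l) z)"
proof (induction m)
  case 0
  show ?case using lin[of 0 _ 0 _ z] by simp
next
  case (Suc m)
  have "B (\<lambda>i. 1 * (\<Sum>l<m. c l * v l i) + c m * v m i) z = 1 * B (\<lambda>i. \<Sum>l<m. c l * v l i) z + c m * B (v m) z"
    by (rule lin)
  thus ?case using Suc by simp
qed

lemma gram_schmidt:
  fixes B :: "(nat \<Rightarrow> real) \<Rightarrow> (nat \<Rightarrow> real) \<Rightarrow> real"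
  assumes lin: "\<And>a b x y z. B (\<lambda>j. a * x j + b * y j) z = a * B x z + b * B y z"
    and sym: "\<And>x y. B x y = B y x"
    and pos: "\<And>x j. (\<And>i. i \<ge> d \<Longrightarrow> x i = 0) \<Longrightarrow> x j \<noteq> 0 \<Longrightarrow> 0 < B x x"
  shows "\<exists>v. orthogonal_family B d v"
proof -
  have "\<exists>v. orthogonal_family B m v" if "m \<le> d" for m
    using that
  proof (induction m)
    case 0
    thus ?case by (simp add: orthogonal_family_def)
  next
    case (Suc m)
    then obtain v where v: "orthogonal_family B m v" by auto
    have vl: "v l l = 1" "\<And>i. i > l \<Longrightarrow> v l i = 0" "0 < B (v l) (v l)"
      "\<And>y. (\<And>j. j \<ge> l \<Longrightarrow> y j = 0) \<Longrightarrow> B y (v l) = 0" if "l < m" for l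
      using v that by (auto simp: orthogonal_family_def)
    have orth: "B (v l) (v l') = 0" if "l < m" "l' < m" "l \<noteq> l'" for l l'
    proof (cases "l < l'")
      case True
      thus ?thesis using that vl(4)[of l' "v l"] vl(2)[of l] by auto
    next
      case False
      thus ?thesis using that vl(4)[of l "v l'"] vl(2)[of l'] sym[of "v l"] by auto
    qed
    define e :: "nat \<Rightarrow> real" where "e = (\<lambda>i. if i = m then 1 else 0)"
    define c where "c = (\<lambda>l. B e (v l) / B (v l) (v l))"
    define w where "w = (\<lambda>i. 1 * e i + (-1) * (\<Sum>l<m. c l * v l i))"
    have Bw: "B w z = B e z - (\<Sum>l<m. c l * B (v l) z)" for z
      unfolding w_def lin bilinear_sum_left[of B, OF lin] by simp
    have wv: "B w (v l) = 0" if l: "l < m" for l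
    proof -
      have "(\<Sum>i<m. c i * B (v i) (v l)) = (\<Sum>i<m. if i = l then c l * B (v l) (v l) else 0)"
        using orth l by (intro sum.cong) auto
      also have "\<dots> = B e (v l)" using vl(3)[OF l] l by (simp add: c_def)
      finally show ?thesis by (simp add: Bw)
    qed
    have wm: "w m = 1" using vl(2) by (simp add: w_def e_def)
    have wi: "w i = 0" if "i > m" for i using that vl(2) by (simp add: w_def e_def)
    \<comment> \<open>Coordinates are cleared from the top: subtracting \<open>y i\<close> times
      \<open>v i\<close> removes coordinate \<open>i\<close>, and \<open>w\<close> is orthogonal to
      \<open>v i\<close>.\<close>
    have yw: "B y w = 0" if "\<And>j. j \<ge> i \<Longrightarrow> y j = 0" "i \<le> m" for y i
      using that
    proof (induction i arbitrary: y)
      case 0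
      hence "y = (\<lambda>_. 0)" by auto
      thus ?case using lin[of 0 _ 0 _ w] by simp
    next
      case (Suc i)
      define z where "z = (\<lambda>j. 1 * y j + (- y i) * v i j)"
      have "B z w = 0"
      proof (rule Suc.IH)
        fix j assume "j \<ge> i"
        thus "z j = 0" using Suc.prems vl[of i] by (cases "j = i") (auto simp: z_def)
      qed (use Suc.prems in simp)
      moreover have "B (v i) w = 0" using wv[of i] sym[of w] Suc.prems by simp
      ultimately show ?case unfolding z_def lin by simp
    qed
    have ww: "B w w = B w e"
    proof -
      have "B w w = 1 * B e w + (-1) * B (\<lambda>i. \<Sum>l<m. c l * v l i) w"
        by (subst w_def) (rule lin)
      also have "B (\<lambda>i. \<Sum>l<m. c l * v l i) w = (\<Sum>l<m. c l * B (v l) w)"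
        by (rule bilinear_sum_left[of B, OF lin])
      also have "\<dots> = 0" using wv sym[of w] by (intro sum.neutral) auto
      finally show ?thesis using sym[of w e] by simp
    qed
    \<comment> \<open>Each term is a square over a positive number: the projection can only lower
      the variance.\<close>
    have "(\<Sum>l<m. c l * B (v l) e) \<ge> 0"
      using sym[of e] vl(3) by (intro sum_nonneg) (auto simp: c_def zero_le_square intro!: divide_nonneg_pos)
    hence we: "B w w \<le> B e e" using ww Bw[of e] by simp
    have wpos: "0 < B w w" using wm wi Suc.prems by (intro pos[of w m]) auto
    have "orthogonal_family B (Suc m) (v(m := w))"
      unfolding orthogonal_family_def
    proof (intro allI impI)
      fix l assume l: "l < Suc m"
      show "(v(m := w)) l l = 1 \<and> (\<forall>i>l. (v(m := w)) l i = 0) \<and> 0 < B ((v(m := w)) l) ((v(m := w)) l) \<and>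
         B ((v(m := w)) l) ((v(m := w)) l) \<le> B (\<lambda>i. if i = l then 1 else 0) (\<lambda>i. if i = l then 1 else 0) \<and>
         (\<forall>y. (\<forall>j\<ge>l. y j = 0) \<longrightarrow> B y ((v(m := w)) l) = 0)"
      proof (cases "l = m")
        case True
        thus ?thesis using wm wi wpos we yw[of m] by (auto simp: e_def)
      next
        case False
        hence "l < m" using l by simp
        thus ?thesis using v False unfolding orthogonal_family_def by auto
      qed
    qed
    thus ?case by blast
  qed
  thus ?thesis by blast
qed

section \<open>Lattice points under quadratic and triangular constraints\<close>

lemma card_int_interval:
  fixes a h :: real assumes "0 \<le> h"
  shows "finite {t::int. \<bar>of_int t - a\<bar> \<le> h}" "real (card {t::int. \<bar>of_int t - a\<bar> \<le> h}) \<le> 2 * h + 1"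
proof -
  have e: "{t::int. \<bar>of_int t - a\<bar> \<le> h} = {\<lceil>a - h\<rceil>..\<lfloor>a + h\<rfloor>}"
    by (auto simp: abs_le_iff ceiling_le_iff le_floor_iff)
  show "finite {t::int. \<bar>of_int t - a\<bar> \<le> h}" unfolding e by simp
  have "of_int (\<lfloor>a + h\<rfloor> - \<lceil>a - h\<rceil> + 1) \<le> 2 * h + 1" by (simp) linarith
  thus "real (card {t::int. \<bar>of_int t - a\<bar> \<le> h}) \<le> 2 * h + 1"
    unfolding e using assms by simp
qed

text \<open>Orthogonality gives \<open>B x x = B y y + c\<^sup>2 * D\<close> for
  \<open>x = y + c * v d\<close>. So the last coordinate lies in an interval, and for each of its
  values \<open>y\<close> is again in the ellipsoid. Subtracting \<open>c * v d\<close> destroys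
  integrality in the lower coordinates, and the real offset \<open>s\<close> is carried through the
  induction to absorb this.\<close>

lemma card_lattice_ellipsoid:
  fixes B :: "(nat \<Rightarrow> real) \<Rightarrow> (nat \<Rightarrow> real) \<Rightarrow> real"
  assumes lin: "\<And>a b x y z. B (\<lambda>j. a * x j + b * y j) z = a * B x z + b * B y z"
    and sym: "\<And>x y. B x y = B y x" and nonneg: "\<And>x. 0 \<le> B x x"
    and v: "orthogonal_family B d v" and N: "0 < N" and R: "0 \<le> R"
    and s: "\<And>j. j \<ge> d \<Longrightarrow> s j = 0"
  defines "G \<equiv> \<lambda>d s. {b :: nat \<Rightarrow> int. (\<forall>j\<ge>d. b j = 0) \<and>
     B (\<lambda>j. of_int (b j) / N + s j) (\<lambda>j. of_int (b j) / N + s j) \<le> R}"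
  shows "finite (G d s) \<and> real (card (G d s)) \<le> (\<Prod>j<d. 2 * (N * sqrt (R / B (v j) (v j))) + 1)"
  using v s
proof (induction d arbitrary: s)
  case 0
  have "G 0 s \<subseteq> {\<lambda>_. 0}" by (auto simp: G_def)
  thus ?case using card_mono[of "{\<lambda>_::nat. 0::int}" "G 0 s"] finite_subset[of "G 0 s" "{\<lambda>_. 0}"] by auto
next
  case (Suc d)
  define D where "D = B (v d) (v d)"
  have vd: "v d d = 1" "\<And>l. l > d \<Longrightarrow> v d l = 0" "0 < D"
    "\<And>y. (\<And>j. j \<ge> d \<Longrightarrow> y j = 0) \<Longrightarrow> B y (v d) = 0"
    using Suc.prems(1) by (auto simp: orthogonal_family_def D_def)
  have fam: "orthogonal_family B d v" using Suc.prems(1) by (auto simp: orthogonal_family_def)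
  define h where "h = N * sqrt (R / D)"
  have h: "h \<ge> 0" using N R vd by (simp add: h_def)
  define I where "I = {t::int. \<bar>of_int t - (- N * s d)\<bar> \<le> h}"
  have I: "finite I" "real (card I) \<le> 2 * h + 1"
    unfolding I_def by (rule card_int_interval[OF h])+
  \<comment> \<open>The offset after removing the component along \<open>v d\<close>, whose
    coefficient is \<open>t / N + s d\<close> when the last integer is \<open>t\<close>.\<close>
  define s' where "s' = (\<lambda>t::int. \<lambda>j. if j < d then s j - (of_int t / N + s d) * v d j else 0)"
  have s': "s' t j = 0" if "j \<ge> d" for t j using that by (simp add: s'_def)
  have IH: "finite (G d (s' t))" "real (card (G d (s' t))) \<le> (\<Prod>j<d. 2 * (N * sqrt (R / B (v j) (v j))) + 1)" for t
    using Suc.IH[OF fam, of "s' t"] s' by auto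
  have sub: "G (Suc d) s \<subseteq> (\<Union>t\<in>I. (\<lambda>b. b(d := t)) ` G d (s' t))"
  proof
    fix b assume b: "b \<in> G (Suc d) s"
    define x where "x = (\<lambda>j. of_int (b j) / N + s j)"
    define c where "c = x d"
    define y where "y = (\<lambda>j. 1 * x j + (- c) * v d j)"
    have x0: "x j = 0" if "j > d" for j using that b Suc.prems(2)[of j] by (auto simp: x_def G_def)
    have y0: "y j = 0" if "j \<ge> d" for j
      using that x0[of j] vd(1) vd(2)[of j] by (cases "j = d") (auto simp: y_def c_def)
    have "B y (v d) = 0" by (rule vd(4)) (rule y0)
    moreover have xy: "x = (\<lambda>j. 1 * y j + c * v d j)" by (auto simp: y_def)
    moreover have "B x z = 1 * B y z + c * B (v d) z" for z by (subst xy) (rule lin)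
    ultimately have "B x x = B y y + c\<^sup>2 * D"
      using sym[of y x] sym[of "v d" x] sym[of "v d" y] by (simp add: D_def power2_eq_square)
    moreover have "B x x \<le> R" using b by (simp add: G_def x_def)
    moreover have "0 \<le> c\<^sup>2 * D" using vd(3) by simp
    ultimately have le: "B y y \<le> R" "c\<^sup>2 * D \<le> R"
      using nonneg[of y] by linarith+
    have "\<bar>c\<bar> \<le> sqrt (R / D)" using le(2) vd(3) by (intro real_le_rsqrt) (simp add: field_simps)
    hence "N * \<bar>c\<bar> \<le> h" unfolding h_def using N by (intro mult_left_mono) auto
    moreover have "of_int (b d) - (- N * s d) = N * c" using N by (simp add: c_def x_def field_simps)
    ultimately have "b d \<in> I" using N by (simp add: I_def abs_mult)
    moreover have "b(d := 0) \<in> G d (s' (b d))"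
    proof -
      have "(\<lambda>j. of_int ((b(d := 0)) j) / N + s' (b d) j) = y"
      proof
        fix j show "of_int ((b(d := 0)) j) / N + s' (b d) j = y j"
          using y0[of j] b by (cases "j < d") (auto simp: s'_def y_def x_def c_def G_def algebra_simps)
      qed
      thus ?thesis using b le(1) by (auto simp: G_def)
    qed
    moreover have "b = (b(d := 0))(d := b d)" by auto
    ultimately show "b \<in> (\<Union>t\<in>I. (\<lambda>b. b(d := t)) ` G d (s' t))" by blast
  qed
  have fin: "finite (\<Union>t\<in>I. (\<lambda>b. b(d := t)) ` G d (s' t))" using I IH by auto
  have "card (G (Suc d) s) \<le> (\<Sum>t\<in>I. card ((\<lambda>b. b(d := t)) ` G d (s' t)))"
    using card_mono[OF fin sub] card_UN_le[OF I(1), of "\<lambda>t. (\<lambda>b. b(d := t)) ` G d (s' t)"] by linarith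
  also have "\<dots> \<le> (\<Sum>t\<in>I. card (G d (s' t)))" by (intro sum_mono card_image_le IH)
  finally have "real (card (G (Suc d) s)) \<le> (\<Sum>t\<in>I. real (card (G d (s' t))))"
    by (simp flip: of_nat_sum)
  also have "\<dots> \<le> (\<Sum>t\<in>I. (\<Prod>j<d. 2 * (N * sqrt (R / B (v j) (v j))) + 1))" by (intro sum_mono IH)
  also have "\<dots> = real (card I) * (\<Prod>j<d. 2 * (N * sqrt (R / B (v j) (v j))) + 1)" by simp
  also have "\<dots> \<le> (2 * h + 1) * (\<Prod>j<d. 2 * (N * sqrt (R / B (v j) (v j))) + 1)"
    using N R nonneg by (intro mult_right_mono I prod_nonneg) auto
  finally show ?case using finite_subset[OF sub fin] by (simp add: h_def D_def mult_ac)
qed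

text \<open>Constraint \<open>j\<close> has coefficient 1 at \<open>x j\<close> and involves no
  later coordinate. With the earlier ones fixed, it confines \<open>x j\<close> to an interval of
  length \<open>2 * h j\<close>.\<close>

lemma card_lattice_triangular:
  fixes v :: "nat \<Rightarrow> nat \<Rightarrow> real" and m :: "nat \<Rightarrow> real"
  assumes v: "\<And>j. j < d \<Longrightarrow> v j j = 1" and h: "\<And>j. j < d \<Longrightarrow> 0 \<le> h j"
  defines "G \<equiv> \<lambda>d. {x :: nat \<Rightarrow> int. (\<forall>j\<ge>d. x j = 0) \<and> (\<forall>j<d. \<bar>(\<Sum>l\<le>j. of_int (x l) * v j l) - m j\<bar> \<le> h j)}"
  shows "finite (G d) \<and> real (card (G d)) \<le> (\<Prod>j<d. 2 * h j + 1)"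
  using v h
proof (induction d)
  case 0
  have "G 0 \<subseteq> {\<lambda>_. 0}" by (auto simp: G_def)
  thus ?case using card_mono[of "{\<lambda>_::nat. 0::int}" "G 0"] finite_subset[of "G 0" "{\<lambda>_. 0}"] by auto
next
  case (Suc d)
  hence IH: "finite (G d)" "real (card (G d)) \<le> (\<Prod>j<d. 2 * h j + 1)" by auto
  have hd: "0 \<le> h d" "v d d = 1" using Suc.prems by auto
  define I where "I = (\<lambda>x::nat\<Rightarrow>int. {t::int. \<bar>of_int t - (m d - (\<Sum>l<d. of_int (x l) * v d l))\<bar> \<le> h d})"
  have I: "finite (I x)" "real (card (I x)) \<le> 2 * h d + 1" for x
    unfolding I_def by (rule card_int_interval[OF hd(1)])+
  have sub: "G (Suc d) \<subseteq> (\<Union>x\<in>G d. (\<lambda>t. x(d := t)) ` I x)"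
  proof
    fix x assume x: "x \<in> G (Suc d)"
    have s: "(\<Sum>l\<le>j. of_int ((x(d := 0)) l) * v j l) = (\<Sum>l\<le>j. of_int (x l) * v j l)" if "j < d" for j
      using that by (intro sum.cong) auto
    have "x(d := 0) \<in> G d" using x s by (auto simp: G_def)
    moreover have "(\<Sum>l<d. of_int ((x(d := 0)) l) * v d l) = (\<Sum>l<d. of_int (x l) * v d l)"
      by (intro sum.cong) auto
    hence "x d \<in> I (x(d := 0))" using x hd
      by (auto simp: I_def G_def lessThan_Suc_atMost[symmetric] algebra_simps)
    moreover have "x = (x(d := 0))(d := x d)" by auto
    ultimately show "x \<in> (\<Union>x\<in>G d. (\<lambda>t. x(d := t)) ` I x)" by blast
  qed
  have fin: "finite (\<Union>x\<in>G d. (\<lambda>t. x(d := t)) ` I x)" using I IH by auto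
  have "card (G (Suc d)) \<le> (\<Sum>x\<in>G d. card ((\<lambda>t. x(d := t)) ` I x))"
    using card_mono[OF fin sub] card_UN_le[OF IH(1), of "\<lambda>x. (\<lambda>t. x(d := t)) ` I x"] by linarith
  also have "\<dots> \<le> (\<Sum>x\<in>G d. card (I x))" by (intro sum_mono card_image_le I)
  finally have "real (card (G (Suc d))) \<le> (\<Sum>x\<in>G d. real (card (I x)))"
    by (simp flip: of_nat_sum)
  also have "\<dots> \<le> (\<Sum>x\<in>G d. 2 * h d + 1)" by (intro sum_mono I)
  also have "\<dots> = real (card (G d)) * (2 * h d + 1)" by simp
  also have "\<dots> \<le> (\<Prod>j<d. 2 * h j + 1) * (2 * h d + 1)" using hd by (intro mult_right_mono IH) auto
  finally show ?case using finite_subset[OF sub fin] by simp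
qed

section \<open>Discrete Fourier inversion\<close>

definition charf :: "nat \<Rightarrow> nat \<Rightarrow> (nat \<Rightarrow> nat \<Rightarrow> real) \<Rightarrow> (nat \<Rightarrow> real) \<Rightarrow> complex" where
  "charf n k p \<xi> = (\<Prod>r<n. \<Sum>j<k. of_real (p r j) * cis (2 * pi * \<xi> j))"

text \<open>The count of the last outcome is omitted, since the counts add up to \<open>n\<close>.\<close>

definition point :: "nat \<Rightarrow> nat \<Rightarrow> (nat \<Rightarrow> nat) \<Rightarrow> nat \<Rightarrow> int" where
  "point n d f = (\<lambda>j. if j < d then int (cnt n f j) else 0)"

definition law :: "nat \<Rightarrow> nat \<Rightarrow> (nat \<Rightarrow> nat \<Rightarrow> real) \<Rightarrow> (nat \<Rightarrow> int) \<Rightarrow> real" where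
  "law n d p y = (\<Sum>f\<in>{f\<in>outcomes n (Suc d). point n d f = y}. weight n p f)"

text \<open>A count takes the values 0 to \<open>n\<close>, so two counts differ by less than
  \<open>n + 1\<close> and the roots of unity of order \<open>n + 1\<close> tell them apart.\<close>

definition freqs :: "nat \<Rightarrow> nat \<Rightarrow> (nat \<Rightarrow> nat) set" where
  "freqs n d = PiE {..<d} (\<lambda>_. {..<Suc n})"

definition freq :: "nat \<Rightarrow> nat \<Rightarrow> (nat \<Rightarrow> nat) \<Rightarrow> nat \<Rightarrow> real" where
  "freq n d a = (\<lambda>j. if j < d then real (a j) / real (Suc n) else 0)"

lemma finite_freqs [simp]: "finite (freqs n d)"
  unfolding freqs_def by (intro finite_PiE) auto

lemma card_freqs: "card (freqs n d) = Suc n ^ d"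
  unfolding freqs_def by (simp add: card_PiE)

lemma cis_sum: "cis (\<Sum>x\<in>A. g x) = (\<Prod>x\<in>A. cis (g x))"
  by (induction A rule: infinite_finite_induct) (auto simp: cis_mult[symmetric])

lemma sum_cis_roots:
  fixes m :: int and N :: nat
  assumes N: "0 < N" and m: "\<bar>m\<bar> < int N"
  shows "(\<Sum>t<N. cis (2 * pi * (real t * of_int m / real N))) = (if m = 0 then of_nat N else 0)"
proof (cases "m = 0")
  case False
  define z where "z = cis (2 * pi * (of_int m / real N))"
  have "z \<noteq> 1"
  proof
    assume "z = 1"
    hence "cos (2 * pi * (of_int m / real N)) = 1"
      unfolding z_def by (metis cis.simps(1) one_complex.simps(1))
    then obtain i :: int where "2 * pi * (of_int m / real N) = of_int i * 2 * pi"
      using cos_one_2pi_int by auto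
    hence "real_of_int m = of_int i * real N" using N by (simp add: field_simps)
    hence mi: "m = i * int N" by (metis of_int_eq_iff of_int_mult of_int_of_nat_eq)
    hence "i \<noteq> 0" using False by auto
    hence "1 * int N \<le> \<bar>i\<bar> * int N" by (intro mult_right_mono) auto
    thus False using m by (simp add: mi abs_mult)
  qed
  have "real N * (2 * pi * (of_int m / real N)) = 2 * pi * of_int m" using N by simp
  hence "z ^ N = cis (2 * pi * of_int m)" unfolding z_def Complex.DeMoivre by (simp only:)
  hence "z ^ N = 1" by simp
  have "(\<Sum>t<N. cis (2 * pi * (real t * of_int m / real N))) = (\<Sum>t<N. z ^ t)"
  proof (intro sum.cong refl)
    fix t
    have "2 * pi * (real t * of_int m / real N) = real t * (2 * pi * (of_int m / real N))" by simp
    thus "cis (2 * pi * (real t * of_int m / real N)) = z ^ t" by (simp only: z_def Complex.DeMoivre)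
  qed
  also have "\<dots> = 0" using \<open>z \<noteq> 1\<close> \<open>z ^ N = 1\<close> by (simp add: geometric_sum)
  finally show ?thesis using False by simp
qed simp

lemma charf_outcomes:
  "charf n k p \<xi> = (\<Sum>f\<in>outcomes n k. of_real (weight n p f) * cis (2 * pi * (\<Sum>j<k. real (cnt n f j) * \<xi> j)))"
proof -
  have "charf n k p \<xi> = (\<Sum>f\<in>outcomes n k. \<Prod>r<n. of_real (p r (f r)) * cis (2 * pi * \<xi> (f r)))"
    unfolding charf_def by (rule sum_outcomes[symmetric])
  also have "\<dots> = (\<Sum>f\<in>outcomes n k. of_real (weight n p f) * cis (2 * pi * (\<Sum>r<n. \<xi> (f r))))"
    by (simp add: weight_def prod.distrib cis_sum sum_distrib_left)
  finally show ?thesis by (simp add: sum_cnt cong: sum.cong)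
qed

text \<open>Orthogonality of the characters of \<open>(Z/(n+1))^d\<close>. Counts and
  \<open>y\<close> both lie between 0 and \<open>n\<close>, so agreement modulo \<open>n + 1\<close>
  is equality.\<close>

lemma fourier_inversion:
  assumes y: "\<And>j. j < d \<Longrightarrow> 0 \<le> y j \<and> y j \<le> int n" "\<And>j. j \<ge> d \<Longrightarrow> y j = 0"
  shows "(\<Sum>a\<in>freqs n d. charf n (Suc d) p (freq n d a) * cis (- (2 * pi * (\<Sum>j<d. of_int (y j) * freq n d a j))))
    = of_nat (Suc n) ^ d * of_real (law n d p y)"
proof -
  let ?O = "outcomes n (Suc d)" and ?N = "Suc n"
  have kern: "(\<Sum>a\<in>freqs n d. cis (2 * pi * (\<Sum>j<Suc d. real (cnt n f j) * freq n d a j))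
        * cis (- (2 * pi * (\<Sum>j<d. of_int (y j) * freq n d a j)))) =
      (if point n d f = y then of_nat ?N ^ d else 0)" if f: "f \<in> ?O" for f
  proof -
    define m where "m = (\<lambda>j. int (cnt n f j) - y j)"
    have m: "\<bar>m j\<bar> < int ?N" if "j < d" for j
      using y(1)[OF that] cnt_le[of n f j] by (auto simp: m_def)
    have "(\<Sum>a\<in>freqs n d. cis (2 * pi * (\<Sum>j<Suc d. real (cnt n f j) * freq n d a j))
        * cis (- (2 * pi * (\<Sum>j<d. of_int (y j) * freq n d a j)))) =
      (\<Sum>a\<in>freqs n d. \<Prod>j<d. cis (2 * pi * (real (a j) * of_int (m j) / real ?N)))"
    proof (intro sum.cong refl)
      fix a
      have 1: "(\<Sum>j<Suc d. real (cnt n f j) * freq n d a j) = (\<Sum>j<d. real (cnt n f j) * (real (a j) / real ?N))"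
        by (simp add: freq_def)
      have 2: "(\<Sum>j<d. of_int (y j) * freq n d a j) = (\<Sum>j<d. of_int (y j) * (real (a j) / real ?N))"
        by (intro sum.cong) (auto simp: freq_def)
      have "2 * pi * (\<Sum>j<Suc d. real (cnt n f j) * freq n d a j) + - (2 * pi * (\<Sum>j<d. of_int (y j) * freq n d a j))
        = (\<Sum>j<d. 2 * pi * (real (a j) * of_int (m j) / real ?N))"
        unfolding 1 2 sum_distrib_left sum_negf[symmetric] sum.distrib[symmetric]
        by (intro sum.cong refl) (simp add: m_def divide_simps, simp add: algebra_simps)
      thus "cis (2 * pi * (\<Sum>j<Suc d. real (cnt n f j) * freq n d a j))
        * cis (- (2 * pi * (\<Sum>j<d. of_int (y j) * freq n d a j))) =
        (\<Prod>j<d. cis (2 * pi * (real (a j) * of_int (m j) / real ?N)))"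
        by (simp only: cis_mult cis_sum[symmetric])
    qed
    also have "\<dots> = (\<Prod>j<d. \<Sum>t<?N. cis (2 * pi * (real t * of_int (m j) / real ?N)))"
      unfolding freqs_def by (rule prod_sum_PiE[symmetric]) auto
    also have "\<dots> = (\<Prod>j<d. if m j = 0 then of_nat ?N else 0)"
      using m by (intro prod.cong refl sum_cis_roots) auto
    also have "\<dots> = (if point n d f = y then of_nat ?N ^ d else 0)"
    proof (cases "point n d f = y")
      case True
      hence "m j = 0" if "j < d" for j using that by (auto simp: m_def point_def)
      thus ?thesis using True by simp
    next
      case False
      then obtain j where "point n d f j \<noteq> y j" by auto
      hence "j < d" "m j \<noteq> 0" using y(2)[of j] by (auto simp: point_def m_def split: if_splits)
      hence "(\<Prod>j<d. if m j = 0 then of_nat ?N else (0::complex)) = 0"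
        by (intro prod_zero) auto
      thus ?thesis using False by simp
    qed
    finally show ?thesis .
  qed
  have "(\<Sum>a\<in>freqs n d. charf n (Suc d) p (freq n d a) * cis (- (2 * pi * (\<Sum>j<d. of_int (y j) * freq n d a j))))
    = (\<Sum>f\<in>?O. of_real (weight n p f) * (\<Sum>a\<in>freqs n d. cis (2 * pi * (\<Sum>j<Suc d. real (cnt n f j) * freq n d a j))
        * cis (- (2 * pi * (\<Sum>j<d. of_int (y j) * freq n d a j)))))"
    unfolding charf_outcomes sum_distrib_right by (subst sum.swap) (simp only: sum_distrib_left mult.assoc)
  also have "\<dots> = (\<Sum>f\<in>?O. of_real (weight n p f) * (if point n d f = y then of_nat ?N ^ d else 0))"
    by (intro sum.cong refl) (simp only: kern)
  also have "\<dots> = (\<Sum>f\<in>?O. if point n d f = y then of_nat ?N ^ d * of_real (weight n p f) else 0)"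
    by (intro sum.cong refl) auto
  also have "\<dots> = of_nat ?N ^ d * of_real (law n d p y)"
    by (simp add: law_def sum.inter_filter[symmetric] sum_distrib_left)
  finally show ?thesis .
qed

lemma law_diff_le:
  assumes y: "\<And>j. j < d \<Longrightarrow> 0 \<le> y j \<and> y j \<le> int n" "\<And>j. j \<ge> d \<Longrightarrow> y j = 0"
  shows "real (Suc n) ^ d * \<bar>law n d p y - law n d q y\<bar> \<le>
    (\<Sum>a\<in>freqs n d. cmod (charf n (Suc d) p (freq n d a) - charf n (Suc d) q (freq n d a)))"
proof -
  let ?c = "\<lambda>a. cis (- (2 * pi * (\<Sum>j<d. of_int (y j) * freq n d a j)))"
  have "real (Suc n) ^ d * \<bar>law n d p y - law n d q y\<bar> =
     cmod (of_nat (Suc n) ^ d * of_real (law n d p y) - of_nat (Suc n) ^ d * of_real (law n d q y))"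
    unfolding right_diff_distrib[symmetric] norm_mult of_real_diff[symmetric] norm_of_real norm_power norm_of_nat ..
  also have "\<dots> = cmod (\<Sum>a\<in>freqs n d. (charf n (Suc d) p (freq n d a) - charf n (Suc d) q (freq n d a)) * ?c a)"
    by (subst (1 2) fourier_inversion[symmetric]) (use y in \<open>auto simp: sum_subtractf left_diff_distrib\<close>)
  also have "\<dots> \<le> (\<Sum>a\<in>freqs n d. cmod (charf n (Suc d) p (freq n d a) - charf n (Suc d) q (freq n d a)))"
    by (rule order_trans[OF norm_sum]) (simp add: norm_mult)
  finally show ?thesis .
qed

section \<open>Decay of the Fourier transform and choice of representatives\<close>

lemma one_minus_cos_ge:
  fixes x :: real and k :: nat
  assumes x: "\<bar>x\<bar> \<le> 1 - 1 / (real k + 1)"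
  shows "4 * x\<^sup>2 / (real k + 1)\<^sup>2 \<le> 1 - cos (2 * pi * x)"
proof -
  \<comment> \<open>For \<open>y \<le> 1.6\<close> the Taylor bound gives
    \<open>sin y \<ge> y - y^3 / 6 \<ge> y / 2\<close>, and \<open>pi > 3\<close>.\<close>
  have sin_ge: "3 / 2 * u \<le> sin (pi * u)" if u: "0 \<le> u" "u \<le> 1 / 2" for u :: real
  proof -
    define y where "y = pi * u"
    have y: "0 \<le> y" "y \<le> 16 / 10" using u pi_gt3 pi_less_4 mult_mono[of pi "32/10" u "1/2"]
      pi_approx by (auto simp: y_def)
    have "\<bar>sin y - (\<Sum>m<3. sin_coeff m * y ^ m)\<bar> \<le> inverse (fact 3) * \<bar>y\<bar> ^ 3"
      by (rule Maclaurin_sin_bound)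
    hence "\<bar>sin y - y\<bar> * 6 \<le> y ^ 3"
      by (simp add: sin_coeff_def numeral_3_eq_3 fact_numeral y(1))
    moreover have "z \<ge> y - c / 6" if "\<bar>z - y\<bar> * 6 \<le> c" for z c :: real
    proof -
      have "(y - z) * 6 \<le> \<bar>z - y\<bar> * 6" by (intro mult_right_mono) auto
      thus ?thesis using that by (simp add: field_simps)
    qed
    ultimately have "sin y \<ge> y - y ^ 3 / 6" by blast
    moreover have "y ^ 3 \<le> y * (16 / 10)\<^sup>2"
      unfolding power3_eq_cube power2_eq_square mult.assoc using y by (intro mult_left_mono mult_mono) auto
    ultimately have "sin y \<ge> y / 2" using y by (simp add: power2_eq_square)
    moreover have "y \<ge> 3 * u" unfolding y_def using pi_gt3 u by (intro mult_right_mono) auto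
    ultimately show ?thesis unfolding y_def by simp
  qed
  define u where "u = \<bar>x\<bar>"
  have u: "0 \<le> u" "u \<le> 1 - 1 / (real k + 1)" using x by (auto simp: u_def)
  have k1: "u / (real k + 1) \<le> u" using u(1) by (simp add: divide_le_eq mult_le_cancel_left1)
  \<comment> \<open>The sine vanishes at both ends of [0, 1]. Past 1/2 it is bounded through the
    distance \<open>1 - u \<ge> 1 / (k + 1)\<close> from the far end, which costs the factor
    \<open>k + 1\<close>.\<close>
  have "3 / 2 * (u / (real k + 1)) \<le> sin (pi * u)"
  proof (cases "u \<le> 1 / 2")
    case True
    thus ?thesis using sin_ge[OF u(1)] k1 by linarith
  next
    case False
    have "u / (real k + 1) \<le> 1 / (real k + 1)"
      using u by (intro divide_right_mono) (auto intro: order_trans)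
    also have "\<dots> \<le> 1 - u" using u by simp
    finally have "3 / 2 * (u / (real k + 1)) \<le> 3 / 2 * (1 - u)" by (intro mult_left_mono) auto
    also have "\<dots> \<le> sin (pi * (1 - u))" using False u
      by (intro sin_ge) (auto intro: order_trans)
    also have "\<dots> = sin (pi * u)" using sin_pi_minus[of "pi * u"] by (simp add: algebra_simps)
    finally show ?thesis .
  qed
  moreover have "0 \<le> 3 / 2 * (u / (real k + 1))" using u by simp
  ultimately have "(3 / 2 * (u / (real k + 1)))\<^sup>2 \<le> (sin (pi * u))\<^sup>2" by (intro power_mono) auto
  moreover have "(sin (pi * u))\<^sup>2 = (1 - cos (2 * pi * x)) / 2"
  proof -
    have "cos (2 * pi * x) = cos (2 * (pi * u))" unfolding u_def by (cases "x \<ge> 0") (auto simp: mult.assoc)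
    thus ?thesis using cos_double_sin[of "pi * u"] by simp
  qed
  moreover have "(3 / 2 * (u / (real k + 1)))\<^sup>2 = 9 / 4 * (x\<^sup>2 / (real k + 1)\<^sup>2)"
    by (simp only: power_mult_distrib power_divide u_def power2_abs) simp
  moreover have "0 \<le> x\<^sup>2 / (real k + 1)\<^sup>2" by simp
  moreover have "4 * c \<le> 1 - z" if "b \<le> a" "a = (1 - z) / 2" "b = 9 / 4 * c" "0 \<le> c" for a b c z :: real
    using that by (simp add: field_simps)
  ultimately have "4 * (x\<^sup>2 / (real k + 1)\<^sup>2) \<le> 1 - cos (2 * pi * x)" by blast
  thus ?thesis by simp
qed

text \<open>Symmetrisation: the squared modulus of one factor is the mean of
  \<open>cos (2 * pi * (\<xi> j - \<xi> l))\<close> over two independent copies of the outcome, and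
  the mean of \<open>(\<xi> j - \<xi> l)\<^sup>2\<close> is twice the variance.\<close>

lemma cmod_charf_le:
  assumes p: "stochastic n k p"
    and \<xi>: "\<And>j l. j < k \<Longrightarrow> l < k \<Longrightarrow> \<bar>\<xi> j - \<xi> l\<bar> \<le> 1 - 1 / (real k + 1)"
  shows "cmod (charf n k p \<xi>) \<le> exp (- 4 * covf n k p \<xi> \<xi> / (real k + 1)\<^sup>2)"
proof -
  define K where "K = (real k + 1)\<^sup>2"
  have K: "K > 0" by (simp add: K_def)
  define V where "V = (\<lambda>r. mean k (p r) (\<lambda>j. \<xi> j * \<xi> j) - mean k (p r) \<xi> * mean k (p r) \<xi>)"
  have one: "cmod (\<Sum>j<k. of_real (p r j) * cis (2 * pi * \<xi> j)) \<le> exp (- 4 * V r / K)" if r: "r < n" for r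
  proof -
    note pr = stochasticD[OF p r]
    have "(cmod (\<Sum>j<k. of_real (p r j) * cis (2 * pi * \<xi> j)))\<^sup>2 =
      (\<Sum>j<k. p r j * cos (2 * pi * \<xi> j))\<^sup>2 + (\<Sum>j<k. p r j * sin (2 * pi * \<xi> j))\<^sup>2"
      by (simp add: cmod_power2)
    also have "\<dots> = (\<Sum>j<k. \<Sum>l<k. p r j * p r l * cos (2 * pi * (\<xi> j - \<xi> l)))"
      by (simp add: power2_eq_square sum_product sum.distrib[symmetric] cos_diff right_diff_distrib algebra_simps)
    also have "\<dots> \<le> (\<Sum>j<k. \<Sum>l<k. p r j * p r l * (1 - 4 * (\<xi> j - \<xi> l)\<^sup>2 / K))"
      using pr one_minus_cos_ge[OF \<xi>] unfolding K_def
      by (intro sum_mono mult_left_mono) (auto simp: algebra_simps)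
    also have "\<dots> = (\<Sum>j<k. \<Sum>l<k. p r j * p r l) - 4 / K * (\<Sum>j<k. \<Sum>l<k. p r j * p r l * (\<xi> j - \<xi> l)\<^sup>2)"
      by (simp add: algebra_simps sum_subtractf sum_distrib_left)
    also have "(\<Sum>j<k. \<Sum>l<k. p r j * p r l) = 1"
      using pr by (simp add: sum_distrib_left[symmetric])
    also have "(\<Sum>j<k. \<Sum>l<k. p r j * p r l * (\<xi> j - \<xi> l)\<^sup>2) = 2 * V r"
    proof -
      have "(\<Sum>j<k. \<Sum>l<k. p r j * p r l * (\<xi> j - \<xi> l)\<^sup>2) =
        (\<Sum>j<k. \<Sum>l<k. (p r j * (\<xi> j * \<xi> j)) * p r l) + (\<Sum>j<k. \<Sum>l<k. p r j * (p r l * (\<xi> l * \<xi> l)))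
         - 2 * (\<Sum>j<k. \<Sum>l<k. (p r j * \<xi> j) * (p r l * \<xi> l))"
        unfolding sum_distrib_left sum.distrib[symmetric] sum_subtractf[symmetric]
        by (intro sum.cong refl) (simp add: power2_eq_square algebra_simps)
      thus ?thesis
        by (simp only: sum_product[symmetric] pr(2)) (simp add: V_def mean_def)
    qed
    also have "1 - 4 / K * (2 * V r) \<le> exp (- (8 * V r / K))"
      using exp_ge_add_one_self[of "- (8 * V r / K)"] by simp
    also have "\<dots> = (exp (- 4 * V r / K))\<^sup>2" by (simp add: exp_double[symmetric])
    finally show ?thesis by (rule power2_le_imp_le) simp
  qed
  have "cmod (charf n k p \<xi>) = (\<Prod>r<n. cmod (\<Sum>j<k. of_real (p r j) * cis (2 * pi * \<xi> j)))"
    by (simp add: charf_def prod_norm)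
  also have "\<dots> \<le> (\<Prod>r<n. exp (- 4 * V r / K))" using one by (intro prod_mono) auto
  also have "\<dots> = exp (- 4 * covf n k p \<xi> \<xi> / K)"
    by (simp add: exp_sum[symmetric] covf_def V_def sum_distrib_left sum_divide_distrib sum_negf)
  finally show ?thesis by (simp add: K_def)
qed

text \<open>
  Rotating the circle so that one of \<open>k + 1\<close> disjoint arcs that contains none of the \<open>k\<close> points
  becomes the cut: the lifts of the points then span at most \<open>1 - 1 / (k + 1)\<close> of a turn.
\<close>

lemma gap_lift:
  fixes a :: "nat \<Rightarrow> nat"
  assumes N: "0 < N" and a: "\<And>j. j < d \<Longrightarrow> a j < N"
  shows "\<exists>b :: nat \<Rightarrow> int. (\<forall>j<d. b j = int (a j) \<or> b j = int (a j) - int N) \<and> (\<forall>j\<ge>d. b j = 0) \<and>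
    (\<forall>j<Suc d. \<forall>l<Suc d. \<bar>of_int (b j) / real N - of_int (b l) / real N\<bar> \<le> 1 - 1 / (real (Suc d) + 1))"
proof -
  \<comment> \<open>The coordinate \<open>d\<close>, fixed at 0, is a point too:
    \<open>d + 1\<close> points against \<open>d + 2\<close> arcs.\<close>
  define K where "K = d + 2"
  define a' where "a' = (\<lambda>j. if j < d then a j else 0)"
  have a': "a' j < N" for j using a N by (simp add: a'_def)
  define g where "g = (\<lambda>j. a' j * K div N)"
  have "card (g ` {..<Suc d}) < card {..<K}"
    using card_image_le[of "{..<Suc d}" g] by (simp add: K_def)
  hence "\<not> {..<K} \<subseteq> g ` {..<Suc d}"
    by (metis card_mono finite_imageI finite_lessThan linorder_not_le)
  then obtain t where t: "t < K" "\<And>j. j < Suc d \<Longrightarrow> g j \<noteq> t" by auto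
  have "g d = 0" by (simp add: g_def a'_def)
  hence t0: "t > 0" using t(2)[of d] by auto
  define b where "b = (\<lambda>j. if t < g j then int (a' j) - int N else int (a' j))"
  have gN: "g j * N \<le> a' j * K" "a' j * K < (g j + 1) * N" for j
    using N by (auto simp: g_def dividend_less_div_times add.commute[of 1] mult.commute[of N]
      intro: dividend_less_times_div)
  \<comment> \<open>With arc \<open>t\<close> free and the points beyond it turned back once, all
    lifts divided by \<open>N\<close> lie in the half-open interval from
    \<open>(t + 1) / K - 1\<close> to \<open>t / K\<close>.\<close>
  have bl: "(int t + 1) * int N - int N * int K \<le> b j * int K" "b j * int K < int t * int N" if j: "j < Suc d" for j
  proof -
    have "g j < t \<or> g j > t" using t(2)[OF j] by auto
    hence "(int t + 1) * int N - int N * int K \<le> b j * int K \<and> b j * int K < int t * int N"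
    proof
      assume g: "g j < t"
      hence "(g j + 1) * N \<le> t * N" by (intro mult_right_mono) auto
      hence "a' j * K < t * N" using gN(2)[of j] by linarith
      hence 1: "int (a' j) * int K < int t * int N" by (metis of_nat_less_iff of_nat_mult)
      have "(int t + 1) * int N \<le> int K * int N" using t(1) by (intro mult_right_mono) auto
      moreover have "0 \<le> int (a' j) * int K" by simp
      ultimately have "(int t + 1) * int N - int N * int K \<le> int (a' j) * int K"
        by (simp only: mult.commute[of "int N" "int K"])
      thus ?thesis using 1 g by (simp add: b_def)
    next
      assume g: "g j > t"
      hence "(t + 1) * N \<le> g j * N" by (intro mult_right_mono) auto
      hence "(t + 1) * N \<le> a' j * K" using gN(1)[of j] by linarith
      hence "int ((t + 1) * N) \<le> int (a' j * K)" by (simp only: of_nat_le_iff)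
      hence 1: "(int t + 1) * int N \<le> int (a' j) * int K" by (simp add: algebra_simps)
      have "(int (a' j) - int N) * int K \<le> 0" using a'[of j] by (intro mult_nonpos_nonneg) auto
      moreover have "int (a' j) - int N < 0" using a'[of j] by simp
      hence "(int (a' j) - int N) * int K < 0" by (intro mult_neg_pos) (auto simp: K_def)
      moreover have "0 \<le> int t * int N" by simp
      moreover have "b j * int K = int (a' j) * int K - int N * int K"
        using g by (simp add: b_def left_diff_distrib)
      ultimately show ?thesis using 1 by (simp only: left_diff_distrib) linarith
    qed
    thus "(int t + 1) * int N - int N * int K \<le> b j * int K" "b j * int K < int t * int N" by auto
  qed
  have "\<bar>of_int (b j) / real N - of_int (b l) / real N\<bar> \<le> 1 - 1 / (real (Suc d) + 1)"
    if "j < Suc d" "l < Suc d" for j l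
  proof -
    have "\<bar>b j * int K - b l * int K\<bar> \<le> int N * int K - int N"
      using bl[OF that(1)] bl[OF that(2)] by (simp add: algebra_simps abs_le_iff)
    hence "\<bar>(b j - b l) * int K\<bar> \<le> int N * (int K - 1)" by (simp add: algebra_simps)
    hence "real_of_int \<bar>(b j - b l) * int K\<bar> \<le> of_int (int N * (int K - 1))" by (simp only: of_int_le_iff)
    hence "\<bar>of_int (b j) - of_int (b l)\<bar> * real K \<le> real N * (real K - 1)"
      by (simp add: abs_mult)
    hence "\<bar>of_int (b j) - of_int (b l)\<bar> / real N \<le> (real K - 1) / real K"
      using N by (simp add: field_simps K_def)
    thus ?thesis using N by (simp add: diff_divide_distrib[symmetric] K_def field_simps)
  qed
  moreover have "b j = int (a j) \<or> b j = int (a j) - int N" if "j < d" for j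
    using that by (auto simp: b_def a'_def)
  moreover have "b j = 0" if "j \<ge> d" for j
    using that by (auto simp: b_def a'_def g_def)
  ultimately show ?thesis by blast
qed

section \<open>Effective supports\<close>

text \<open>The form in which the spectral hypothesis is used. It speaks of differences of
  coordinates because constant vectors have variance 0.\<close>

definition spread :: "nat \<Rightarrow> nat \<Rightarrow> real \<Rightarrow> (nat \<Rightarrow> nat \<Rightarrow> real) \<Rightarrow> bool" where
  "spread n k t p \<longleftrightarrow> (\<forall>x. \<forall>j<k. \<forall>l<k. t * (x j - x l)\<^sup>2 \<le> 2 * covf n k p x x)"

lemma spreadD: "spread n k t p \<Longrightarrow> j < k \<Longrightarrow> l < k \<Longrightarrow> t * (x j - x l)\<^sup>2 \<le> 2 * covf n k p x x"
  by (auto simp: spread_def)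

lemma charf_lift:
  fixes b :: "nat \<Rightarrow> int"
  assumes "\<And>j. j < d \<Longrightarrow> b j = int (a j) \<or> b j = int (a j) - int (Suc n)" "\<And>j. j \<ge> d \<Longrightarrow> b j = 0"
  shows "charf n k p (freq n d a) = charf n k p (\<lambda>j. of_int (b j) / real (Suc n))"
proof -
  have "cis (2 * pi * freq n d a j) = cis (2 * pi * (of_int (b j) / real (Suc n)))" for j
  proof (cases "j < d")
    case True
    have "cis (2 * pi * ((real (a j) - real (Suc n)) / real (Suc n))) = cis (2 * pi * (real (a j) / real (Suc n)) - 2 * pi)"
      by (simp add: diff_divide_distrib right_diff_distrib del: of_nat_Suc)
    also have "\<dots> = cis (2 * pi * (real (a j) / real (Suc n)))" by (simp add: cis_divide[symmetric])
    finally show ?thesis using assms(1)[OF True] True by (auto simp: freq_def simp del: of_nat_Suc)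
  next
    case False
    thus ?thesis using assms(2) by (simp add: freq_def)
  qed
  thus ?thesis by (simp add: charf_def)
qed

lemma law_nonneg: "stochastic n (Suc d) p \<Longrightarrow> 0 \<le> law n d p y"
  unfolding law_def by (intro sum_nonneg) (auto intro: weight_nonneg)

lemma sum_law:
  assumes "Z \<subseteq> point n d ` outcomes n (Suc d)"
  shows "(\<Sum>y\<in>Z. law n d p y) = (\<Sum>f\<in>{f\<in>outcomes n (Suc d). point n d f \<in> Z}. weight n p f)"
proof -
  let ?O = "{f\<in>outcomes n (Suc d). point n d f \<in> Z}"
  have fin: "finite Z" using assms by (rule finite_subset) simp
  have "(\<Sum>y\<in>Z. law n d p y) = (\<Sum>y\<in>Z. \<Sum>f\<in>{f\<in>?O. point n d f = y}. weight n p f)"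
    unfolding law_def by (intro sum.cong refl) (auto intro: sum.cong)
  also have "\<dots> = (\<Sum>f\<in>?O. weight n p f)" using fin by (intro sum.group) auto
  finally show ?thesis .
qed

lemma gram_schmidt_covf:
  assumes p: "stochastic n (Suc d) p" and t: "0 < t" "spread n (Suc d) t p"
  shows "\<exists>v. orthogonal_family (covf n (Suc d) p) d v"
proof (rule gram_schmidt)
  fix x :: "nat \<Rightarrow> real" and j assume x: "\<And>i. i \<ge> d \<Longrightarrow> x i = 0" "x j \<noteq> 0"
  hence "j < d" by (metis linorder_not_le)
  hence "t * (x j - x d)\<^sup>2 \<le> 2 * covf n (Suc d) p x x" by (intro spreadD[OF t(2)]) auto
  moreover have "0 < t * (x j - x d)\<^sup>2" using x t(1) by simp
  ultimately show "0 < covf n (Suc d) p x x" by linarith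
qed (simp_all add: covf_lin covf_commute)

lemma covf_unit_le:
  assumes p: "stochastic n k p" and m: "m < k"
  shows "covf n k p (\<lambda>i. if i = m then 1 else 0) (\<lambda>i. if i = m then 1 else 0) \<le> real n"
proof -
  have "covf n k p (\<lambda>i. if i = m then 1 else 0) (\<lambda>i. if i = m then 1 else 0) \<le> (\<Sum>r<n. 1)"
    unfolding covf_def
  proof (intro sum_mono)
    fix r assume "r \<in> {..<n}"
    hence r: "r < n" by simp
    have "p r m \<le> (\<Sum>j<k. p r j)" using stochasticD[OF p r] m by (intro member_le_sum) auto
    hence "p r m \<le> 1" using stochasticD[OF p r] by simp
    moreover have "mean k (p r) (\<lambda>i. (if i = m then 1 else 0) * (if i = m then 1 else 0)) = p r m"
      "mean k (p r) (\<lambda>i. if i = m then 1 else 0) = p r m"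
      using m by (simp_all add: mean_def if_distrib cong: if_cong)
    ultimately show "mean k (p r) (\<lambda>i. (if i = m then 1 else 0) * (if i = m then 1 else 0)) -
      mean k (p r) (\<lambda>i. if i = m then 1 else 0) * mean k (p r) (\<lambda>i. if i = m then 1 else 0) \<le> 1"
      using zero_le_square[of "p r m"] by (simp only:)
  qed
  thus ?thesis by simp
qed

text \<open>From below, coordinate \<open>j\<close> of \<open>v j\<close>, which is 1, is compared
  with the omitted coordinate \<open>d\<close>, where \<open>v j\<close> is 0. From above,
  projecting does not increase the variance of a single count.\<close>

lemma orthogonal_family_variance:
  assumes p: "stochastic n (Suc d) p" and t: "spread n (Suc d) t p"
    and v: "orthogonal_family (covf n (Suc d) p) d v" and j: "j < d"
  shows "t / 2 \<le> covf n (Suc d) p (v j) (v j)" "covf n (Suc d) p (v j) (v j) \<le> real n"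
proof -
  have "t * (v j j - v j d)\<^sup>2 \<le> 2 * covf n (Suc d) p (v j) (v j)"
    using j by (intro spreadD[OF t]) auto
  moreover have "v j j = 1" "v j d = 0" using v j by (auto simp: orthogonal_family_def)
  ultimately show "t / 2 \<le> covf n (Suc d) p (v j) (v j)" by simp
  show "covf n (Suc d) p (v j) (v j) \<le> real n"
    using v j covf_unit_le[OF p, of j] unfolding orthogonal_family_def by fastforce
qed

lemma sum_cnt_triangular:
  assumes f: "f \<in> outcomes n (Suc d)" and v: "\<And>l. l > j \<Longrightarrow> v l = 0" and j: "j < d"
  shows "(\<Sum>r<n. v (f r)) = (\<Sum>l\<le>j. of_int (point n d f l) * (v l :: real))"
proof -
  have "(\<Sum>r<n. v (f r)) = (\<Sum>l<Suc d. real (cnt n f l) * v l)" by (rule sum_cnt[OF f])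
  also have "\<dots> = (\<Sum>l\<le>j. real (cnt n f l) * v l)"
    using j v by (intro sum.mono_neutral_right) auto
  also have "\<dots> = (\<Sum>l\<le>j. of_int (point n d f l) * v l)"
    using j by (intro sum.cong) (auto simp: point_def)
  finally show ?thesis .
qed

lemma sum_UN_le:
  fixes f :: "'a \<Rightarrow> real"
  assumes "finite I" "\<And>i. i \<in> I \<Longrightarrow> finite (A i)" "\<And>x i. i \<in> I \<Longrightarrow> x \<in> A i \<Longrightarrow> 0 \<le> f x"
  shows "sum f (\<Union>i\<in>I. A i) \<le> (\<Sum>i\<in>I. sum f (A i))"
  using assms
proof (induction I rule: finite_induct)
  case (insert i I)
  have "sum f (A i \<union> (\<Union>i\<in>I. A i)) \<le> sum f (A i) + sum f (\<Union>i\<in>I. A i)"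
    using insert.prems insert.hyps by (subst sum_Un) (auto intro!: sum_nonneg)
  also have "\<dots> \<le> sum f (A i) + (\<Sum>i\<in>I. sum f (A i))" using insert by auto
  finally show ?case using insert.hyps by simp
qed simp

text \<open>Chernoff for the \<open>d\<close> linear statistics \<open>v j\<close>, joined by a
  union bound: the typical outcomes satisfy triangular constraints of width
  \<open>\<tau> * sqrt (D j)\<close>, and lattice points under these are counted coordinate by
  coordinate.\<close>

lemma effective_support:
  assumes p: "stochastic n (Suc d) p" and t: "2 \<le> t" "spread n (Suc d) t p"
    and v: "orthogonal_family (covf n (Suc d) p) d v" and \<tau>: "1 \<le> \<tau>" "\<tau>\<^sup>2 \<le> 2 * t"
  obtains S where "S \<subseteq> point n d ` outcomes n (Suc d)"
    "real (card S) \<le> (\<Prod>j<d. 3 * \<tau> * sqrt (covf n (Suc d) p (v j) (v j)))"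
    "(\<Sum>y\<in>point n d ` outcomes n (Suc d) - S. law n d p y) \<le> 2 * real d * exp (- \<tau>\<^sup>2 / 4)"
proof -
  let ?O = "outcomes n (Suc d)"
  define D where "D = (\<lambda>j. covf n (Suc d) p (v j) (v j))"
  have D: "t / 2 \<le> D j" "1 \<le> D j" if "j < d" for j
    using orthogonal_family_variance(1)[OF p t(2) v that] t by (auto simp: D_def)
  have vv: "v j j = 1" "\<And>l. l > j \<Longrightarrow> v j l = 0" if "j < d" for j
    using v that by (auto simp: orthogonal_family_def)
  define m where "m = (\<lambda>j. \<Sum>r<n. mean (Suc d) (p r) (v j))"
  define S where "S = {y\<in>point n d ` ?O. \<forall>j<d. \<bar>(\<Sum>l\<le>j. of_int (y l) * v j l) - m j\<bar> \<le> \<tau> * sqrt (D j)}"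
  have h: "0 \<le> \<tau> * sqrt (D j)" if "j < d" for j using D[OF that] \<tau> by simp
  let ?G = "{x :: nat \<Rightarrow> int. (\<forall>j\<ge>d. x j = 0) \<and> (\<forall>j<d. \<bar>(\<Sum>l\<le>j. of_int (x l) * v j l) - m j\<bar> \<le> \<tau> * sqrt (D j))}"
  have G: "finite ?G" "real (card ?G) \<le> (\<Prod>j<d. 2 * (\<tau> * sqrt (D j)) + 1)"
    using card_lattice_triangular[of d v "\<lambda>j. \<tau> * sqrt (D j)" m] vv h by auto
  show thesis
  proof
    show "S \<subseteq> point n d ` ?O" by (auto simp: S_def)
    have "S \<subseteq> ?G" by (auto simp: S_def point_def)
    hence "real (card S) \<le> real (card ?G)" using G(1) by (simp add: card_mono)
    also note G(2)
    \<comment> \<open>Each width is at least 1, so rounding to integers costs only the step from 2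
      to 3.\<close>
    also have "(\<Prod>j<d. 2 * (\<tau> * sqrt (D j)) + 1) \<le> (\<Prod>j<d. 3 * \<tau> * sqrt (D j))"
    proof (intro prod_mono conjI)
      fix j assume "j \<in> {..<d}"
      hence j: "j < d" by simp
      have "1 * 1 \<le> \<tau> * sqrt (D j)" using \<tau>(1) D[OF j] by (intro mult_mono) auto
      thus "2 * (\<tau> * sqrt (D j)) + 1 \<le> 3 * \<tau> * sqrt (D j)" "0 \<le> 2 * (\<tau> * sqrt (D j)) + 1" by auto
    qed
    finally show "real (card S) \<le> (\<Prod>j<d. 3 * \<tau> * sqrt (covf n (Suc d) p (v j) (v j)))"
      by (simp add: D_def)
    define bad where "bad = (\<lambda>j. {f\<in>?O. \<bar>\<Sum>r<n. v j (f r) - mean (Suc d) (p r) (v j)\<bar> > \<tau> * sqrt (D j)})"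
    have bad: "(\<Sum>f\<in>bad j. weight n p f) \<le> 2 * exp (- \<tau>\<^sup>2 / 4)" if j: "j < d" for j
      unfolding bad_def
    proof (rule chernoff_two_sided[OF p])
      fix i l assume il: "i < Suc d" "l < Suc d"
      have "t * (v j i - v j l)\<^sup>2 \<le> 2 * D j" unfolding D_def by (rule spreadD[OF t(2) il])
      hence "(v j i - v j l)\<^sup>2 \<le> 2 * D j / t" using t(1) by (simp add: field_simps)
      thus "\<bar>v j i - v j l\<bar> \<le> sqrt (2 * D j / t)" by (rule real_le_rsqrt[of "\<bar>_\<bar>", simplified])
    next
      \<comment> \<open>The entries of \<open>v j\<close> differ by at most
        \<open>sqrt (2 * D j / t)\<close>, so the range condition of the Chernoff bound is exactly
        \<open>\<tau>\<^sup>2 \<le> 2 * t\<close>.\<close>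
      have "\<tau> * sqrt (2 * D j / t) = sqrt (\<tau>\<^sup>2 * (2 * D j / t))" 
        unfolding real_sqrt_mult[of "\<tau>\<^sup>2"] using \<tau> by simp
      also have "\<dots> \<le> sqrt (2\<^sup>2 * D j)"
      proof (rule real_sqrt_le_mono)
        have "\<tau>\<^sup>2 * (2 * D j) \<le> 2 * t * (2 * D j)" using \<tau>(2) D[OF j] by (intro mult_right_mono) auto
        thus "\<tau>\<^sup>2 * (2 * D j / t) \<le> 2\<^sup>2 * D j" using t(1) by (simp add: field_simps)
      qed
      also have "\<dots> = 2 * sqrt (D j)" by (simp add: real_sqrt_mult)
      finally show "\<tau> * sqrt (2 * D j / t) \<le> 2 * sqrt (D j)" .
    qed (use D[OF j] \<tau> in \<open>auto simp: D_def\<close>)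
    have "(\<Sum>y\<in>point n d ` ?O - S. law n d p y) =
       (\<Sum>f\<in>{f\<in>?O. point n d f \<in> point n d ` ?O - S}. weight n p f)" by (rule sum_law) auto
    also have "\<dots> \<le> (\<Sum>f\<in>(\<Union>j<d. bad j). weight n p f)"
    proof (rule sum_mono2)
      show "{f\<in>?O. point n d f \<in> point n d ` ?O - S} \<subseteq> (\<Union>j<d. bad j)"
      proof
        fix f assume "f \<in> {f\<in>?O. point n d f \<in> point n d ` ?O - S}"
        hence f: "f \<in> ?O" "point n d f \<notin> S" by auto
        then obtain j where j: "j < d" "\<bar>(\<Sum>l\<le>j. of_int (point n d f l) * v j l) - m j\<bar> > \<tau> * sqrt (D j)"
          unfolding S_def by fastforce
        have "(\<Sum>r<n. v j (f r) - mean (Suc d) (p r) (v j)) = (\<Sum>l\<le>j. of_int (point n d f l) * v j l) - m j"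
          using sum_cnt_triangular[OF f(1), of j "v j"] vv(2)[OF j(1)] j(1) by (simp add: sum_subtractf m_def)
        thus "f \<in> (\<Union>j<d. bad j)" using f(1) j unfolding bad_def by (intro UN_I[of j]) auto
      qed
    qed (auto simp: bad_def intro: weight_nonneg[OF p])
    also have "\<dots> \<le> (\<Sum>j<d. \<Sum>f\<in>bad j. weight n p f)"
      by (rule sum_UN_le) (auto simp: bad_def intro: weight_nonneg[OF p])
    also have "\<dots> \<le> (\<Sum>j<d. 2 * exp (- \<tau>\<^sup>2 / 4))" by (intro sum_mono bad) auto
    finally show "(\<Sum>y\<in>point n d ` ?O - S. law n d p y) \<le> 2 * real d * exp (- \<tau>\<^sup>2 / 4)" by simp
  qed
qed

text \<open>The lift is injective, since \<open>a j\<close> lies between 0 and \<open>n\<close> and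
  is determined by its residue modulo \<open>n + 1\<close>; hence the lattice points of an ellipsoid
  bound the number of frequencies.\<close>

lemma card_effective_freqs:
  fixes b :: "(nat \<Rightarrow> nat) \<Rightarrow> nat \<Rightarrow> int"
  assumes p: "stochastic n (Suc d) p" and t: "2 \<le> t" "spread n (Suc d) t p"
    and v: "orthogonal_family (covf n (Suc d) p) d v" and R: "1 \<le> R"
    and b: "\<And>a j. a \<in> freqs n d \<Longrightarrow> j < d \<Longrightarrow> b a j = int (a j) \<or> b a j = int (a j) - int (Suc n)"
      "\<And>a j. a \<in> freqs n d \<Longrightarrow> j \<ge> d \<Longrightarrow> b a j = 0"
  defines "\<xi> \<equiv> \<lambda>a j. of_int (b a j) / real (Suc n)"
  shows "real (card {a\<in>freqs n d. covf n (Suc d) p (\<xi> a) (\<xi> a) \<le> R}) \<le>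
    (\<Prod>j<d. 3 * real (Suc n) * sqrt R / sqrt (covf n (Suc d) p (v j) (v j)))"
proof -
  let ?B = "covf n (Suc d) p"
  let ?T = "{a\<in>freqs n d. ?B (\<xi> a) (\<xi> a) \<le> R}"
  let ?G = "{b :: nat \<Rightarrow> int. (\<forall>j\<ge>d. b j = 0) \<and>
     ?B (\<lambda>j. of_int (b j) / real (Suc n) + 0) (\<lambda>j. of_int (b j) / real (Suc n) + 0) \<le> R}"
  have G: "finite ?G \<and> real (card ?G) \<le> (\<Prod>j<d. 2 * (real (Suc n) * sqrt (R / ?B (v j) (v j))) + 1)"
    by (rule card_lattice_ellipsoid) (use R v covf_nonneg[OF p] in \<open>auto simp: covf_lin covf_commute\<close>)
  have "inj_on b ?T"
  proof (rule inj_onI)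
    fix a a' assume a: "a \<in> ?T" "a' \<in> ?T" "b a = b a'"
    show "a = a'"
    proof
      fix j show "a j = a' j"
      proof (cases "j < d")
        case True
        have "b a j = int (a j) \<or> b a j = int (a j) - int (Suc n)"
          "b a j = int (a' j) \<or> b a j = int (a' j) - int (Suc n)"
          using b(1)[of a j] b(1)[of a' j] a True by auto
        moreover have "a j < Suc n" "a' j < Suc n" using a True by (auto simp: freqs_def PiE_def Pi_def)
        ultimately show ?thesis by (elim disjE) simp_all
      next
        case False
        thus ?thesis using a by (auto simp: freqs_def PiE_def extensional_def)
      qed
    qed
  qed
  moreover have "b ` ?T \<subseteq> ?G" using b(2) by (auto simp: \<xi>_def)
  ultimately have "card ?T \<le> card ?G" using G by (intro card_inj_on_le[of b]) auto
  hence "real (card ?T) \<le> (\<Prod>j<d. 2 * (real (Suc n) * sqrt (R / ?B (v j) (v j))) + 1)" using G by linarith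
  also have "\<dots> \<le> (\<Prod>j<d. 3 * real (Suc n) * sqrt R / sqrt (?B (v j) (v j)))"
  proof (intro prod_mono conjI)
    fix j assume "j \<in> {..<d}"
    hence j: "j < d" by simp
    note D = orthogonal_family_variance[OF p t(2) v j]
    have D1: "1 \<le> ?B (v j) (v j)" using D t by simp
    \<comment> \<open>The variance is at most \<open>n\<close>, so each side of the ellipsoid has
      length at least 1 in lattice units and \<open>2 * x + 1 \<le> 3 * x\<close>.\<close>
    have "sqrt (?B (v j) (v j)) \<le> sqrt (real (Suc n) ^ 2)"
      using D(2) power_increasing[of 1 2 "real (Suc n)"] by (intro real_sqrt_le_mono) auto
    also have "\<dots> = real (Suc n) * 1" by simp
    also have "\<dots> \<le> real (Suc n) * sqrt R" using R by (intro mult_left_mono) auto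
    finally have X: "1 \<le> real (Suc n) * sqrt R / sqrt (?B (v j) (v j))"
      using D1 by (simp add: field_simps)
    define x where "x = real (Suc n) * sqrt R / sqrt (?B (v j) (v j))"
    have x: "real (Suc n) * sqrt (R / ?B (v j) (v j)) = x"
      "3 * real (Suc n) * sqrt R / sqrt (?B (v j) (v j)) = 3 * x"
      by (simp_all add: x_def real_sqrt_divide del: of_nat_Suc)
    show "2 * (real (Suc n) * sqrt (R / ?B (v j) (v j))) + 1 \<le> 3 * real (Suc n) * sqrt R / sqrt (?B (v j) (v j))"
      "0 \<le> 2 * (real (Suc n) * sqrt (R / ?B (v j) (v j))) + 1"
      unfolding x using X by (simp_all add: x_def[symmetric] del: of_nat_Suc)
  qed
  finally show ?thesis .
qed


text \<open>The positive part of \<open>p - q\<close> is at most \<open>p\<close> off the support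
  \<open>S\<close> of \<open>p\<close>, and on \<open>S\<close> it is bounded by Fourier inversion
  times the size of \<open>S\<close>. The three terms are the mass off \<open>S\<close>, the
  effective frequencies of \<open>p\<close> or \<open>q\<close>, and the remaining
  frequencies.\<close>

lemma sum_positive_part_le:
  assumes p: "stochastic n (Suc d) p" and q: "stochastic n (Suc d) q"
    and t: "2 \<le> t" "spread n (Suc d) t p" "spread n (Suc d) t q"
    and \<tau>: "1 \<le> \<tau>" "\<tau>\<^sup>2 \<le> 2 * t" and R: "1 \<le> R" and \<eta>: "0 \<le> \<eta>"
    and v: "orthogonal_family (covf n (Suc d) p) d v" and v': "orthogonal_family (covf n (Suc d) q) d v'"
    and det: "(\<Prod>j<d. sqrt (covf n (Suc d) p (v j) (v j))) \<le> (\<Prod>j<d. sqrt (covf n (Suc d) q (v' j) (v' j)))"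
    and close: "\<And>\<xi>. (\<And>j l. j < Suc d \<Longrightarrow> l < Suc d \<Longrightarrow> t * (\<xi> j - \<xi> l)\<^sup>2 \<le> 2 * R) \<Longrightarrow>
       cmod (charf n (Suc d) p \<xi> - charf n (Suc d) q \<xi>) \<le> \<eta>"
  shows "(\<Sum>y\<in>point n d ` outcomes n (Suc d). max 0 (law n d p y - law n d q y)) \<le>
    2 * real d * exp (- \<tau>\<^sup>2 / 4) + 2 * (9 * \<tau> * sqrt R) ^ d * \<eta>
    + 2 * (3 * \<tau> * sqrt (real n)) ^ d * exp (- 4 * R / (real (Suc d) + 1)\<^sup>2)"
proof -
  let ?k = "Suc d" and ?N = "real (Suc n)"
  define Y where "Y = point n d ` outcomes n ?k"
  define Dp where "Dp = (\<lambda>j. sqrt (covf n ?k p (v j) (v j)))"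
  define Dq where "Dq = (\<lambda>j. sqrt (covf n ?k q (v' j) (v' j)))"
  have Dp: "0 < Dp j" "Dp j \<le> sqrt (real n)" if "j < d" for j
    using orthogonal_family_variance[OF p t(2) v that] t(1) by (auto simp: Dp_def)
  have Dq: "0 < Dq j" if "j < d" for j
    using orthogonal_family_variance[OF q t(3) v' that] t(1) by (auto simp: Dq_def)
  define e where "e = exp (- 4 * R / (real ?k + 1)\<^sup>2)"
  obtain S where S: "S \<subseteq> Y" "real (card S) \<le> (\<Prod>j<d. 3 * \<tau> * Dp j)"
    "(\<Sum>y\<in>Y - S. law n d p y) \<le> 2 * real d * exp (- \<tau>\<^sup>2 / 4)"
    using effective_support[OF p t(1,2) v \<tau>] unfolding Y_def Dp_def by blast
  have finY: "finite Y" by (simp add: Y_def)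
  have "\<exists>b :: nat \<Rightarrow> int. (\<forall>j<d. b j = int (a j) \<or> b j = int (a j) - int (Suc n)) \<and> (\<forall>j\<ge>d. b j = 0) \<and>
    (\<forall>j<?k. \<forall>l<?k. \<bar>of_int (b j) / ?N - of_int (b l) / ?N\<bar> \<le> 1 - 1 / (real ?k + 1))"
    if "a \<in> freqs n d" for a
    using that by (intro gap_lift) (auto simp: freqs_def PiE_def Pi_def)
  then obtain b where b: "\<And>a j. a \<in> freqs n d \<Longrightarrow> j < d \<Longrightarrow> b a j = int (a j) \<or> b a j = int (a j) - int (Suc n)"
    "\<And>a j. a \<in> freqs n d \<Longrightarrow> j \<ge> d \<Longrightarrow> b a j = (0::int)"
    "\<And>a j l. a \<in> freqs n d \<Longrightarrow> j < ?k \<Longrightarrow> l < ?k \<Longrightarrow>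
      \<bar>of_int (b a j) / ?N - of_int (b a l) / ?N\<bar> \<le> 1 - 1 / (real ?k + 1)"
    by metis
  define \<xi> where "\<xi> = (\<lambda>a j. of_int (b a j) / ?N)"
  define \<delta> where "\<delta> = (\<lambda>a. cmod (charf n ?k p (freq n d a) - charf n ?k q (freq n d a)))"
  have \<delta>: "\<delta> a = cmod (charf n ?k p (\<xi> a) - charf n ?k q (\<xi> a))" if "a \<in> freqs n d" for a
    unfolding \<delta>_def \<xi>_def using charf_lift[of d "b a" a n] b(1,2)[OF that] by simp
  define Tp where "Tp = {a\<in>freqs n d. covf n ?k p (\<xi> a) (\<xi> a) \<le> R}"
  define Tq where "Tq = {a\<in>freqs n d. covf n ?k q (\<xi> a) (\<xi> a) \<le> R}"
  have Tp: "real (card Tp) \<le> (\<Prod>j<d. 3 * ?N * sqrt R / Dp j)"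
    unfolding Tp_def Dp_def \<xi>_def by (rule card_effective_freqs[where b = b, OF p t(1,2) v R b(1,2)])
  have Tq: "real (card Tq) \<le> (\<Prod>j<d. 3 * ?N * sqrt R / Dq j)"
    unfolding Tq_def Dq_def \<xi>_def by (rule card_effective_freqs[where b = b, OF q t(1,3) v' R b(1,2)])
  have finT: "finite Tp" "finite Tq" by (auto simp: Tp_def Tq_def)
  have decay: "cmod (charf n ?k w (\<xi> a)) \<le> e"
    if w: "stochastic n ?k w" "covf n ?k w (\<xi> a) (\<xi> a) > R" and a: "a \<in> freqs n d" for w a
  proof -
    have "cmod (charf n ?k w (\<xi> a)) \<le> exp (- 4 * covf n ?k w (\<xi> a) (\<xi> a) / (real ?k + 1)\<^sup>2)"
      using b(3)[OF a] by (intro cmod_charf_le[OF w(1)]) (simp add: \<xi>_def)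
    also have "\<dots> \<le> e" unfolding e_def using w(2) by (simp add: divide_right_mono)
    finally show ?thesis .
  qed
  have \<delta>_le: "\<delta> a \<le> (if a \<in> Tp \<union> Tq then \<eta> else 0) + 2 * e" if a: "a \<in> freqs n d" for a
  proof (cases "a \<in> Tp \<union> Tq")
    case True
    then obtain w where w: "spread n ?k t w" "covf n ?k w (\<xi> a) (\<xi> a) \<le> R"
      using t by (auto simp: Tp_def Tq_def)
    \<comment> \<open>One of the two variances being at most \<open>R\<close> already bounds all
      differences of the frequency, which is all that \<open>close\<close> requires.\<close>
    have "\<delta> a \<le> \<eta>" unfolding \<delta>[OF a]
    proof (rule close)
      fix j l assume "j < ?k" "l < ?k"
      from spreadD[OF w(1) this, of "\<xi> a"] show "t * (\<xi> a j - \<xi> a l)\<^sup>2 \<le> 2 * R" using w(2) by linarith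
    qed
    moreover have "0 \<le> e" by (simp add: e_def)
    ultimately show ?thesis using True by simp
  next
    case False
    hence "cmod (charf n ?k p (\<xi> a)) \<le> e" "cmod (charf n ?k q (\<xi> a)) \<le> e"
      using a p q by (auto intro!: decay simp: Tp_def Tq_def not_le)
    hence "\<delta> a \<le> e + e" unfolding \<delta>[OF a] by (intro norm_triangle_le_diff add_mono) auto
    thus ?thesis using False by simp
  qed
  have sum\<delta>: "(\<Sum>a\<in>freqs n d. \<delta> a) \<le> (real (card Tp) + real (card Tq)) * \<eta> + ?N ^ d * (2 * e)"
  proof -
    have "(\<Sum>a\<in>freqs n d. \<delta> a) \<le> (\<Sum>a\<in>freqs n d. (if a \<in> Tp \<union> Tq then \<eta> else 0) + 2 * e)"
      by (intro sum_mono \<delta>_le)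
    also have "\<dots> = real (card (Tp \<union> Tq)) * \<eta> + ?N ^ d * (2 * e)"
      by (simp add: sum.distrib sum.If_cases card_freqs Tp_def Tq_def Int_absorb1 Collect_disj_eq[symmetric]
          flip: of_nat_Suc) (auto intro!: arg_cong[of _ _ card])
    also have "real (card (Tp \<union> Tq)) * \<eta> \<le> (real (card Tp) + real (card Tq)) * \<eta>"
      using card_Un_le[of Tp Tq] \<eta> by (intro mult_right_mono) auto
    finally show ?thesis by simp
  qed
  have point: "?N ^ d * \<bar>law n d p y - law n d q y\<bar> \<le> (\<Sum>a\<in>freqs n d. \<delta> a)" if "y \<in> Y" for y
    unfolding \<delta>_def using that by (intro law_diff_le) (auto simp: Y_def point_def cnt_le)
  have Nd: "0 < ?N ^ d" by simp
  \<comment> \<open>The standard deviations \<open>Dp j\<close> of the support and of the frequency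
    count cancel; the power of \<open>n + 1\<close> is the normalisation of the inversion
    formula.\<close>
  have prodp: "real (card S) * real (card Tp) \<le> (9 * \<tau> * sqrt R) ^ d * ?N ^ d"
  proof -
    have "real (card S) * real (card Tp) \<le> (\<Prod>j<d. 3 * \<tau> * Dp j) * (\<Prod>j<d. 3 * ?N * sqrt R / Dp j)"
      using \<tau> R Dp by (intro mult_mono S Tp prod_nonneg) (auto intro: less_imp_le)
    also have "\<dots> = (\<Prod>j<d. (9 * \<tau> * sqrt R) * ?N)"
      unfolding prod.distrib[symmetric] using Dp by (intro prod.cong refl) (force simp: field_simps)
    finally show ?thesis by (simp add: power_mult_distrib)
  qed
  have prodq: "real (card S) * real (card Tq) \<le> (9 * \<tau> * sqrt R) ^ d * ?N ^ d"
  proof -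
    have "real (card S) * real (card Tq) \<le> (\<Prod>j<d. 3 * \<tau> * Dp j) * (\<Prod>j<d. 3 * ?N * sqrt R / Dq j)"
      using \<tau> R Dp Dq by (intro mult_mono S Tq prod_nonneg) (auto intro: less_imp_le)
    also have "(\<Prod>j<d. 3 * \<tau> * Dp j) = (3 * \<tau>) ^ d * (\<Prod>j<d. Dp j)" by (simp add: prod.distrib)
    \<comment> \<open>The individual \<open>Dp j\<close> and \<open>Dq j\<close> are not comparable,
      only their products are. This is the use of the smaller determinant.\<close>
    also have "(3 * \<tau>) ^ d * (\<Prod>j<d. Dp j) * (\<Prod>j<d. 3 * ?N * sqrt R / Dq j) \<le>
       (3 * \<tau>) ^ d * (\<Prod>j<d. Dq j) * (\<Prod>j<d. 3 * ?N * sqrt R / Dq j)"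
      using det Dq \<tau> R unfolding Dp_def[symmetric] Dq_def[symmetric]
      by (intro mult_right_mono mult_left_mono prod_nonneg) (auto intro: less_imp_le)
    also have "(3 * \<tau>) ^ d * (\<Prod>j<d. Dq j) = (\<Prod>j<d. 3 * \<tau> * Dq j)" by (simp add: prod.distrib)
    also have "\<dots> * (\<Prod>j<d. 3 * ?N * sqrt R / Dq j) = (\<Prod>j<d. (9 * \<tau> * sqrt R) * ?N)"
      unfolding prod.distrib[symmetric] using Dq by (intro prod.cong refl) (force simp: field_simps)
    finally show ?thesis by (simp add: power_mult_distrib)
  qed
  have cardS: "real (card S) \<le> (3 * \<tau> * sqrt (real n)) ^ d"
  proof -
    have "(\<Prod>j<d. 3 * \<tau> * Dp j) \<le> (\<Prod>j<d. 3 * \<tau> * sqrt (real n))"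
      using Dp \<tau> by (intro prod_mono conjI mult_left_mono mult_nonneg_nonneg) (auto intro: less_imp_le)
    thus ?thesis using S(2) by simp
  qed
  have "?N ^ d * (\<Sum>y\<in>S. \<bar>law n d p y - law n d q y\<bar>) \<le> (\<Sum>y\<in>S. (\<Sum>a\<in>freqs n d. \<delta> a))"
    unfolding sum_distrib_left using S(1) by (intro sum_mono point) auto
  also have "\<dots> = real (card S) * (\<Sum>a\<in>freqs n d. \<delta> a)" by simp
  also have "\<dots> \<le> real (card S) * ((real (card Tp) + real (card Tq)) * \<eta> + ?N ^ d * (2 * e))"
    by (intro mult_left_mono sum\<delta>) auto
  also have "\<dots> = (real (card S) * real (card Tp) + real (card S) * real (card Tq)) * \<eta> + ?N ^ d * (2 * e * real (card S))"
    by (simp add: algebra_simps)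
  also have "\<dots> \<le> ((9 * \<tau> * sqrt R) ^ d * ?N ^ d + (9 * \<tau> * sqrt R) ^ d * ?N ^ d) * \<eta>
      + ?N ^ d * (2 * e * (3 * \<tau> * sqrt (real n)) ^ d)"
    using \<eta> by (intro add_mono mult_right_mono mult_left_mono prodp prodq cardS) (auto simp: e_def)
  also have "\<dots> = ?N ^ d * (2 * (9 * \<tau> * sqrt R) ^ d * \<eta> + 2 * (3 * \<tau> * sqrt (real n)) ^ d * e)"
    by (simp add: algebra_simps)
  finally have inS: "(\<Sum>y\<in>S. \<bar>law n d p y - law n d q y\<bar>) \<le>
      2 * (9 * \<tau> * sqrt R) ^ d * \<eta> + 2 * (3 * \<tau> * sqrt (real n)) ^ d * e"
    using Nd mult_le_cancel_left_pos by blast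
  have "(\<Sum>y\<in>Y. max 0 (law n d p y - law n d q y)) =
     (\<Sum>y\<in>Y - S. max 0 (law n d p y - law n d q y)) + (\<Sum>y\<in>S. max 0 (law n d p y - law n d q y))"
    by (rule sum.subset_diff[OF S(1) finY])
  also have "\<dots> \<le> (\<Sum>y\<in>Y - S. law n d p y) + (\<Sum>y\<in>S. \<bar>law n d p y - law n d q y\<bar>)"
    using law_nonneg[OF p] law_nonneg[OF q] by (intro add_mono sum_mono) (auto simp: max_def)
  finally show ?thesis using S(3) inS by (simp add: Y_def e_def)
qed

section \<open>Closeness of Fourier transforms\<close>

lemma norm_exp_minus_one_le:
  fixes z :: complex assumes "cmod z \<le> 1" shows "cmod (exp z - 1) \<le> 2 * cmod z"
proof -
  have "(\<lambda>n. z ^ Suc n /\<^sub>R fact (Suc n)) sums (exp z - 1)"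
    using sums_split_initial_segment[OF exp_converges[of z], of 1] by simp
  moreover have "(\<lambda>n. cmod z ^ Suc n /\<^sub>R fact (Suc n)) sums (exp (cmod z) - 1)"
    using sums_split_initial_segment[OF exp_converges[of "cmod z"], of 1] by simp
  ultimately have "cmod (exp z - 1) \<le> exp (cmod z) - 1"
    by (rule norm_sums_le) (simp only: norm_scaleR norm_power, simp)
  also have "\<dots> \<le> cmod z + (cmod z)\<^sup>2" using exp_bound[of "cmod z"] assms by simp
  also have "\<dots> \<le> 2 * cmod z"
    using assms mult_left_le[of "cmod z" "cmod z"] by (simp add: power2_eq_square)
  finally show ?thesis .
qed

lemma Ln_remainder:
  fixes z :: complex
  assumes z: "cmod z \<le> \<rho>" and \<rho>: "\<rho> \<le> 1 / 2"
  shows "cmod (Ln (1 + z) - (\<Sum>l=1..L. - ((- z) ^ l) / of_nat l)) \<le> 2 * \<rho> ^ Suc L"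
proof -
  have \<rho>0: "0 \<le> \<rho>" using z norm_ge_zero order_trans by blast
  have z1: "cmod z < 1" using z \<rho> by simp
  have "(\<lambda>i. - ((- z) ^ (i + Suc L)) / of_nat (i + Suc L)) sums
      (Ln (1 + z) - (\<Sum>l<Suc L. - ((- z) ^ l) / of_nat l))"
    by (rule sums_split_initial_segment[OF Ln_series'[OF z1]])
  moreover have "(\<lambda>i. \<rho> ^ Suc L * \<rho> ^ i) sums (\<rho> ^ Suc L * (1 / (1 - \<rho>)))"
    using \<rho> \<rho>0 by (intro sums_mult geometric_sums) auto
  ultimately have "cmod (Ln (1 + z) - (\<Sum>l<Suc L. - ((- z) ^ l) / of_nat l)) \<le> \<rho> ^ Suc L * (1 / (1 - \<rho>))"
  proof (rule norm_sums_le)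
    fix i
    have "cmod (- ((- z) ^ (i + Suc L)) / of_nat (i + Suc L)) = cmod z ^ (i + Suc L) / real (i + Suc L)"
      by (simp only: norm_divide norm_minus_cancel norm_power norm_of_nat)
    also have "\<dots> \<le> cmod z ^ (i + Suc L) / 1" by (intro divide_left_mono) auto
    also have "\<dots> \<le> \<rho> ^ (i + Suc L)" using z by (simp add: power_mono del: power_Suc)
    also have "\<dots> = \<rho> ^ Suc L * \<rho> ^ i" by (simp add: power_add mult.commute)
    finally show "cmod (- ((- z) ^ (i + Suc L)) / of_nat (i + Suc L)) \<le> \<rho> ^ Suc L * \<rho> ^ i" .
  qed
  also have "(\<Sum>l<Suc L. - ((- z) ^ l) / of_nat l) = (\<Sum>l=1..L. - ((- z) ^ l) / of_nat l)"
    by (rule sum.mono_neutral_right) (auto simp: Suc_le_eq)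
  also have "\<rho> ^ Suc L * (1 / (1 - \<rho>)) \<le> \<rho> ^ Suc L * 2"
    using \<rho> \<rho>0 by (intro mult_left_mono) (auto simp: field_simps)
  finally show ?thesis by simp
qed

text \<open>The truncated logarithms depend only on the power sums. Their errors form a geometric
  series in \<open>\<kappa> \<le> 1 / 2\<close> that starts in degree 1, hence the factor
  \<open>\<kappa>\<close> in the first term; the second collects the remainders.\<close>

lemma sum_Ln_close:
  fixes z w :: "'a \<Rightarrow> complex"
  assumes z: "\<And>a. a \<in> A \<Longrightarrow> cmod (z a) \<le> \<rho>" and w: "\<And>b. b \<in> B \<Longrightarrow> cmod (w b) \<le> \<rho>"
    and \<rho>: "\<rho> \<le> 1 / 2" and \<kappa>: "0 \<le> \<kappa>" "\<kappa> \<le> 1 / 2" and \<epsilon>: "0 \<le> \<epsilon>" and card: "card A = card B"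
    and pw: "\<And>l. 1 \<le> l \<Longrightarrow> l \<le> L \<Longrightarrow> cmod ((\<Sum>a\<in>A. z a ^ l) - (\<Sum>b\<in>B. w b ^ l)) \<le> \<epsilon> * \<kappa> ^ l"
  shows "cmod ((\<Sum>a\<in>A. Ln (1 + z a)) - (\<Sum>b\<in>B. Ln (1 + w b))) \<le> 2 * \<epsilon> * \<kappa> + 4 * real (card A) * \<rho> ^ Suc L"
proof -
  let ?T = "\<lambda>z. \<Sum>l=1..L. - ((- z) ^ l) / of_nat l :: complex"
  have rem: "cmod ((\<Sum>a\<in>A. Ln (1 + z a)) - (\<Sum>a\<in>A. ?T (z a))) \<le> real (card A) * (2 * \<rho> ^ Suc L)"
    if "\<And>a. a \<in> A \<Longrightarrow> cmod (z a) \<le> \<rho>" for A and z :: "'a \<Rightarrow> complex"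
    unfolding sum_subtractf[symmetric]
    by (intro order_trans[OF norm_sum] sum_bounded_above Ln_remainder that \<rho>)
  have main: "cmod ((\<Sum>a\<in>A. ?T (z a)) - (\<Sum>b\<in>B. ?T (w b))) \<le> 2 * \<epsilon> * \<kappa>"
  proof -
    have T: "(\<Sum>a\<in>A. ?T (z a)) = (\<Sum>l=1..L. - ((-1) ^ l) / of_nat l * (\<Sum>a\<in>A. z a ^ l))"
      for A and z :: "'a \<Rightarrow> complex"
      by (subst sum.swap) (simp add: sum_distrib_left power_minus[of "z _"])
    have "cmod ((\<Sum>a\<in>A. ?T (z a)) - (\<Sum>b\<in>B. ?T (w b))) \<le>
      (\<Sum>l=1..L. cmod (- ((-1) ^ l) / of_nat l * ((\<Sum>a\<in>A. z a ^ l) - (\<Sum>b\<in>B. w b ^ l))))"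
      unfolding T sum_subtractf[symmetric] right_diff_distrib[symmetric] by (rule norm_sum)
    also have "\<dots> \<le> (\<Sum>l=1..L. \<epsilon> * \<kappa> ^ l)"
    proof (intro sum_mono)
      fix l assume l: "l \<in> {1..L}"
      have "cmod (- ((-1) ^ l) / of_nat l * ((\<Sum>a\<in>A. z a ^ l) - (\<Sum>b\<in>B. w b ^ l))) =
         1 / real l * cmod ((\<Sum>a\<in>A. z a ^ l) - (\<Sum>b\<in>B. w b ^ l))"
        by (simp only: norm_mult norm_divide norm_minus_cancel norm_power norm_of_nat norm_one power_one)
      also have "\<dots> \<le> 1 * (\<epsilon> * \<kappa> ^ l)" using l pw[of l] by (intro mult_mono) auto
      finally show "cmod (- ((-1) ^ l) / of_nat l * ((\<Sum>a\<in>A. z a ^ l) - (\<Sum>b\<in>B. w b ^ l))) \<le> \<epsilon> * \<kappa> ^ l"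
        by simp
    qed
    also have "\<dots> \<le> (\<Sum>l<L. \<epsilon> * \<kappa> * (1 / 2) ^ l)"
      unfolding One_nat_def sum.atLeast1_atMost_eq using \<kappa> \<epsilon>
      by (intro sum_mono) (auto simp: mult.assoc intro!: mult_left_mono power_mono)
    also have "\<dots> = \<epsilon> * \<kappa> * (\<Sum>l<L. (1 / 2) ^ l)" by (simp add: sum_distrib_left)
    also have "(\<Sum>l<L. (1 / 2 :: real) ^ l) = ((1 / 2) ^ L - 1) / (1 / 2 - 1)"
      by (rule geometric_sum) simp
    also have "\<epsilon> * \<kappa> * (((1 / 2) ^ L - 1) / (1 / 2 - 1)) \<le> \<epsilon> * \<kappa> * 2"
      using \<kappa> \<epsilon> by (intro mult_left_mono) auto
    finally show ?thesis by (simp add: mult_ac)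
  qed
  have "cmod ((\<Sum>a\<in>A. Ln (1 + z a)) - (\<Sum>b\<in>B. Ln (1 + w b))) \<le>
    cmod ((\<Sum>a\<in>A. Ln (1 + z a)) - (\<Sum>a\<in>A. ?T (z a))) + cmod ((\<Sum>a\<in>A. ?T (z a)) - (\<Sum>b\<in>B. ?T (w b)))
    + cmod ((\<Sum>b\<in>B. Ln (1 + w b)) - (\<Sum>b\<in>B. ?T (w b)))"
    by (metis (no_types, lifting) norm_diff_triangle_le norm_minus_commute order_refl)
  also have "\<dots> \<le> real (card A) * (2 * \<rho> ^ Suc L) + 2 * \<epsilon> * \<kappa> + real (card B) * (2 * \<rho> ^ Suc L)"
    by (intro add_mono main rem z w)
  finally show ?thesis using card by (simp add: algebra_simps)
qed

text \<open>For the variables in \<open>A i\<close> the phase of \<open>\<xi> i\<close> is pulled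
  out; what remains is \<open>1 + z\<close> with \<open>z\<close> built from small phase
  differences. No branch of the logarithm has to be tracked, as it is only exponentiated
  again.\<close>

lemma charf_factor:
  fixes \<xi> :: "nat \<Rightarrow> real" and z :: "nat \<Rightarrow> nat \<Rightarrow> complex"
  assumes z_def: "z = (\<lambda>i r. \<Sum>j<k. of_real (p r j) * (cis (2 * pi * (\<xi> j - \<xi> i)) - 1))"
    and A: "\<And>i j. i < k \<Longrightarrow> j < k \<Longrightarrow> i \<noteq> j \<Longrightarrow> A i \<inter> A j = {}" "(\<Union>i<k. A i) = {..<n}"
    and p: "stochastic n k p" and z: "\<And>i r. i < k \<Longrightarrow> r < n \<Longrightarrow> cmod (z i r) < 1"
  shows "charf n k p \<xi> = (\<Prod>i<k. cis (2 * pi * \<xi> i) ^ card (A i)) * exp (\<Sum>i<k. \<Sum>r\<in>A i. Ln (1 + z i r))"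
proof -
  have sub: "r < n" if "i < k" "r \<in> A i" for i r using A(2) that by blast
  have fin: "finite (A i)" if "i < k" for i using sub[OF that] by (meson finite_nat_iff_bounded lessThan_iff subsetI)
  have "charf n k p \<xi> = (\<Prod>i<k. \<Prod>r\<in>A i. \<Sum>j<k. of_real (p r j) * cis (2 * pi * \<xi> j))"
    unfolding charf_def A(2)[symmetric] using fin A(1) by (intro prod.UNION_disjoint) auto
  also have "\<dots> = (\<Prod>i<k. \<Prod>r\<in>A i. cis (2 * pi * \<xi> i) * exp (Ln (1 + z i r)))"
  proof (intro prod.cong refl)
    fix i r assume "i \<in> {..<k}" "r \<in> A i"
    hence i: "i < k" "r < n" using sub by auto
    have "1 + z i r \<noteq> 0" using z[OF i] by (metis add.commute add_eq_0_iff norm_minus_cancel norm_one order_less_irrefl)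
    hence "exp (Ln (1 + z i r)) = 1 + z i r" by simp
    also have "1 + z i r = (\<Sum>j<k. of_real (p r j) * cis (2 * pi * (\<xi> j - \<xi> i)))"
      using stochasticD(2)[OF p i(2)]
      by (simp add: z_def right_diff_distrib sum_subtractf flip: of_real_sum)
    also have "cis (2 * pi * \<xi> i) * \<dots> = (\<Sum>j<k. of_real (p r j) * cis (2 * pi * \<xi> j))"
      by (simp add: sum_distrib_left mult.left_commute cis_mult algebra_simps)
    finally show "(\<Sum>j<k. of_real (p r j) * cis (2 * pi * \<xi> j)) = cis (2 * pi * \<xi> i) * exp (Ln (1 + z i r))" ..
  qed
  also have "\<dots> = (\<Prod>i<k. cis (2 * pi * \<xi> i) ^ card (A i)) * exp (\<Sum>i<k. \<Sum>r\<in>A i. Ln (1 + z i r))"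
    using fin by (simp add: prod.distrib exp_sum)
  finally show ?thesis .
qed

lemma cmod_cis_minus_one_le: "cmod (cis x - 1) \<le> \<bar>x\<bar>"
  using dist_exp_i_1[of x] abs_sin_x_le_abs_x[of "x / 2"] by (simp add: cis_conv_exp)

text \<open>Expansion over ordered tuples instead of exponent vectors, which avoids multinomial
  coefficients and leaves \<open>k ^ l\<close> equal terms to bound.\<close>

lemma power_sum_tuples:
  fixes u w :: "nat \<Rightarrow> 'a :: comm_semiring_1"
  shows "(\<Sum>j<k. u j * w j) ^ l = (\<Sum>g\<in>PiE {..<l} (\<lambda>_. {..<k}). (\<Prod>s<l. w (g s)) * (\<Prod>s<l. u (g s)))"
proof -
  have "(\<Sum>j<k. u j * w j) ^ l = (\<Prod>s<l. \<Sum>j<k. u j * w j)" by simp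
  also have "\<dots> = (\<Sum>g\<in>PiE {..<l} (\<lambda>_. {..<k}). \<Prod>s<l. u (g s) * w (g s))"
    by (rule prod_sum_PiE) auto
  finally show ?thesis by (simp add: prod.distrib mult.commute)
qed

text \<open>The quotient of the two Fourier transforms is \<open>exp U\<close>, where
  \<open>U\<close> is the difference of the sums of logarithms and is controlled by the moments. The
  common factor has modulus at most 1, and
  \<open>\<bar>exp U - 1\<bar> \<le> 2 * \<bar>U\<bar>\<close>.\<close>

lemma charf_close:
  assumes A: "\<And>i j. i < k \<Longrightarrow> j < k \<Longrightarrow> i \<noteq> j \<Longrightarrow> A i \<inter> A j = {}" "(\<Union>i<k. A i) = {..<n}"
    and B: "\<And>i j. i < k \<Longrightarrow> j < k \<Longrightarrow> i \<noteq> j \<Longrightarrow> B i \<inter> B j = {}" "(\<Union>i<k. B i) = {..<n}"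
    and p: "stochastic n k p" and q: "stochastic n k q"
    and mom: "\<And>i l g. i < k \<Longrightarrow> l \<le> L \<Longrightarrow> (\<And>s. s < l \<Longrightarrow> g s < k) \<Longrightarrow>
       \<bar>(\<Sum>r\<in>A i. \<Prod>s<l. p r (g s)) - (\<Sum>r\<in>B i. \<Prod>s<l. q r (g s))\<bar> \<le> \<epsilon>"
    and \<epsilon>: "0 \<le> \<epsilon>" "\<epsilon> < 1" and \<rho>: "0 \<le> \<rho>" "real k * \<rho> \<le> 1 / 2"
    and \<xi>: "\<And>j l. j < k \<Longrightarrow> l < k \<Longrightarrow> 2 * pi * \<bar>\<xi> j - \<xi> l\<bar> \<le> \<rho>"
    and \<Delta>: "\<Delta> = 2 * (real k)\<^sup>2 * \<epsilon> * \<rho> + 4 * real n * \<rho> ^ Suc L" "\<Delta> \<le> 1"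
  shows "cmod (charf n k p \<xi> - charf n k q \<xi>) \<le> 2 * \<Delta>"
proof (cases "k = 0")
  case True
  hence "n = 0" using A(2) by auto
  thus ?thesis using \<epsilon> \<rho> by (simp add: charf_def \<Delta>)
next
  case False
  have \<rho>2: "\<rho> \<le> 1 / 2"
    using mult_right_mono[of 1 "real k" \<rho>] \<rho> False by simp
  have c: "cmod (cis (2 * pi * (\<xi> j - \<xi> i)) - 1) \<le> \<rho>" if "i < k" "j < k" for i j
    using cmod_cis_minus_one_le[of "2 * pi * (\<xi> j - \<xi> i)"] \<xi>[OF that(2,1)] by (simp add: abs_mult)
  define z :: "(nat \<Rightarrow> nat \<Rightarrow> real) \<Rightarrow> nat \<Rightarrow> nat \<Rightarrow> complex" where "z = (\<lambda>p i r. \<Sum>j<k. of_real (p r j) * (cis (2 * pi * (\<xi> j - \<xi> i)) - 1))"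
  have z: "cmod (z p i r) \<le> \<rho>" if p: "stochastic n k p" and i: "i < k" "r < n" for p i r
  proof -
    note pr = stochasticD[OF p i(2)]
    have "cmod (z p i r) \<le> (\<Sum>j<k. p r j * \<rho>)"
      unfolding z_def using c[OF i(1)] pr
      by (intro order_trans[OF norm_sum] sum_mono) (auto simp: norm_mult intro!: mult_mono)
    thus ?thesis using pr by (simp add: sum_distrib_right[symmetric])
  qed
  have subA: "r < n" if "i < k" "r \<in> A i" for i r using A(2) that by blast
  have subB: "r < n" if "i < k" "r \<in> B i" for i r using B(2) that by blast
  have finA: "finite (A i)" if "i < k" for i using subA[OF that] by (meson finite_nat_iff_bounded lessThan_iff subsetI)
  \<comment> \<open>The moments of degree 0 are cardinalities: integers at distance less than 1 are
    equal. So the phases pulled out of both transforms agree.\<close>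
  have card: "card (A i) = card (B i)" if "i < k" for i
  proof -
    have "\<bar>real (card (A i)) - real (card (B i))\<bar> < 1"
      using mom[OF that, of 0 "\<lambda>_. 0"] \<epsilon> by simp
    thus ?thesis by linarith
  qed
  have cardsum: "(\<Sum>i<k. real (card (A i))) = real n"
  proof -
    have "n = card (\<Union>i<k. A i)" by (simp add: A(2))
    also have "\<dots> = (\<Sum>i<k. card (A i))" using A(1) finA by (intro card_UN_disjoint) auto
    finally show ?thesis by simp
  qed
  define E where "E = (\<lambda>i. (\<Sum>r\<in>A i. Ln (1 + z p i r)) - (\<Sum>r\<in>B i. Ln (1 + z q i r)))"
  have E: "cmod (E i) \<le> 2 * \<epsilon> * (real k * \<rho>) + 4 * real (card (A i)) * \<rho> ^ Suc L" if i: "i < k" for i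
    unfolding E_def
  proof (rule sum_Ln_close)
    fix l assume l: "1 \<le> l" "l \<le> L"
    let ?w = "\<lambda>j. cis (2 * pi * (\<xi> j - \<xi> i)) - 1"
    let ?G = "PiE {..<l} (\<lambda>_. {..<k})"
    \<comment> \<open>Expanding and exchanging the sums leaves the phases outside and a parameter
      moment inside.\<close>
    have zl: "(\<Sum>r\<in>C. z p i r ^ l) = (\<Sum>g\<in>?G. (\<Prod>s<l. ?w (g s)) * of_real (\<Sum>r\<in>C. \<Prod>s<l. p r (g s)))" for p :: "nat \<Rightarrow> nat \<Rightarrow> real" and C
      unfolding z_def power_sum_tuples by (subst sum.swap) (simp add: sum_distrib_left)
    have "cmod ((\<Sum>r\<in>A i. z p i r ^ l) - (\<Sum>r\<in>B i. z q i r ^ l)) =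
      cmod (\<Sum>g\<in>?G. (\<Prod>s<l. ?w (g s)) * of_real ((\<Sum>r\<in>A i. \<Prod>s<l. p r (g s)) - (\<Sum>r\<in>B i. \<Prod>s<l. q r (g s))))"
      unfolding zl by (simp add: sum_subtractf right_diff_distrib)
    also have "\<dots> \<le> (\<Sum>g\<in>?G. (\<Prod>s<l. \<rho>) * \<epsilon>)"
    proof (intro order_trans[OF norm_sum] sum_mono)
      fix g assume "g \<in> ?G"
      hence g: "g s < k" if "s < l" for s using that by (auto simp: PiE_def Pi_def)
      show "cmod ((\<Prod>s<l. ?w (g s)) * of_real ((\<Sum>r\<in>A i. \<Prod>s<l. p r (g s)) - (\<Sum>r\<in>B i. \<Prod>s<l. q r (g s)))) \<le> (\<Prod>s<l. \<rho>) * \<epsilon>"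
        unfolding norm_mult prod_norm[symmetric] norm_of_real
        using mom[OF i l(2) g] c[OF i] g \<rho> by (intro mult_mono prod_mono prod_nonneg) auto
    qed
    also have "\<dots> = \<epsilon> * (real k * \<rho>) ^ l" by (simp add: card_PiE power_mult_distrib)
    finally show "cmod ((\<Sum>r\<in>A i. z p i r ^ l) - (\<Sum>r\<in>B i. z q i r ^ l)) \<le> \<epsilon> * (real k * \<rho>) ^ l" .
  qed (use z[OF p i] z[OF q i] subA[OF i] subB[OF i] card[OF i] \<rho> \<rho>2 \<epsilon> in auto)
  define U where "U = (\<Sum>i<k. E i)"
  have "cmod U \<le> (\<Sum>i<k. 2 * \<epsilon> * (real k * \<rho>) + 4 * real (card (A i)) * \<rho> ^ Suc L)"
    unfolding U_def by (intro order_trans[OF norm_sum] sum_mono E) auto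
  also have "\<dots> = \<Delta>"
    by (simp add: sum.distrib \<Delta> sum_distrib_left[symmetric] sum_distrib_right[symmetric] cardsum power2_eq_square)
  finally have U: "cmod U \<le> \<Delta>" .
  have z1: "cmod (z p i r) < 1" "cmod (z q i r) < 1" if "i < k" "r < n" for i r
    using z[OF p that] z[OF q that] \<rho>2 by auto
  define c where "c = (\<Prod>i<k. cis (2 * pi * \<xi> i) ^ card (B i))"
  define W where "W = (\<Sum>i<k. \<Sum>r\<in>B i. Ln (1 + z q i r))"
  have Q: "charf n k q \<xi> = c * exp W"
    unfolding c_def W_def by (rule charf_factor[OF _ B q z1(2)]) (simp add: z_def)
  have "charf n k p \<xi> = (\<Prod>i<k. cis (2 * pi * \<xi> i) ^ card (A i)) * exp (\<Sum>i<k. \<Sum>r\<in>A i. Ln (1 + z p i r))"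
    by (rule charf_factor[OF _ A p z1(1)]) (simp add: z_def)
  also have "(\<Prod>i<k. cis (2 * pi * \<xi> i) ^ card (A i)) = c"
    unfolding c_def using card by (intro prod.cong refl) simp
  also have "(\<Sum>i<k. \<Sum>r\<in>A i. Ln (1 + z p i r)) = W + U"
    by (simp add: W_def U_def E_def sum_subtractf)
  finally have P: "charf n k p \<xi> = charf n k q \<xi> * exp U" by (simp add: Q exp_add)
  have "cmod (charf n k q \<xi>) \<le> (\<Prod>r<n. \<Sum>j<k. q r j * 1)"
    unfolding charf_def prod_norm[symmetric] using stochasticD(1)[OF q]
    by (intro prod_mono conjI order_trans[OF norm_sum] sum_mono) (auto simp: norm_mult)
  also have "\<dots> = 1" using stochasticD(2)[OF q] by simp
  finally have q1: "cmod (charf n k q \<xi>) \<le> 1" .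
  have "cmod (charf n k p \<xi> - charf n k q \<xi>) = cmod (charf n k q \<xi>) * cmod (exp U - 1)"
    unfolding P by (simp add: norm_mult[symmetric] algebra_simps)
  also have "\<dots> \<le> 1 * (2 * cmod U)"
    using q1 U \<Delta> by (intro mult_mono norm_exp_minus_one_le) auto
  finally show ?thesis using U by simp
qed

section \<open>Poisson multinomial distributions\<close>

definition probs :: "nat \<Rightarrow> (nat \<Rightarrow> real vec pmf) \<Rightarrow> nat \<Rightarrow> nat \<Rightarrow> real" where
  "probs k P r j = pmf (P r) (unit_vec k j)"

definition cnt_vec :: "nat \<Rightarrow> nat \<Rightarrow> (nat \<Rightarrow> nat) \<Rightarrow> real vec" where
  "cnt_vec n k f = vec k (\<lambda>j. real (cnt n f j))"

lemma inj_unit_vec: "inj_on (unit_vec k :: nat \<Rightarrow> real vec) {..<k}"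
  by (rule inj_onI) (auto simp: unit_vec_eq)

lemma stochastic_probs:
  assumes "\<forall>r<n. categorical k (P r)"
  shows "stochastic n k (probs k P)"
  unfolding stochastic_def probs_def
proof (intro allI impI conjI)
  fix r assume "r < n"
  have "(\<Sum>j<k. pmf (P r) (unit_vec k j)) = (\<Sum>x\<in>unit_vec k ` {..<k}. pmf (P r) x)"
    by (simp add: sum.reindex[OF inj_unit_vec])
  also have "\<dots> = 1" using assms \<open>r < n\<close> by (intro sum_pmf_eq_1) (auto simp: categorical_def)
  finally show "(\<Sum>j<k. pmf (P r) (unit_vec k j)) = 1" .
qed simp

lemma expectation_pmd:
  fixes g :: "real vec \<Rightarrow> real"
  assumes P: "\<forall>r<n. categorical k (P r)"
  shows "measure_pmf.expectation (pmd k {..<n} P) g =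
    (\<Sum>f\<in>outcomes n k. weight n (probs k P) f * g (cnt_vec n k f))"
proof -
  \<comment> \<open>Beyond \<open>n\<close> the value must be the default of \<open>Pi_pmf\<close>,
    or \<open>h f\<close> would lie outside its support.\<close>
  define h where "h = (\<lambda>f r. if r < n then unit_vec k (f r) else 0\<^sub>v k :: real vec)"
  let ?M = "Pi_pmf {..<n} (0\<^sub>v k) P"
  have inj: "inj_on h (outcomes n k)"
  proof (rule inj_onI, rule ext)
    fix f f' r assume f: "f \<in> outcomes n k" "f' \<in> outcomes n k" and e: "h f = h f'"
    show "f r = f' r"
    proof (cases "r < n")
      case True
      hence "(unit_vec k (f r) :: real vec) = unit_vec k (f' r)" using fun_cong[OF e, of r] by (simp add: h_def)
      thus ?thesis using inj_unit_vec[of k] outcomesD[OF f(1) True] outcomesD[OF f(2) True]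
        by (auto simp: inj_on_def)
    next
      case False
      thus ?thesis using f by (auto simp: outcomes_def PiE_def extensional_def)
    qed
  qed
  have supp: "a \<in> h ` outcomes n k" if a: "a \<in> set_pmf ?M" for a
  proof -
    have a': "a r \<in> unit_vec k ` {..<k}" if "r < n" for r
    proof -
      have "a r \<in> set_pmf (P r)" using a that by (simp add: set_Pi_pmf PiE_dflt_def)
      thus ?thesis using P that unfolding categorical_def by blast
    qed
    have a0: "a r = 0\<^sub>v k" if "\<not> r < n" for r
      using a that by (auto simp: set_Pi_pmf PiE_dflt_def)
    \<comment> \<open>The outcome numbers are recovered from the unit vectors;
      \<open>undefined\<close> outside the index range makes \<open>f\<close> extensional, as
      \<open>outcomes\<close> demands.\<close>
    define f where "f = (\<lambda>r. if r < n then (SOME j. j < k \<and> a r = unit_vec k j) else undefined)"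
    have f: "f r < k \<and> a r = unit_vec k (f r)" if "r < n" for r
      using someI_ex[of "\<lambda>j. j < k \<and> a r = unit_vec k j"] a'[OF that] that by (auto simp: f_def)
    have "f r = undefined" if "\<not> r < n" for r using that by (simp add: f_def)
    hence "f \<in> outcomes n k" unfolding outcomes_def using f by (intro PiE_I) auto
    moreover have "a = h f" using f a0 by (auto simp: h_def)
    ultimately show ?thesis by blast
  qed
  have vec: "finsum_vec TYPE(real) k (h f) {..<n} = cnt_vec n k f" if f: "f \<in> outcomes n k" for f
  proof (rule eq_vecI)
    have c: "h f \<in> {..<n} \<rightarrow> carrier_vec k" by (auto simp: h_def)
    show "dim_vec (finsum_vec TYPE(real) k (h f) {..<n}) = dim_vec (cnt_vec n k f)"
      using finsum_vec_closed[OF c] by (simp add: cnt_vec_def)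
    fix i assume "i < dim_vec (cnt_vec n k f)"
    hence i: "i < k" by (simp add: cnt_vec_def)
    have "finsum_vec TYPE(real) k (h f) {..<n} $ i = (\<Sum>r<n. h f r $ i)"
      by (rule index_finsum_vec) (use i c in auto)
    also have "\<dots> = (\<Sum>r<n. if f r = i then 1 else 0)"
      using outcomesD[OF f] i by (intro sum.cong) (auto simp: h_def)
    also have "\<dots> = cnt_vec n k f $ i"
      using i by (simp add: cnt_vec_def cnt_def sum.If_cases Int_def)
    finally show "finsum_vec TYPE(real) k (h f) {..<n} $ i = cnt_vec n k f $ i" .
  qed
  have "measure_pmf.expectation (pmd k {..<n} P) g =
     measure_pmf.expectation ?M (\<lambda>x. g (finsum_vec TYPE(real) k x {..<n}))"
    unfolding pmd_def by simp
  also have "\<dots> = (\<Sum>a\<in>h ` outcomes n k. pmf ?M a *\<^sub>R g (finsum_vec TYPE(real) k a {..<n}))"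
    by (rule integral_measure_pmf) (use supp in auto)
  also have "\<dots> = (\<Sum>f\<in>outcomes n k. pmf ?M (h f) * g (finsum_vec TYPE(real) k (h f) {..<n}))"
    by (simp add: sum.reindex[OF inj])
  also have "\<dots> = (\<Sum>f\<in>outcomes n k. weight n (probs k P) f * g (cnt_vec n k f))"
  proof (intro sum.cong refl)
    fix f assume f: "f \<in> outcomes n k"
    have "pmf ?M (h f) = (\<Prod>r<n. pmf (P r) (h f r))" by (rule pmf_Pi') (auto simp: h_def)
    also have "\<dots> = weight n (probs k P) f" by (simp add: weight_def probs_def h_def)
    finally show "pmf ?M (h f) * g (finsum_vec TYPE(real) k (h f) {..<n}) = weight n (probs k P) f * g (cnt_vec n k f)"
      using vec[OF f] by simp
  qed
  finally show ?thesis .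
qed

text \<open>\<open>\<Phi>\<close> restores the omitted last count from the total \<open>n\<close>,
  which turns events of vectors into sets of reduced points.\<close>

lemma prob_pmd:
  assumes P: "\<forall>r<n. categorical (Suc d) (P r)"
  defines "\<Phi> \<equiv> \<lambda>y. vec (Suc d) (\<lambda>j. if j < d then of_int (y j) else real n - (\<Sum>l<d. of_int (y l)))"
  shows "measure_pmf.prob (pmd (Suc d) {..<n} P) A =
    (\<Sum>y\<in>{y\<in>point n d ` outcomes n (Suc d). \<Phi> y \<in> A}. law n d (probs (Suc d) P) y)"
proof -
  let ?O = "outcomes n (Suc d)"
  have \<Phi>: "cnt_vec n (Suc d) f = \<Phi> (point n d f)" if f: "f \<in> ?O" for f
  proof (rule eq_vecI)
    fix j assume "j < dim_vec (\<Phi> (point n d f))"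
    hence j: "j < Suc d" by (simp add: \<Phi>_def)
    have "real n = (\<Sum>l<Suc d. real (cnt n f l))" using sum_cnt_total[OF f] by (metis of_nat_sum)
    hence "real n - (\<Sum>l<d. of_int (point n d f l)) = real (cnt n f d)" by (simp add: point_def)
    thus "cnt_vec n (Suc d) f $ j = \<Phi> (point n d f) $ j"
      using j by (auto simp: cnt_vec_def \<Phi>_def point_def less_Suc_eq)
  qed (simp add: cnt_vec_def \<Phi>_def)
  have "measure_pmf.prob (pmd (Suc d) {..<n} P) A = measure_pmf.expectation (pmd (Suc d) {..<n} P) (indicator A)"
    by simp
  also have "\<dots> = (\<Sum>f\<in>?O. weight n (probs (Suc d) P) f * indicator A (cnt_vec n (Suc d) f))"
    by (rule expectation_pmd[OF P])
  also have "\<dots> = (\<Sum>f\<in>?O. if point n d f \<in> {y\<in>point n d ` ?O. \<Phi> y \<in> A} then weight n (probs (Suc d) P) f else 0)"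
    by (intro sum.cong refl) (auto simp: \<Phi> indicator_def)
  also have "\<dots> = (\<Sum>y\<in>{y\<in>point n d ` ?O. \<Phi> y \<in> A}. law n d (probs (Suc d) P) y)"
    by (subst sum_law) (auto simp: sum.inter_filter)
  finally show ?thesis .
qed

text \<open>The difference on an event is at most the sum of the positive parts; passing to the
  complement reverses its sign, so the same bound serves for the absolute value.\<close>

lemma tv_dist_pmd_le:
  assumes P: "\<forall>r<n. categorical (Suc d) (P r)" and Q: "\<forall>r<n. categorical (Suc d) (Q r)"
  shows "tv_dist (pmd (Suc d) {..<n} P) (pmd (Suc d) {..<n} Q) \<le>
    (\<Sum>y\<in>point n d ` outcomes n (Suc d). max 0 (law n d (probs (Suc d) P) y - law n d (probs (Suc d) Q) y))"
  (is "_ \<le> ?B")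
proof -
  let ?p = "measure_pmf.prob (pmd (Suc d) {..<n} P)" and ?q = "measure_pmf.prob (pmd (Suc d) {..<n} Q)"
  have le: "?p A - ?q A \<le> ?B" for A
    unfolding prob_pmd[OF P] prob_pmd[OF Q] sum_subtractf[symmetric]
    by (rule order_trans[OF sum_mono sum_mono2[of _ _ "\<lambda>y. max 0 (law n d (probs (Suc d) P) y - law n d (probs (Suc d) Q) y)"]]) auto
  show ?thesis unfolding tv_dist_def
  proof (rule cSUP_least)
    fix A
    have "?p (- A) = 1 - ?p A" "?q (- A) = 1 - ?q A"
      using measure_pmf.prob_compl[of A] by (simp_all add: Compl_eq_Diff_UNIV)
    hence "?q A - ?p A = ?p (- A) - ?q (- A)" by simp
    thus "\<bar>?p A - ?q A\<bar> \<le> ?B" using le[of A] le[of "- A"] by linarith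
  qed simp
qed

lemma tv_dist_commute: "tv_dist p q = tv_dist q p"
  unfolding tv_dist_def by (simp add: abs_minus_commute)

section \<open>The covariance matrix of a PMD\<close>

definition unit_fun :: "nat \<Rightarrow> nat \<Rightarrow> real" where
  "unit_fun i = (\<lambda>j. if j = i then 1 else 0)"

lemma covf_cong:
  assumes "\<And>j. j < k \<Longrightarrow> x j = x' j" "\<And>j. j < k \<Longrightarrow> y j = y' j"
  shows "covf n k p x y = covf n k p x' y'"
proof -
  have "mean k u x = mean k u x'" "mean k u y = mean k u y'"
    "mean k u (\<lambda>j. x j * y j) = mean k u (\<lambda>j. x' j * y' j)" for u
    using assms by (auto simp: mean_def intro!: sum.cong)
  thus ?thesis by (simp add: covf_def)
qed

lemma covf_expand: "covf n k p x y = qform k (\<lambda>i j. covf n k p (unit_fun i) (unit_fun j)) x y"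
proof -
  have *: "covf n k p x y = (\<Sum>l<k. x l * covf n k p (unit_fun l) y)" for x y
  proof -
    have "covf n k p x y = covf n k p (\<lambda>i. \<Sum>l<k. x l * unit_fun l i) y"
      by (rule covf_cong) (auto simp: unit_fun_def if_distrib cong: if_cong)
    thus ?thesis by (simp add: bilinear_sum_left[of "covf n k p", OF covf_lin])
  qed
  show ?thesis unfolding qform_def
    by (subst *, subst covf_commute, subst *) (simp add: sum_distrib_left mult_ac covf_commute)
qed

lemma covariance_mat_pmd:
  assumes P: "\<forall>r<n. categorical k (P r)" and ij: "i < k" "j < k"
  shows "covariance_mat k (pmd k {..<n} P) $$ (i, j) = covf n k (probs k P) (unit_fun i) (unit_fun j)"
proof -
  let ?p = "probs k P"
  note p = stochastic_probs[OF P]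
  have cnt: "real (cnt n f i) = (\<Sum>r<n. unit_fun i (f r))" for f i
    by (simp add: cnt_def unit_fun_def sum.If_cases Int_def)
  have E: "measure_pmf.expectation (pmd k {..<n} P) (\<lambda>y. y $ i) = (\<Sum>r<n. mean k (?p r) (unit_fun i))" if "i < k" for i
  proof -
    have "measure_pmf.expectation (pmd k {..<n} P) (\<lambda>y. y $ i) =
       (\<Sum>f\<in>outcomes n k. \<Sum>r<n. weight n ?p f * unit_fun i (f r))"
      using that by (simp add: expectation_pmd[OF P] cnt_vec_def cnt sum_distrib_left)
    also have "\<dots> = (\<Sum>r<n. \<Sum>f\<in>outcomes n k. weight n ?p f * unit_fun i (f r))" by (rule sum.swap)
    also have "\<dots> = (\<Sum>r<n. mean k (?p r) (unit_fun i))" by (intro sum.cong refl sum_weight_one[OF p]) auto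
    finally show ?thesis .
  qed
  define u where "u = (\<lambda>i r j. unit_fun i j - mean k (?p r) (unit_fun i))"
  have "covariance_mat k (pmd k {..<n} P) $$ (i, j) =
    (\<Sum>f\<in>outcomes n k. weight n ?p f * ((\<Sum>r<n. u i r (f r)) * (\<Sum>r<n. u j r (f r))))"
    using ij by (simp add: covariance_mat_def expectation_pmd[OF P, of "\<lambda>x. (x $ i - _) * (x $ j - _)"] E cnt_vec_def
        cnt u_def sum_subtractf)
  also have "\<dots> = (\<Sum>r<n. mean k (?p r) (\<lambda>l. u i r l * u j r l))"
  proof (rule covariance_sum[OF p])
    fix r assume r: "r < n"
    show "mean k (?p r) (u i r) = 0"
      using stochasticD(2)[OF p r]
      by (simp add: mean_def u_def right_diff_distrib sum_subtractf sum_distrib_right[symmetric])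
  qed
  also have "\<dots> = covf n k ?p (unit_fun i) (unit_fun j)" by (simp add: covf_alt[OF p] u_def)
  finally show ?thesis .
qed

lemma spread_pmd:
  assumes P: "\<forall>r<n. categorical k (P r)" and k: "2 \<le> k" and t: "0 < t"
    and ev: "all_eigenvalues_but_one_ge (covariance_mat k (pmd k {..<n} P)) t"
  shows "spread n k t (probs k P)"
  unfolding spread_def
proof (intro allI impI)
  fix x :: "nat \<Rightarrow> real" and j l assume jl: "j < k" "l < k"
  let ?A = "covariance_mat k (pmd k {..<n} P)" and ?p = "probs k P"
  note p = stochastic_probs[OF P] and C = covariance_mat_pmd[OF P]
  have rows: "(\<Sum>j<k. ?A $$ (i, j)) = 0" if i: "i < k" for i
  proof -
    have "(\<Sum>j<k. ?A $$ (i, j)) = (\<Sum>j<k. 1 * covf n k ?p (unit_fun j) (unit_fun i))"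
      using i by (intro sum.cong refl) (simp add: C covf_commute)
    also have "\<dots> = covf n k ?p (\<lambda>m. \<Sum>j<k. 1 * unit_fun j m) (unit_fun i)"
      by (simp only: bilinear_sum_left[of "covf n k ?p", OF covf_lin])
    also have "\<dots> = covf n k ?p (\<lambda>_. 1) (unit_fun i)"
      by (rule covf_cong) (auto simp: unit_fun_def)
    also have "\<dots> = 0" unfolding covf_def using stochasticD(2)[OF p]
      by (intro sum.neutral) (auto simp: mean_def)
    finally show ?thesis .
  qed
  have "t * (x j - x l)\<^sup>2 \<le> 2 * qform k (\<lambda>i j. ?A $$ (i, j)) x x"
    by (rule all_eigenvalues_but_one_geD[OF _ k t _ rows ev jl])
      (use jl in \<open>auto simp: covariance_mat_def mult.commute\<close>)
  also have "qform k (\<lambda>i j. ?A $$ (i, j)) x x = covf n k ?p x x"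
    unfolding covf_expand[of n k ?p x x] by (simp add: qform_def C)
  finally show "t * (x j - x l)\<^sup>2 \<le> 2 * covf n k ?p x x" .
qed

section \<open>The partition into maximal components and its moments\<close>

lemma maximal_indices_disjoint:
  "i \<noteq> j \<Longrightarrow> maximal_indices n k P i \<inter> maximal_indices n k P j = {}"
  unfolding maximal_indices_def maximal_def
  by (auto simp: disjoint_iff) (metis linorder_neqE_nat not_less)

lemma maximal_indices_cover:
  assumes "0 < k"
  shows "(\<Union>i<k. maximal_indices n k P i) = {..<n}"
proof -
  have "\<exists>i<k. maximal k i (P r)" for r
  proof -
    let ?f = "\<lambda>j. pmf (P r) (unit_vec k j)"
    let ?Q = "\<lambda>i. i < k \<and> (\<forall>j<k. ?f j \<le> ?f i)"
    have "Max (?f ` {..<k}) \<in> ?f ` {..<k}" using assms by (intro Max_in) auto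
    then obtain i where "i < k" "?f i = Max (?f ` {..<k})" by auto
    hence "?Q i" by (auto intro: Max_ge)
    hence L: "?Q (LEAST i. ?Q i)" by (rule LeastI)
    define m where "m = (LEAST i. ?Q i)"
    have "?f j < ?f m" if "j < m" for j
    proof -
      have "\<not> ?Q j" using not_less_Least that unfolding m_def by blast
      thus ?thesis using L that unfolding m_def[symmetric] by (meson le_less_trans less_trans not_le order_trans)
    qed
    hence "maximal k m (P r)" using L unfolding m_def[symmetric] maximal_def by blast
    thus ?thesis unfolding maximal_def by blast
  qed
  thus ?thesis by (auto simp: maximal_indices_def)
qed

lemma prod_cnt:
  fixes h :: "nat \<Rightarrow> 'a :: comm_monoid_mult"
  assumes "\<And>s. s < l \<Longrightarrow> g s < k"
  shows "(\<Prod>s<l. h (g s)) = (\<Prod>j<k. h j ^ cnt l g j)"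
proof -
  have "(\<Prod>j<k. h j ^ cnt l g j) = (\<Prod>j<k. \<Prod>s\<in>{s\<in>{..<l}. g s = j}. h (g s))"
    by (intro prod.cong refl) (simp add: cnt_def)
  also have "\<dots> = (\<Prod>s<l. h (g s))" using assms by (intro prod.group) auto
  finally show ?thesis ..
qed

text \<open>The exponent vector of a tuple records how often each value occurs, so the tuple sums of
  the Fourier estimate are parameter moments of degree the length of the tuple.\<close>

lemma tuple_moment:
  assumes "\<And>s. s < l \<Longrightarrow> g s < k"
  shows "\<exists>m\<in>carrier_vec k. moment_degree m = l \<and>
    (\<forall>A P. parameter_moment k A P m = (\<Sum>r\<in>A. \<Prod>s<l. probs k P r (g s)))"
proof (intro bexI conjI allI)
  let ?m = "vec k (\<lambda>j. cnt l g j)"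
  show "?m \<in> carrier_vec k" by simp
  \<comment> \<open>Restriction makes the tuple extensional and does not affect its counts.\<close>
  have "restrict g {..<l} \<in> outcomes l k" using assms by (auto simp: outcomes_def)
  from sum_cnt_total[OF this] have "(\<Sum>j<k. cnt l g j) = l"
    by (simp add: cnt_def cong: conj_cong)
  thus "moment_degree ?m = l" by (simp add: moment_degree_def)
  fix A and P :: "nat \<Rightarrow> real vec pmf"
  have "(\<Prod>s<l. pmf (P r) (unit_vec k (g s))) = (\<Prod>j<k. pmf (P r) (unit_vec k j) ^ cnt l g j)" for r
    by (rule prod_cnt[OF assms])
  thus "parameter_moment k A P ?m = (\<Sum>r\<in>A. \<Prod>s<l. probs k P r (g s))"
    by (simp add: parameter_moment_def probs_def)
qed

section \<open>Choice of parameters\<close>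

text \<open>All hypotheses are symmetric in the two laws and so is the distance, so whichever has
  the smaller determinant may supply the support. \<open>\<rho>\<close> is the largest phase
  difference at a frequency of variance at most \<open>R\<close>.\<close>

lemma tv_dist_pmd_bound:
  assumes P: "\<forall>r<n. categorical k (P r)" and Q: "\<forall>r<n. categorical k (Q r)"
    and k: "2 \<le> k" and t: "2 \<le> t"
    and evP: "all_eigenvalues_but_one_ge (covariance_mat k (pmd k {..<n} P)) t"
    and evQ: "all_eigenvalues_but_one_ge (covariance_mat k (pmd k {..<n} Q)) t"
    and mom: "\<And>i m. i < k \<Longrightarrow> m \<in> carrier_vec k \<Longrightarrow> moment_degree m \<le> L \<Longrightarrow>
       \<bar>parameter_moment k (maximal_indices n k P i) P m
         - parameter_moment k (maximal_indices n k Q i) Q m\<bar> \<le> \<epsilon>"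
    and \<epsilon>: "0 \<le> \<epsilon>" "\<epsilon> < 1" and \<tau>: "1 \<le> \<tau>" "\<tau>\<^sup>2 \<le> 2 * t" and R: "1 \<le> R"
    and \<rho>: "\<rho> = 2 * pi * sqrt (2 * R / t)" "real k * \<rho> \<le> 1 / 2"
    and \<Delta>: "\<Delta> = 2 * (real k)\<^sup>2 * \<epsilon> * \<rho> + 4 * real n * \<rho> ^ Suc L" "\<Delta> \<le> 1"
  shows "tv_dist (pmd k {..<n} P) (pmd k {..<n} Q) \<le>
    2 * real (k - 1) * exp (- \<tau>\<^sup>2 / 4) + 2 * (9 * \<tau> * sqrt R) ^ (k - 1) * (2 * \<Delta>)
    + 2 * (3 * \<tau> * sqrt (real n)) ^ (k - 1) * exp (- 4 * R / (real k + 1)\<^sup>2)"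
proof -
  obtain d where d: "k = Suc d" using k by (cases k) auto
  let ?p = "probs k P" and ?q = "probs k Q"
  let ?A = "maximal_indices n k P" and ?B = "maximal_indices n k Q"
  note p = stochastic_probs[OF P] and q = stochastic_probs[OF Q]
  have sp: "spread n k t ?p" "spread n k t ?q"
    using spread_pmd[OF P k _ evP] spread_pmd[OF Q k _ evQ] t by auto
  have \<rho>0: "0 \<le> \<rho>" using \<rho>(1) R t by simp
  hence \<Delta>0: "0 \<le> 2 * \<Delta>" using \<epsilon> by (simp add: \<Delta>)
  have tuple: "\<bar>(\<Sum>r\<in>?A i. \<Prod>s<l. ?p r (g s)) - (\<Sum>r\<in>?B i. \<Prod>s<l. ?q r (g s))\<bar> \<le> \<epsilon>"
    if il: "i < k" "l \<le> L" and g: "\<And>s. s < l \<Longrightarrow> g s < k" for i l g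
  proof -
    obtain m where "m \<in> carrier_vec k" "moment_degree m = l"
      "\<And>A P. parameter_moment k A P m = (\<Sum>r\<in>A. \<Prod>s<l. probs k P r (g s))"
      using tuple_moment[of l g k, OF g] by blast
    thus ?thesis using mom[of i m] il by simp
  qed
  have close: "cmod (charf n k ?p \<xi> - charf n k ?q \<xi>) \<le> 2 * \<Delta>"
    if \<xi>: "\<And>j l. j < k \<Longrightarrow> l < k \<Longrightarrow> t * (\<xi> j - \<xi> l)\<^sup>2 \<le> 2 * R" for \<xi>
  proof (rule charf_close[of k ?A n ?B, OF _ _ _ _ p q tuple \<epsilon> \<rho>0 \<rho>(2) _ \<Delta>])
    fix j l assume "j < k" "l < k"
    hence "(\<xi> j - \<xi> l)\<^sup>2 \<le> 2 * R / t" using \<xi>[of j l] t by (simp add: field_simps)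
    hence "\<bar>\<xi> j - \<xi> l\<bar> \<le> sqrt (2 * R / t)" by (rule real_le_rsqrt[of "\<bar>_\<bar>", simplified])
    thus "2 * pi * \<bar>\<xi> j - \<xi> l\<bar> \<le> \<rho>" unfolding \<rho>(1) by (intro mult_left_mono) auto
  qed (use k maximal_indices_disjoint maximal_indices_cover in auto)
  have close': "cmod (charf n k ?q \<xi> - charf n k ?p \<xi>) \<le> 2 * \<Delta>"
    if "\<And>j l. j < k \<Longrightarrow> l < k \<Longrightarrow> t * (\<xi> j - \<xi> l)\<^sup>2 \<le> 2 * R" for \<xi>
    using close[OF that] by (simp add: norm_minus_commute)
  obtain v where v: "orthogonal_family (covf n k ?p) d v"
    using gram_schmidt_covf[of n d ?p t] p sp t unfolding d by auto
  obtain v' where v': "orthogonal_family (covf n k ?q) d v'"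
    using gram_schmidt_covf[of n d ?q t] q sp t unfolding d by auto
  have bound: "tv_dist (pmd k {..<n} P) (pmd k {..<n} Q) \<le>
      2 * real d * exp (- \<tau>\<^sup>2 / 4) + 2 * (9 * \<tau> * sqrt R) ^ d * (2 * \<Delta>)
      + 2 * (3 * \<tau> * sqrt (real n)) ^ d * exp (- 4 * R / (real (Suc d) + 1)\<^sup>2)"
  proof (cases "(\<Prod>j<d. sqrt (covf n k ?p (v j) (v j))) \<le> (\<Prod>j<d. sqrt (covf n k ?q (v' j) (v' j)))")
    case True
    show ?thesis unfolding d
      by (rule order_trans[OF tv_dist_pmd_le[OF P[unfolded d] Q[unfolded d]]
            sum_positive_part_le[OF p[unfolded d] q[unfolded d] t sp[unfolded d] \<tau> R \<Delta>0 v[unfolded d]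
              v'[unfolded d] True[unfolded d] close[unfolded d]]])
  next
    case False
    hence le: "(\<Prod>j<d. sqrt (covf n k ?q (v' j) (v' j))) \<le> (\<Prod>j<d. sqrt (covf n k ?p (v j) (v j)))" by simp
    show ?thesis unfolding d tv_dist_commute[of "pmd (Suc d) {..<n} P"]
      by (rule order_trans[OF tv_dist_pmd_le[OF Q[unfolded d] P[unfolded d]]
            sum_positive_part_le[OF q[unfolded d] p[unfolded d] t sp(2,1)[unfolded d] \<tau> R \<Delta>0 v'[unfolded d]
              v[unfolded d] le[unfolded d] close'[unfolded d]]])
  qed
  thus ?thesis unfolding d by simp
qed

text \<open>In logarithms, with \<open>x = ln n\<close>, the hypothesis is
  \<open>K k ln k \<le> x\<close> and the claim
  \<open>k (ln 64 + 3 ln k + ln x) \<le> \<delta> x\<close>. Only the term \<open>k ln x\<close> is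
  not visibly a multiple of \<open>k ln k\<close>.\<close>

lemma polylog_power_le_powr:
  fixes \<delta> :: real
  assumes \<delta>: "0 < \<delta>"
  shows "\<exists>K::real. 0 < K \<and> (\<forall>k n. 2 \<le> k \<longrightarrow> real k powr (K * real k) \<le> real n \<longrightarrow>
    1 \<le> ln (real n) \<and> (64 * real k ^ 3 * ln (real n)) ^ k \<le> real n powr \<delta>)"
proof -
  \<comment> \<open>\<open>22 / \<delta>\<close> makes 11 copies of \<open>k ln k\<close> at most
    half of \<open>\<delta> x\<close>: 6 from 64 = 2^6, 3 from the cube, 2 from the case of large
    \<open>k\<close>. The fourth power gives \<open>x^(1/4) \<ge> 8 / \<delta>\<close>.\<close>
  define K where "K = max 1 (max (22 / \<delta>) ((8 / \<delta>) ^ 4))"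
  have K: "1 \<le> K" "22 / \<delta> \<le> K" "(8 / \<delta>) ^ 4 \<le> K" by (auto simp: K_def)
  show ?thesis
  proof (intro exI[of _ K] conjI allI impI)
    show "0 < K" using K by simp
    fix k n :: nat assume k: "2 \<le> k" and n: "real k powr (K * real k) \<le> real n"
    define x where "x = ln (real n)"
    define l where "l = ln (real k)"
    have "0 < real k powr (K * real k)" using k by simp
    hence n0: "0 < real n" using n by linarith
    have l2: "ln 2 \<le> l" using k by (simp add: l_def)
    have ln2: "1 / 2 \<le> ln (2::real)" using ln_le_minus_one[of "1 / 2"] by (simp add: ln_div)
    have "K * real k * l = ln (real k powr (K * real k))" using k by (simp add: l_def ln_powr)
    also have "\<dots> \<le> x" unfolding x_def using n k n0 by (intro ln_mono) auto
    finally have x: "K * real k * l \<le> x" .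
    have "K * 1 \<le> K * (real k * l)"
      using K k l2 ln2 mult_mono[of 2 "real k" "1/2" l] by (intro mult_left_mono) auto
    hence xK: "K \<le> x" using x by (simp add: mult.assoc)
    have x1: "1 \<le> x" using xK K by simp
    show "1 \<le> ln (real n)" using x1 by (simp add: x_def)
    have kl0: "0 \<le> real k * l" using l2 ln2 by simp
    have "22 * (real k * l) \<le> \<delta> * (K * (real k * l))"
    proof -
      have "22 \<le> \<delta> * K" using K(2) \<delta> by (simp add: field_simps)
      from mult_right_mono[OF this kl0] show ?thesis by (simp add: mult_ac)
    qed
    also have "\<dots> \<le> \<delta> * x" using x \<delta> by (intro mult_left_mono) (auto simp: mult_ac)
    finally have kl: "22 * (real k * l) \<le> \<delta> * x" .
    \<comment> \<open>If \<open>k \<le> sqrt x\<close>, then \<open>ln x \<le> 4 x^(1/4)\<close>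
      makes the product at most \<open>4 x^(3/4)\<close>; otherwise \<open>x < k^2\<close> and
      \<open>ln x \<le> 2 ln k\<close>. The sum of the two bounds covers both cases.\<close>
    have klnx: "real k * ln x \<le> \<delta> * x / 2 + 2 * (real k * l)"
    proof (cases "real k \<le> sqrt x")
      case True
      define y where "y = sqrt (sqrt x)"
      have y: "1 \<le> y" "y ^ 2 = sqrt x" "y ^ 4 = x"
      proof -
        show "1 \<le> y" using x1 by (simp add: y_def)
        show y2: "y ^ 2 = sqrt x" using x1 by (simp add: y_def)
        have "y ^ 4 = (y ^ 2) ^ 2" by (simp flip: power_mult)
        thus "y ^ 4 = x" using x1 by (simp add: y2)
      qed
      have "ln x = ln (y ^ 4)" by (simp only: y(3))
      also have "\<dots> = 4 * ln y" using y(1) by (simp add: ln_realpow)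
      also have "\<dots> \<le> 4 * y" using ln_le_minus_one[of y] y(1) by simp
      finally have "real k * ln x \<le> y ^ 2 * (4 * y)"
        using True y(1) x1 unfolding y(2) by (intro mult_mono) auto
      also have "\<dots> = 4 * y ^ 3" by (simp add: power2_eq_square power3_eq_cube)
      also have "\<dots> \<le> \<delta> * y / 2 * y ^ 3"
      proof (intro mult_right_mono)
        have "(8 / \<delta>) ^ 4 \<le> y ^ 4" using K xK y by simp
        hence "8 / \<delta> \<le> y" using power_mono_iff[of "8 / \<delta>" y 4] y(1) \<delta> by simp
        thus "4 \<le> \<delta> * y / 2" using \<delta> by (simp add: field_simps)
      qed (use y(1) in simp)
      also have "\<dots> = \<delta> * x / 2" unfolding y(3)[symmetric] by (simp add: power3_eq_cube power4_eq_xxxx)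
      finally show ?thesis using kl0 by simp
    next
      case False
      hence "sqrt x ^ 2 \<le> real k ^ 2" using x1 by (intro power_mono) auto
      hence "ln x \<le> ln (real k ^ 2)" using x1 k by (intro ln_mono) auto
      also have "\<dots> = 2 * l" using k by (simp add: l_def ln_realpow)
      finally have "real k * ln x \<le> real k * (2 * l)" by (intro mult_left_mono) auto
      moreover have "0 \<le> \<delta> * x / 2" using \<delta> x1 by simp
      ultimately show ?thesis by (simp add: mult.left_commute)
    qed
    have ln64: "ln (64 :: real) = 6 * ln 2"
      using ln_realpow[of "2::real" 6] by simp
    have "ln (64 * real k ^ 3 * x) = ln 64 + 3 * l + ln x"
      using k x1 by (simp add: ln_mult ln_realpow l_def)
    hence "real k * ln (64 * real k ^ 3 * x) = 6 * (real k * ln 2) + 3 * (real k * l) + real k * ln x"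
      by (simp add: ln64 algebra_simps)
    also have "\<dots> \<le> 6 * (real k * l) + 3 * (real k * l) + (\<delta> * x / 2 + 2 * (real k * l))"
      using klnx l2 by (intro add_mono mult_left_mono) auto
    also have "\<dots> \<le> \<delta> * x"
    proof -
      have "6 * a + 3 * a + (e / 2 + 2 * a) \<le> e" if "22 * a \<le> e" for a e :: real
        using that by (simp add: field_simps)
      thus ?thesis using kl by blast
    qed
    finally have e: "exp (real k * ln (64 * real k ^ 3 * x)) \<le> exp (\<delta> * x)" by simp
    have e': "exp (real k * ln (64 * real k ^ 3 * x)) = (64 * real k ^ 3 * x) ^ k"
      using k x1 by (simp add: exp_of_nat_mult)
    have e'': "real n powr \<delta> = exp (\<delta> * x)" using n0 by (simp add: powr_def x_def)
    show "(64 * real k ^ 3 * ln (real n)) ^ k \<le> real n powr \<delta>"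
      unfolding e'' x_def[symmetric] e'[symmetric] by (rule e)
  qed
qed

theorem lemma3p4:
  fixes c :: real
  assumes "0 < c" and "c < 1"
  shows "\<exists>K::real. K > 0 \<and>
    (\<forall>(k::nat) (n::nat) (\<epsilon>::real) (P :: nat \<Rightarrow> real vec pmf) (Q :: nat \<Rightarrow> real vec pmf).
       2 \<le> k \<longrightarrow>
       real k powr (K * real k) \<le> real n \<longrightarrow>
       \<epsilon> = real n powr (- c) \<longrightarrow>
       (\<forall>r<n. categorical k (P r)) \<longrightarrow>
       (\<forall>r<n. categorical k (Q r)) \<longrightarrow>
       all_eigenvalues_but_one_ge (covariance_mat k (pmd k {..<n} P)) (\<epsilon> * real n / real k) \<longrightarrow>
       all_eigenvalues_but_one_ge (covariance_mat k (pmd k {..<n} Q)) (\<epsilon> * real n / real k) \<longrightarrow>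
       (\<forall>i<k. \<forall>m \<in> carrier_vec k. real (moment_degree m) \<le> (2 + 2 * c) / (1 - c) \<longrightarrow>
          \<bar>parameter_moment k (maximal_indices n k P i) P m
            - parameter_moment k (maximal_indices n k Q i) Q m\<bar> \<le> real n powr (- c)) \<longrightarrow>
       tv_dist (pmd k {..<n} P) (pmd k {..<n} Q) \<le> \<epsilon>)"
proof -
  define a where "a = (1 - c) / 2"
  define B where "B = (2 + 2 * c) / (1 - c)"
  define L where "L = nat \<lfloor>B\<rfloor>"
  \<comment> \<open>The smaller of two gains over \<open>n^(-c)\<close>: \<open>a\<close> in the
    moment term, from one factor \<open>\<rho>\<close>, and \<open>a * (L + 1) - 1 - c\<close> in
    the tail. The latter is positive because \<open>a * B = 1 + c\<close> and
    \<open>B < L + 1\<close>.\<close>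
  define \<gamma> where "\<gamma> = min a (a * real (Suc L) - 1 - c)"
  \<comment> \<open>The gain is spent on \<open>L + 4\<close> factors \<open>n^\<delta>\<close>:
    \<open>L + 1\<close> in the tail, one for the number of points, the rest for numerical
    constants.\<close>
  define \<delta> where "\<delta> = \<gamma> / real (L + 4)"
  have a: "0 < a" "a \<le> 1 / 2" "2 * a = 1 - c" using assms by (auto simp: a_def)
  have aB: "a * B = 1 + c" using assms by (simp add: a_def B_def field_simps)
  have B0: "0 \<le> B" using assms by (simp add: B_def)
  have L: "real l \<le> B" if "l \<le> L" for l using that B0 unfolding L_def by linarith
  have "B < real (Suc L)" using B0 unfolding L_def by linarith
  hence "a * B < a * real (Suc L)" using a by simp
  hence \<gamma>: "0 < \<gamma>" "\<gamma> \<le> a" "\<gamma> \<le> a * real (Suc L) - 1 - c" using a aB by (auto simp: \<gamma>_def)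
  have \<delta>: "0 < \<delta>" "\<delta> * real (L + 4) = \<gamma>" using \<gamma> by (auto simp: \<delta>_def)
  have "\<delta> * 1 \<le> \<delta> * real (L + 4)" using \<delta>(1) by (intro mult_left_mono) auto
  hence \<delta>a: "\<delta> \<le> a" using \<delta>(2) \<gamma>(2) by simp
  obtain K where K: "0 < K" and growth: "\<And>k n. 2 \<le> k \<Longrightarrow> real k powr (K * real k) \<le> real n \<Longrightarrow>
    1 \<le> ln (real n) \<and> (64 * real k ^ 3 * ln (real n)) ^ k \<le> real n powr \<delta>"
    using polylog_power_le_powr[OF \<delta>(1)] by blast
  show ?thesis
  proof (intro exI[of _ K] conjI allI impI)
    show "K > 0" by (rule K)
    fix k n :: nat and \<epsilon> :: real and P Q :: "nat \<Rightarrow> real vec pmf"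
    assume k: "2 \<le> k" and n: "real k powr (K * real k) \<le> real n" and \<epsilon>: "\<epsilon> = real n powr (- c)"
      and P: "\<forall>r<n. categorical k (P r)" and Q: "\<forall>r<n. categorical k (Q r)"
      and evP: "all_eigenvalues_but_one_ge (covariance_mat k (pmd k {..<n} P)) (\<epsilon> * real n / real k)"
      and evQ: "all_eigenvalues_but_one_ge (covariance_mat k (pmd k {..<n} Q)) (\<epsilon> * real n / real k)"
      and mom: "\<forall>i<k. \<forall>m \<in> carrier_vec k. real (moment_degree m) \<le> (2 + 2 * c) / (1 - c) \<longrightarrow>
          \<bar>parameter_moment k (maximal_indices n k P i) P m
            - parameter_moment k (maximal_indices n k Q i) Q m\<bar> \<le> real n powr (- c)"
    define N where "N = real n"
    define x where "x = ln N"
    \<comment> \<open>One quantity above every polynomial factor in \<open>k\<close> and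
      \<open>x\<close> that occurs below; by the choice of \<open>K\<close> even its
      \<open>k\<close>-th power is at most \<open>g\<close>.\<close>
    define G where "G = 64 * real k ^ 3 * x"
    define g where "g = N powr \<delta>"
    define t where "t = \<epsilon> * N / real k"
    \<comment> \<open>Makes the Chernoff term \<open>exp (- \<tau>\<^sup>2 / 4)\<close> equal to
      \<open>N^(-2)\<close>.\<close>
    define \<tau> where "\<tau> = sqrt (8 * x)"
    \<comment> \<open>As \<open>(k + 1)^2 \<le> 4 k^2\<close>, the decay at the remaining
      frequencies is at most \<open>exp (- 3 k x) = N^(-3k)\<close>, which outweighs the factor
      \<open>sqrt N ^ (k - 1)\<close>.\<close>
    define R where "R = 3 * real k ^ 3 * x"
    define \<rho> where "\<rho> = 2 * pi * sqrt (2 * R / t)"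
    define \<Delta> where "\<Delta> = 2 * (real k)\<^sup>2 * \<epsilon> * \<rho> + 4 * N * \<rho> ^ Suc L"
    \<comment> \<open>\<open>u\<close> is the order of \<open>\<rho>\<close> up to factors in
      \<open>k\<close> and \<open>x\<close>, and \<open>w\<close> is the size that every error must
      reach before those factors are counted.\<close>
    define u where "u = N powr (- a)"
    define w where "w = N powr (- c - \<gamma>)"
    have x1: "1 \<le> x" and Gk: "G ^ k \<le> g"
      using growth[OF k n] by (simp_all add: x_def N_def G_def g_def)
    have N1: "1 < N"
    proof -
      have "0 < real k powr (K * real k)" using k by simp
      hence "0 < N" using n unfolding N_def by linarith
      hence "1 < N \<longleftrightarrow> 0 < x" by (simp add: x_def)
      thus ?thesis using x1 by simp
    qed
    have Nx: "N = exp x" using N1 by (simp add: x_def)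
    have k2: "2 \<le> real k" using k by simp
    have k1: "1 \<le> real k" using k2 by simp
    define C where "C = real k ^ 3"
    have k3: "8 \<le> C" "real k \<le> C" "2 * (real k)\<^sup>2 \<le> C"
    proof -
      show "8 \<le> C" using power_mono[OF k2, of 3] by (simp add: C_def)
      show "real k \<le> C" using power_increasing[of 1 3 "real k"] k1 by (simp add: C_def)
      show "2 * (real k)\<^sup>2 \<le> C"
        using mult_right_mono[OF k2, of "(real k)\<^sup>2"] by (simp add: C_def power2_eq_square power3_eq_cube)
    qed
    have kx: "C \<le> C * x" "8 * x \<le> C * x" "real k * x \<le> C * x"
      using x1 k3 by (simp_all add: mult_right_mono)
    have GC: "G = 64 * (C * x)" by (simp add: G_def C_def)
    have G: "512 \<le> G" "2 * real k \<le> G" "4 * real k * x \<le> G" "2 * (real k)\<^sup>2 \<le> G" "24 * x \<le> G"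
      using kx k3 x1 unfolding GC by linarith+
    have GG: "G ^ 2 \<le> g" using power_increasing[of 2 k G] k G(1) Gk by linarith
    have Gg: "G \<le> g" using power_increasing[of 1 k G] k G(1) Gk by simp
    have "G ^ (k - 1) \<le> G ^ k" using G(1) by (intro power_increasing) auto
    hence Gd: "G ^ (k - 1) \<le> g" using Gk by linarith
    have g1: "1 \<le> g" using Gg G(1) by simp
    have u: "0 < u" "u\<^sup>2 = N powr (c - 1)"
      using N1 a(3) by (simp_all add: u_def powr_power mult.commute)
    have \<epsilon>0: "0 < \<epsilon>" "\<epsilon> < 1" using \<epsilon> N1 assms powr_less_mono[of "-c" 0 N] by (auto simp: N_def)
    have \<epsilon>N: "\<epsilon> * N * u\<^sup>2 = 1"
      using N1 by (simp add: u(2) \<epsilon> N_def[symmetric] powr_mult_base powr_add[symmetric] mult.commute)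
    have gu: "g * u \<le> 1"
    proof -
      have "g * u = N powr (\<delta> - a)" by (simp add: g_def u_def powr_add[symmetric])
      also have "\<dots> \<le> N powr 0" using N1 \<delta>a by (intro powr_mono) auto
      finally show ?thesis using N1 by simp
    qed
    have w0: "0 < w" using N1 by (simp add: w_def)
    have wu: "\<epsilon> * u \<le> w"
    proof -
      have "\<epsilon> * u = N powr (- c - a)" by (simp add: \<epsilon> u_def N_def powr_add[symmetric])
      thus ?thesis using N1 \<gamma>(2) unfolding w_def by (simp add: powr_mono)
    qed
    have wN: "N * u ^ Suc L \<le> w"
    proof -
      have "u ^ Suc L = N powr (- a * real (Suc L))"
        using N1 by (simp add: u_def powr_power mult.commute del: power_Suc)
      hence "N * u ^ Suc L = N powr (1 - a * real (Suc L))"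
        using N1 by (simp add: powr_diff powr_minus field_simps del: power_Suc of_nat_Suc)
      thus ?thesis using N1 \<gamma>(3) unfolding w_def by (simp add: powr_mono del: power_Suc of_nat_Suc)
    qed
    have w2: "exp (- 2 * x) \<le> w"
    proof -
      have "exp (- 2 * x) = N powr (- 2)" using N1 by (simp add: powr_def x_def)
      thus ?thesis using N1 \<gamma>(2) a(2) assms unfolding w_def by (simp add: powr_mono)
    qed
    have gw: "g ^ (L + 4) * w = \<epsilon>"
    proof -
      have "g ^ (L + 4) = N powr (\<delta> * real (L + 4))"
        using N1 unfolding g_def by (simp add: powr_power mult.commute del: of_nat_add)
      hence "g ^ (L + 4) * w = N powr (\<gamma> + (- c - \<gamma>))"
        unfolding \<delta>(2) w_def by (simp only: powr_add)
      thus ?thesis by (simp add: \<epsilon> N_def)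
    qed
    have gpow: "g ^ i \<le> g ^ j" if "i \<le> j" for i j using that g1 by (rule power_increasing)

    \<comment> \<open>This is \<open>\<tau>\<^sup>2 \<le> 2 * t\<close>, and it also yields
      \<open>2 \<le> t\<close>. Since \<open>\<epsilon> * N = 1 / u\<^sup>2\<close>, it amounts to
      \<open>4 k x u\<^sup>2 \<le> 1\<close>, which follows from \<open>4 k x \<le> g\<close> and
      \<open>g u \<le> 1\<close>.\<close>
    have t: "4 * x \<le> t"
    proof -
      have "1 * (4 * real k * x) * u\<^sup>2 \<le> (\<epsilon> * N * u\<^sup>2) * 1"
      proof -
        have "u \<le> g * u" using g1 u by simp
        hence "u \<le> 1" using gu by simp
        have "4 * real k * x * u\<^sup>2 \<le> g * u\<^sup>2" using G(3) Gg by (intro mult_right_mono) auto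
        also have "\<dots> = (g * u) * u" by (simp add: power2_eq_square)
        also have "\<dots> \<le> 1 * 1" using gu \<open>u \<le> 1\<close> u by (intro mult_mono) auto
        finally show ?thesis by (simp add: \<epsilon>N)
      qed
      hence "4 * real k * x \<le> \<epsilon> * N" using u(1) by simp
      thus ?thesis using k1 by (simp add: t_def field_simps)
    qed
    have t0: "0 < t" using t x1 by simp
    have R1: "1 \<le> R" 
    proof -
      have "R = 3 * (C * x)" by (simp add: R_def C_def)
      thus ?thesis using kx k3 by linarith
    qed
    have \<rho>G: "\<rho> \<le> 16 * x * (real k)\<^sup>2 * u"
    proof -
      have "1 / t = real k * u\<^sup>2" using \<epsilon>N \<epsilon>0 N1 k1 u by (simp add: t_def field_simps)
      hence "2 * R / t = 2 * R * (real k * u\<^sup>2)" by (metis mult.commute times_divide_eq_right mult_1)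
      also have "\<dots> = 6 * x * ((real k)\<^sup>2 * u)\<^sup>2"
        by (simp add: R_def power2_eq_square power3_eq_cube mult_ac)
      \<comment> \<open>The constant 16 arises from \<open>6 x \<le> (5/2 x)^2\<close> for
        \<open>x \<ge> 1\<close> and \<open>2 * pi \<le> 6.4\<close>.\<close>
      also have "\<dots> \<le> (5 / 2 * x)\<^sup>2 * ((real k)\<^sup>2 * u)\<^sup>2"
        using x1 mult_mono[of 6 "25 / 4 * x" x x] by (intro mult_right_mono) (auto simp: power2_eq_square)
      also have "\<dots> = (5 / 2 * x * ((real k)\<^sup>2 * u))\<^sup>2" by (simp only: power_mult_distrib)
      finally have "sqrt (2 * R / t) \<le> 5 / 2 * x * ((real k)\<^sup>2 * u)"
        using x1 u by (intro real_le_lsqrt) auto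
      hence "\<rho> \<le> (2 * (32 / 10)) * (5 / 2 * x * ((real k)\<^sup>2 * u))"
        unfolding \<rho>_def using pi_approx x1 u R1 t0 by (intro mult_mono) auto
      thus ?thesis by (simp add: mult_ac)
    qed
    have \<rho>0: "0 \<le> \<rho>" using R1 t0 by (simp add: \<rho>_def)
    have k\<rho>: "real k * \<rho> \<le> 1 / 2"
    proof -
      have "real k * \<rho> \<le> real k * (16 * x * (real k)\<^sup>2 * u)" using \<rho>G by (intro mult_left_mono) auto
      also have "\<dots> = G * u / 4" by (simp add: G_def power2_eq_square power3_eq_cube)
      also have "\<dots> \<le> g * u / 4" using Gg u by simp
      finally show ?thesis using gu by simp
    qed
    have \<rho>u: "\<rho> \<le> G * u"
    proof -
      have "16 * x * (real k)\<^sup>2 \<le> G" using mult_right_mono[OF k3(3), of x] x1 kx unfolding GC by (simp add: mult_ac)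
      hence "16 * x * (real k)\<^sup>2 * u \<le> G * u" using u by (intro mult_right_mono) auto
      thus ?thesis using \<rho>G by linarith
    qed
    \<comment> \<open>The moment term contains one factor \<open>u\<close> beside
      \<open>\<epsilon>\<close>, the tail \<open>L + 1\<close> factors \<open>u\<close> against the
      leading \<open>N\<close>. The constant 5 is 1 + 4.\<close>
    have \<Delta>w: "\<Delta> \<le> 5 * g ^ Suc L * w"
    proof -
      have "2 * (real k)\<^sup>2 * \<epsilon> * \<rho> \<le> G * \<epsilon> * (G * u)"
        using G \<epsilon>0 \<rho>0 \<rho>u by (intro mult_mono mult_right_mono) auto
      also have "\<dots> = G ^ 2 * (\<epsilon> * u)" by (simp add: power2_eq_square)
      also have "\<dots> \<le> g ^ 1 * w" using GG wu \<epsilon>0 u g1 by (intro mult_mono) auto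
      also have "\<dots> \<le> g ^ Suc L * w" using w0 by (intro mult_right_mono gpow) auto
      finally have 1: "2 * (real k)\<^sup>2 * \<epsilon> * \<rho> \<le> g ^ Suc L * w" .
      have "N * \<rho> ^ Suc L \<le> N * (G * u) ^ Suc L"
        using \<rho>0 \<rho>u N1 by (intro mult_left_mono power_mono) auto
      also have "\<dots> = G ^ Suc L * (N * u ^ Suc L)" by (simp add: power_mult_distrib del: power_Suc)
      also have "\<dots> \<le> g ^ Suc L * w"
        using Gg G(1) wN N1 u by (intro mult_mono power_mono) auto
      finally have 2: "N * \<rho> ^ Suc L \<le> g ^ Suc L * w" .
      have "\<Delta> = 2 * (real k)\<^sup>2 * \<epsilon> * \<rho> + 4 * (N * \<rho> ^ Suc L)" by (simp add: \<Delta>_def)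
      thus ?thesis using 1 2 by linarith
    qed
    have \<Delta>1: "\<Delta> \<le> 1"
    proof -
      have "5 * g ^ Suc L * w \<le> g * g ^ Suc L * w"
        using Gg G(1) w0 g1 by (intro mult_right_mono) auto
      also have "\<dots> = g ^ Suc (Suc L) * w" by simp
      also have "\<dots> \<le> g ^ (L + 4) * w" using w0 by (intro mult_right_mono gpow) auto
      finally show ?thesis using \<Delta>w gw \<epsilon>0 by linarith
    qed
    have \<Delta>0: "0 \<le> \<Delta>" using \<epsilon>0 \<rho>0 N1 by (simp add: \<Delta>_def)
    have \<tau>x: "\<tau> \<le> 8 * x"
      unfolding \<tau>_def using x1 mult_mono[of 8 "8 * (8 * x)" x x] by (intro real_le_lsqrt) (auto simp: power2_eq_square)
    have \<tau>1: "1 \<le> \<tau>" using x1 by (simp add: \<tau>_def)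
    have \<tau>2: "\<tau>\<^sup>2 = 8 * x" using x1 by (simp add: \<tau>_def)

    have "tv_dist (pmd k {..<n} P) (pmd k {..<n} Q) \<le>
      2 * real (k - 1) * exp (- \<tau>\<^sup>2 / 4) + 2 * (9 * \<tau> * sqrt R) ^ (k - 1) * (2 * \<Delta>)
      + 2 * (3 * \<tau> * sqrt (real n)) ^ (k - 1) * exp (- 4 * R / (real k + 1)\<^sup>2)"
    proof (rule tv_dist_pmd_bound[OF P Q k])
      show "all_eigenvalues_but_one_ge (covariance_mat k (pmd k {..<n} P)) t"
        "all_eigenvalues_but_one_ge (covariance_mat k (pmd k {..<n} Q)) t"
        using evP evQ by (simp_all add: t_def N_def)
      show "\<bar>parameter_moment k (maximal_indices n k P i) P m
         - parameter_moment k (maximal_indices n k Q i) Q m\<bar> \<le> \<epsilon>"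
        if "i < k" "m \<in> carrier_vec k" "moment_degree m \<le> L" for i m
        using mom L[OF that(3)] that(1,2) unfolding \<epsilon> B_def by blast
      show "\<Delta> = 2 * (real k)\<^sup>2 * \<epsilon> * \<rho> + 4 * real n * \<rho> ^ Suc L" by (simp add: \<Delta>_def N_def)
    qed (use t x1 \<epsilon>0 \<tau>1 \<tau>2 R1 k\<rho> \<Delta>1 in \<open>auto simp: \<rho>_def\<close>)
    also have "2 * real (k - 1) * exp (- \<tau>\<^sup>2 / 4) \<le> g ^ (L + 2) * w"
    proof -
      have "2 * real (k - 1) * exp (- \<tau>\<^sup>2 / 4) \<le> g ^ 1 * w"
        using G(2) Gg w2 g1 by (intro mult_mono) (auto simp: \<tau>2 of_nat_diff k)
      also have "\<dots> \<le> g ^ (L + 2) * w" using w0 by (intro mult_right_mono gpow) auto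
      finally show ?thesis .
    qed
    also have "2 * (9 * \<tau> * sqrt R) ^ (k - 1) * (2 * \<Delta>) \<le> 20 * (g ^ (L + 2) * w)"
    proof -
      have "\<tau> * sqrt R = sqrt (24 * real k ^ 3 * x\<^sup>2)"
        by (simp add: \<tau>_def R_def real_sqrt_mult[symmetric] power2_eq_square mult_ac)
      also have "\<dots> \<le> 5 * (real k)\<^sup>2 * x"
      proof (rule real_le_lsqrt)
        have "24 * real k ^ 3 \<le> 25 * real k * real k ^ 3" using k1 by (intro mult_right_mono) auto
        hence "24 * real k ^ 3 * x\<^sup>2 \<le> 25 * real k * real k ^ 3 * x\<^sup>2" by (rule mult_right_mono) simp
        thus "24 * real k ^ 3 * x\<^sup>2 \<le> (5 * (real k)\<^sup>2 * x)\<^sup>2"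
          by (simp add: power2_eq_square power3_eq_cube mult_ac)
      qed (use x1 in auto)
      finally have "9 * (\<tau> * sqrt R) \<le> 9 * (5 * (real k)\<^sup>2 * x)" by (rule mult_left_mono) simp
      hence "9 * \<tau> * sqrt R \<le> 45 * ((real k)\<^sup>2 * x)" by (simp add: mult.assoc)
      also have "\<dots> \<le> G" using mult_right_mono[OF k3(3), of x] x1 kx unfolding GC by (simp add: mult_ac)
      finally have "(9 * \<tau> * sqrt R) ^ (k - 1) \<le> G ^ (k - 1)"
        using \<tau>1 R1 by (intro power_mono) auto
      hence "(9 * \<tau> * sqrt R) ^ (k - 1) \<le> g" using Gd by linarith
      hence "(9 * \<tau> * sqrt R) ^ (k - 1) * \<Delta> \<le> g * (5 * g ^ Suc L * w)"
        using \<Delta>w \<Delta>0 g1 by (intro mult_mono) auto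
      thus ?thesis by (simp add: mult_ac)
    qed
    also have "2 * (3 * \<tau> * sqrt (real n)) ^ (k - 1) * exp (- 4 * R / (real k + 1)\<^sup>2) \<le> 2 * (g ^ (L + 2) * w)"
    proof -
      have 1: "(3 * \<tau>) ^ (k - 1) \<le> g"
        using power_mono[of "3 * \<tau>" G "k - 1"] \<tau>x G(5) \<tau>1 Gd by linarith
      have "sqrt N ^ (k - 1) \<le> N ^ (k - 1)"
        using N1 by (intro power_mono real_le_lsqrt) (auto simp: power2_eq_square)
      also have "\<dots> \<le> N ^ k" using N1 by (intro power_increasing) auto
      also have "\<dots> = exp (real k * x)" by (simp add: Nx exp_of_nat_mult)
      finally have 2: "sqrt N ^ (k - 1) \<le> exp (real k * x)" .
      have "3 * (real k * x) \<le> 4 * R / (real k + 1)\<^sup>2"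
      proof -
        have "(real k + 1)\<^sup>2 \<le> (2 * real k)\<^sup>2" using k1 by (intro power_mono) auto
        hence "3 * (real k * x) * (real k + 1)\<^sup>2 \<le> 3 * (real k * x) * (2 * real k)\<^sup>2"
          using x1 by (intro mult_left_mono) auto
        also have "\<dots> = 4 * R" by (simp add: R_def power2_eq_square power3_eq_cube)
        finally show ?thesis using k1 by (simp add: pos_le_divide_eq)
      qed
      hence "exp (- 4 * R / (real k + 1)\<^sup>2) \<le> exp (- (3 * (real k * x)))" by simp
      hence "sqrt N ^ (k - 1) * exp (- 4 * R / (real k + 1)\<^sup>2) \<le> exp (real k * x) * exp (- (3 * (real k * x)))"
        using 2 by (intro mult_mono) auto
      also have "\<dots> = exp (- 2 * (real k * x))" by (simp add: exp_add[symmetric])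
      also have "\<dots> \<le> exp (- 2 * x)" using k1 x1 by simp
      finally have "sqrt N ^ (k - 1) * exp (- 4 * R / (real k + 1)\<^sup>2) \<le> w" using w2 by linarith
      hence "(3 * \<tau>) ^ (k - 1) * (sqrt N ^ (k - 1) * exp (- 4 * R / (real k + 1)\<^sup>2)) \<le> g ^ 1 * w"
        using 1 g1 N1 by (intro mult_mono) auto
      also have "\<dots> \<le> g ^ (L + 2) * w" using w0 by (intro mult_right_mono gpow) auto
      finally show ?thesis by (simp add: power_mult_distrib mult_ac N_def)
    qed
    \<comment> \<open>The three errors amount to 1 + 20 + 2 copies of
      \<open>g ^ (L + 2) * w\<close>; one more factor \<open>g \<ge> 512\<close> absorbs the
      23.\<close>
    also have "g ^ (L + 2) * w + 20 * (g ^ (L + 2) * w) + 2 * (g ^ (L + 2) * w) = 23 * g ^ (L + 2) * w" by simp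
    also have "\<dots> \<le> g * g ^ (L + 2) * w" using Gg G(1) w0 g1 by (intro mult_right_mono) auto
    also have "\<dots> = g ^ (L + 3) * w" by (simp add: eval_nat_numeral)
    also have "\<dots> \<le> g ^ (L + 4) * w" using w0 by (intro mult_right_mono gpow) auto
    finally show "tv_dist (pmd k {..<n} P) (pmd k {..<n} Q) \<le> \<epsilon>" using gw by simp
  qed
qed

end
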